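(* Let $K$ be a field, let $r,s\ge 1$ be integers, $A=K[x_1,\ldots,x_r]$, $B=K[x_{r+1},\ldots,x_{r+s}]$ and $R=K[x_1,\ldots,x_{r+s}]$. Let $I\subset A$ be a nonzero proper monomial ideal and let $J\subset B$ be a nonzero proper complete intersection monomial ideal. Then for all integers $n\ge 1$: (1) $\operatorname{depth}(R/(I+J)^n)=\min_{1\le i\le n}\{\operatorname{depth}_A(A/I^i)+\dim(B/J)\}$. (2) $r+\dim(B/J)\ \ge\ \operatorname{sdepth}_R(R/(I+J)^n)\ \ge\ \min_{1\le i\le n}\{\operatorname{sdepth}_A(A/I^i)+\dim(B/J)\}$. (3) In particular, if $\operatorname{sdepth}_A(A/I^i)\ge\operatorname{depth}_A(A/I^i)$ for all $1\le i\le n$, then $\operatorname{sdepth}_R(R/(I+J)^n)\ge\operatorname{depth}(R/(I+J)^n)$; and likewise, if $\operatorname{sdepth}_A(A/I^i)\ge\operatorname{depth}_A(A/I^i)-1$ for all $1\le i\le n$, then $\operatorname{sdepth}_R(R/(I+J)^n)\ge\operatorname{depth}(R/(I+J)^n)-1$. (4) $\operatorname{sdepth}_R(R/(I+J)^{n+1})\le\operatorname{sdepth}_R(R/(I+J)^n)$, $\ \operatorname{sdepth}_R((I+J)^{n+1})\le\operatorname{sdepth}_R((I+J)^n)$, and $\operatorname{sdepth}_R((I+J)^{n+1}/(I+J)^{n+2})\le\operatorname{sdepth}_R((I+J)^n/(I+J)^{n+1})$. Moreover: (5) The numerical functions $n\mapsto\operatorname{sdepth}_R(R/(I+J)^n)$,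 $n\mapsto\operatorname{sdepth}_R((I+J)^n)$ and $n\mapsto\operatorname{sdepth}_R((I+J)^n/(I+J)^{n+1})$ are constant for $n\gg 0$.
   Context: The symbols $I$, $J$ also denote the extended ideals $IR$, $JR$ in $R$, so $I+J$ means $IR+JR\subset R$. A monomial ideal is a complete intersection if its minimal monomial generators form a regular sequence, equivalently, if they have pairwise disjoint supports (no variable divides two distinct minimal generators). $\dim$ is Krull dimension, and depth is taken with respect to the homogeneous maximal ideal. Stanley depth: let $S$ be a polynomial ring over $K$ in $N$ variables $x_1,\ldots,x_N$ and let $M$ be a finitely generated $\mathbb Z^N$-graded $S$-module. A Stanley decomposition of $M$ is a finite direct sum decomposition $\mathcal D: M=\bigoplus_{i=1}^{q} m_iK[Z_i]$ as a $\mathbb Z^N$-graded $K$-vector space, where each $m_i\in M$ is homogeneous, $Z_i\subset\{x_1,\ldots,x_N\}$, and $m_iK[Z_i]=\{um_i: u\in K[Z_i]\}$ is a free $K[Z_i]$-submodule of $M$. Put $\operatorname{sdepth}(\mathcal D)=\min_i|Z_i|$ and let $\operatorname{sdepth}_S(M)$ be the maximum of $\operatorname{sdepth}(\mathcal D)$ over all Stanley decompositions $\mathcal D$ of $M$. *)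

theory Defs
  imports
    "HOL-Library.Poly_Mapping" "HOL-Library.Extended_Nat"
    "HOL-Algebra.Module" "HOL-Algebra.Divisibility" "HOL-Algebra.QuotRing" "HOL-Algebra.Ideal_Product"
begin

section \<open>Polynomial rings and monomial ideals\<close>

text \<open>
  Polynomials over \<open>'k\<close> in the variables \<open>x\<^sub>v\<close>, \<open>v :: nat\<close>: an exponent vector is a finitely
  supported function \<open>nat \<Rightarrow>\<^sub>0 nat\<close>, and multiplication is the convolution product.
\<close>

type_synonym 'k mpoly = "(nat \<Rightarrow>\<^sub>0 nat) \<Rightarrow>\<^sub>0 'k"

definition polys :: "nat set \<Rightarrow> 'k::field mpoly set" where
  "polys V = {p. \<forall>t \<in> Poly_Mapping.keys p. Poly_Mapping.keys t \<subseteq> V}"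

text \<open>
  \<open>poly_ring V\<close> is the ring \<open>K[x\<^sub>v : v \<in> V]\<close>; for \<open>V \<subseteq> W\<close> the ring \<open>poly_ring V\<close> is literally a
  subring of \<open>poly_ring W\<close>.
\<close>

definition poly_ring :: "nat set \<Rightarrow> 'k::field mpoly ring" where
  "poly_ring V = \<lparr>carrier = polys V, monoid.mult = (*), one = 1, ring.zero = 0, add = (+)\<rparr>"

definition monomial :: "(nat \<Rightarrow>\<^sub>0 nat) \<Rightarrow> 'k::field mpoly" where
  "monomial t = Poly_Mapping.single t 1"

definition monomials :: "nat set \<Rightarrow> 'k::field mpoly set" where
  "monomials V = monomial ` {t. Poly_Mapping.keys t \<subseteq> V}"

definition irrelevant_ideal :: "nat set \<Rightarrow> 'k::field mpoly set" where
  "irrelevant_ideal V = Idl\<^bsub>poly_ring V\<^esub> ((\<lambda>v. monomial (Poly_Mapping.single v 1)) ` V)"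

definition monomial_ideal :: "nat set \<Rightarrow> 'k::field mpoly set \<Rightarrow> bool" where
  "monomial_ideal V I \<longleftrightarrow> (\<exists>S \<subseteq> monomials V. I = Idl\<^bsub>poly_ring V\<^esub> S)"

definition minimal_monomial_generators :: "nat set \<Rightarrow> 'k::field mpoly set \<Rightarrow> 'k mpoly set" where
  "minimal_monomial_generators V I =
     {f \<in> monomials V \<inter> I. \<forall>g \<in> monomials V \<inter> I. g divides\<^bsub>poly_ring V\<^esub> f \<longrightarrow> g = f}"


section \<open>Graded modules\<close>

text \<open>
  The field \<open>component\<close> gives the homogeneous component of each degree. The degree group
  \<open>\<int>\<^sup>N\<close> is rendered by \<open>nat \<Rightarrow>\<^sub>0 int\<close>; for the modules below, the components of degrees with
  support outside the set of variables are zero.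
  The fields \<open>mult\<close> and \<open>one\<close>, which \<^locale>\<open>module\<close> inherits but does not use, carry no meaning.
\<close>

record ('a, 'b) graded_module = "('a, 'b) module" +
  component :: "(nat \<Rightarrow>\<^sub>0 int) \<Rightarrow> 'b set"

definition homogeneous :: "(nat \<Rightarrow>\<^sub>0 int) \<Rightarrow> 'k::field mpoly set" where
  "homogeneous a = {p. \<forall>t \<in> Poly_Mapping.keys p. Poly_Mapping.map int t = a}"

text \<open>A monomial ideal \<open>U\<close> of the polynomial ring, possibly the whole ring, as a graded module.\<close>

definition ideal_module :: "'k::field mpoly set \<Rightarrow> ('k mpoly, 'k mpoly) graded_module" where
  "ideal_module U =
     \<lparr>carrier = U, monoid.mult = (*), one = 1, ring.zero = 0, add = (+), smult = (*),
      component = (\<lambda>a. U \<inter> homogeneous a)\<rparr>"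

text \<open>The quotient \<open>M/N\<close>, consisting of the cosets of \<open>N\<close>, with the induced grading.\<close>

definition quotient_module ::
    "('a, 'b) graded_module \<Rightarrow> 'b set \<Rightarrow> ('a, 'b set) graded_module" where
  "quotient_module M N =
     \<lparr>carrier = a_rcosets\<^bsub>M\<^esub> N, monoid.mult = undefined, one = undefined, ring.zero = N,
      add = set_add M,
      smult = (\<lambda>f X. \<Union>x\<in>X. N +>\<^bsub>M\<^esub> (f \<odot>\<^bsub>M\<^esub> x)),
      component = (\<lambda>a. (\<lambda>x. N +>\<^bsub>M\<^esub> x) ` component M a)\<rparr>"

abbreviation residue_module ::
    "nat set \<Rightarrow> 'k::field mpoly set \<Rightarrow> ('k mpoly, 'k mpoly set) graded_module" where
  "residue_module V U \<equiv> quotient_module (ideal_module (carrier (poly_ring V))) U"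


section \<open>Regular sequences, depth, Krull dimension\<close>

text \<open>The submodule \<open>(f\<^sub>1, \<dots>, f\<^sub>k) M\<close>.\<close>

definition seq_submodule :: "('a, 'b, 'm) module_scheme \<Rightarrow> 'a list \<Rightarrow> 'b set" where
  "seq_submodule M fs =
     {(\<Oplus>\<^bsub>M\<^esub> j \<in> {..<length fs}. (fs ! j) \<odot>\<^bsub>M\<^esub> m j) | m. m \<in> {..<length fs} \<rightarrow> carrier M}"

text \<open>
  The first condition says that \<open>f\<^sub>i\<close> is a nonzerodivisor on \<open>M/(f\<^sub>1, \<dots>, f\<^bsub>i-1\<^esub>)M\<close>, the second that
  \<open>M/(f\<^sub>1, \<dots>, f\<^sub>k)M\<close> is nonzero.
\<close>

definition regular_sequence ::
    "('a, 'n) ring_scheme \<Rightarrow> ('a, 'b, 'm) module_scheme \<Rightarrow> 'a list \<Rightarrow> bool" where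
  "regular_sequence R M fs \<longleftrightarrow>
     set fs \<subseteq> carrier R \<and>
     (\<forall>i < length fs. \<forall>x \<in> carrier M.
        (fs ! i) \<odot>\<^bsub>M\<^esub> x \<in> seq_submodule M (take i fs) \<longrightarrow> x \<in> seq_submodule M (take i fs)) \<and>
     seq_submodule M fs \<noteq> carrier M"

definition depth :: "nat set \<Rightarrow> ('k::field mpoly, 'b, 'm) module_scheme \<Rightarrow> enat" where
  "depth V M =
     Sup {enat (length fs) | fs.
       regular_sequence (poly_ring V) M fs \<and> set fs \<subseteq> irrelevant_ideal V}"

definition krull_dim :: "('a, 'n) ring_scheme \<Rightarrow> enat" where
  "krull_dim R =
     Sup {enat l | l. \<exists>P. (\<forall>i \<le> l. primeideal (P i) R) \<and> (\<forall>i < l. P i \<subset> P (Suc i))}"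

text \<open>
  For an ideal \<open>J\<close> of \<open>poly_ring V\<close> that is monomial and proper; \<open>fs\<close> enumerates the minimal
  monomial generators.
\<close>

definition complete_intersection :: "nat set \<Rightarrow> 'k::field mpoly set \<Rightarrow> bool" where
  "complete_intersection V J \<longleftrightarrow>
     (\<exists>fs. distinct fs \<and> set fs = minimal_monomial_generators V J \<and>
        regular_sequence (poly_ring V) (ideal_module (carrier (poly_ring V))) fs)"


section \<open>Stanley depth\<close>

definition stanley_space :: "('k::field mpoly, 'b, 'm) module_scheme \<Rightarrow> 'b \<Rightarrow> nat set \<Rightarrow> 'b set" where
  "stanley_space M m Z = {u \<odot>\<^bsub>M\<^esub> m | u. u \<in> polys Z}"

text \<open>
  Injectivity of \<open>u \<mapsto> u m\<close> says that \<open>m K[Z]\<close> is free over \<open>K[Z]\<close> with basis \<open>m\<close>; in particular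
  \<open>m \<noteq> 0\<close>. The last condition is the direct sum decomposition; as each \<open>m\<close> is homogeneous,
  the summands are automatically graded subspaces.
\<close>

definition stanley_decomposition ::
    "nat set \<Rightarrow> ('k::field mpoly, 'b) graded_module \<Rightarrow> ('b \<times> nat set) list \<Rightarrow> bool" where
  "stanley_decomposition V M D \<longleftrightarrow>
     (\<forall>(m, Z) \<in> set D.
        m \<in> carrier M \<and> (\<exists>a. m \<in> component M a) \<and> Z \<subseteq> V \<and>
        inj_on (\<lambda>u. u \<odot>\<^bsub>M\<^esub> m) (polys Z)) \<and>
     (\<forall>x \<in> carrier M.
        \<exists>!w. w \<in> (\<Pi>\<^sub>E i \<in> {..<length D}. stanley_space M (fst (D ! i)) (snd (D ! i))) \<and>
             x = (\<Oplus>\<^bsub>M\<^esub> i \<in> {..<length D}. w i))"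

text \<open>
  The infimum is the minimum of the \<open>|Z\<^sub>i|\<close>; a zero module has only the empty decomposition,
  so its Stanley depth is \<open>\<infinity>\<close>.
\<close>

definition sdepth :: "nat set \<Rightarrow> ('k::field mpoly, 'b) graded_module \<Rightarrow> enat" where
  "sdepth V M = Sup {(INF (m, Z) \<in> set D. enat (card Z)) | D. stanley_decomposition V M D}"

end

theory Submission
  imports Defs
begin

text \<open>
  Monomial ideals are handled through their sets of exponent vectors. If \<open>f\<^sub>1, \<dots>, f\<^sub>k\<close> are the
  minimal generators of \<open>J\<close>, which have disjoint supports, and \<open>ord v\<close> is the sum over \<open>j\<close> of the
  multiplicities of \<open>f\<^sub>j\<close> in \<open>v\<close>, then a monomial \<open>u v\<close>, with \<open>u\<close> in \<open>A\<close> and \<open>v\<close> in \<open>B\<close>, lies in \<open>(I + J)\<^sup>n\<close>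
  iff \<open>u\<close> lies in the power of \<open>I\<close> with exponent \<open>n - ord v\<close>.

  Stanley depth: Stanley decompositions amount to partitions of sets of exponents into cones. The
  monomials of \<open>B\<close> of a given order split into cones of dimension \<open>s - k\<close>, which are multiplied with
  decompositions of the \<open>A/I\<^sup>i\<close> to give the lower bound. A cone outside \<open>(I + J)\<^sup>n\<close> misses a variable of
  each \<open>f\<^sub>j\<close>, which gives the upper bound, and monotonicity follows from \<open>((I + J)\<^bsup>n+1\<^esup> : f\<^sub>1) = (I + J)\<^sup>n\<close>.

  Depth: if \<open>y\<^sub>1\<close> and \<open>y\<^sub>2\<close> occur in the same \<open>f\<^sub>j\<close>, or if \<open>y\<^sub>2\<close> occurs in no \<open>f\<^sub>j\<close>, then \<open>y\<^sub>1 - y\<^sub>2\<close> is regular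
  modulo \<open>(I + J)\<^sup>n\<close>, and dividing it out gives an ideal of the same kind in one variable less. After
  \<open>s - k\<close> steps each \<open>f\<^sub>j\<close> is a power of a variable; the quotient is then a finite direct sum of copies
  of the modules \<open>A/I\<^sup>i\<close> over \<open>A\<close> on which the remaining variables are nilpotent. By prime avoidance, these
  modules have a common regular sequence, and by Rees' theorem its length is the depth.

  Krull dimension: given primes \<open>Q\<^sub>0 \<subset> \<dots> \<subset> Q\<^sub>l\<close> containing \<open>J\<close>, elements \<open>f\<^sub>i\<close> of \<open>Q\<^sub>i - Q\<^bsub>i-1\<^esub>\<close> are algebraically
  independent modulo \<open>Q\<^sub>0\<close>; comparing the growth of the number of their monomials with that of the
  monomials of \<open>B\<close> outside \<open>Q\<^sub>0\<close> bounds \<open>l\<close> by \<open>s - k\<close>.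
\<close>


section \<open>Regular elements and depth over a Noetherian ring\<close>

text \<open>Depth is defined by regular sequences alone, so the equality in the depth formula must
  also bound sequences that start with an arbitrary element. Rees' theorem removes this obstacle:
  \<open>depth_ge\<close> may be tested on any regular element of one's choice, first on differences
  of two variables, later on elements of \<open>A\<close>. The modules \<open>S/W\<close> are not
  formed for this purpose; a module is represented by the ideal \<open>W\<close>, and dividing out
  \<open>f\<close> means passing to \<open>W + (f)\<close>. Regularity of \<open>x_a - x_b\<close>
  modulo a monomial ideal follows from a condition on exponents: a monomial that enters the ideal
  after multiplication by some power of \<open>x_a\<close>, and also after multiplication by some
  power of \<open>x_b\<close>, already belongs to it. The powers of \<open>I + J\<close> satisfy it,
  because such multiplications can raise the multiplicity of only one \<open>f_j\<close>, and the
  smaller of the two multiplicities obtained is already present. The minimum over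
  \<open>1 \<le> i \<le> n\<close> arises because \<open>n - ord v\<close>, for
  \<open>ord v < n\<close>, takes exactly these values. The constant \<open>s - k\<close> is the
  dimension of \<open>B/J\<close> and also the number of identifications of variables.\<close>

definition is_ideal :: "'a::comm_ring_1 set \<Rightarrow> 'a set \<Rightarrow> bool" where
  "is_ideal S W \<longleftrightarrow> W \<subseteq> S \<and> 0 \<in> W \<and> (\<forall>a\<in>W. \<forall>b\<in>W. a + b \<in> W) \<and> (\<forall>s\<in>S. \<forall>a\<in>W. s * a \<in> W)"

definition adjoin :: "'a::comm_ring_1 set \<Rightarrow> 'a set \<Rightarrow> 'a \<Rightarrow> 'a set" where
  "adjoin S W f = {w + s * f | w s. w \<in> W \<and> s \<in> S}"

definition regular_on :: "'a::comm_ring_1 set \<Rightarrow> 'a set \<Rightarrow> 'a \<Rightarrow> bool" where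
  "regular_on S W f \<longleftrightarrow> (\<forall>x\<in>S. f * x \<in> W \<longrightarrow> x \<in> W)"

text \<open>No nonzero element of \<open>S/W\<close> is killed by \<open>\<mm>\<close>; in
  homological terms, Hom(S/\<mm>, S/W) = 0. Over a Noetherian ring this is positivity of the depth,
  see \<open>depth_ge_1_iff\<close>.\<close>

definition socle_free :: "'a::comm_ring_1 set \<Rightarrow> 'a set \<Rightarrow> 'a set \<Rightarrow> bool" where
  "socle_free S \<mm> W \<longleftrightarrow> (\<forall>a\<in>S. (\<forall>x\<in>\<mm>. x * a \<in> W) \<longrightarrow> a \<in> W)"

text \<open>
  That the quotient by a regular sequence is nonzero is not part of this definition; it holds
  automatically if \<open>W\<close> lies in the proper ideal \<open>\<mm>\<close>.
\<close>

primrec depth_ge :: "'a::comm_ring_1 set \<Rightarrow> 'a set \<Rightarrow> 'a set \<Rightarrow> nat \<Rightarrow> bool" where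
  "depth_ge S \<mm> W 0 \<longleftrightarrow> True"
| "depth_ge S \<mm> W (Suc d) \<longleftrightarrow> (\<exists>f\<in>\<mm>. regular_on S W f \<and> depth_ge S \<mm> (adjoin S W f) d)"

lemma is_idealD:
  assumes "is_ideal S W"
  shows "W \<subseteq> S" "0 \<in> W" "\<And>a b. a \<in> W \<Longrightarrow> b \<in> W \<Longrightarrow> a + b \<in> W"
    "\<And>s a. s \<in> S \<Longrightarrow> a \<in> W \<Longrightarrow> s * a \<in> W" "\<And>s a. s \<in> S \<Longrightarrow> a \<in> W \<Longrightarrow> a * s \<in> W"
    "\<And>a. a \<in> W \<Longrightarrow> a \<in> S"
  using assms by (auto simp: is_ideal_def mult.commute)

locale carrier_subring =
  fixes S :: "'a::comm_ring_1 set"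
  assumes one_closed: "1 \<in> S"
    and add_closed: "a \<in> S \<Longrightarrow> b \<in> S \<Longrightarrow> a + b \<in> S"
    and uminus_closed: "a \<in> S \<Longrightarrow> - a \<in> S"
    and mult_closed: "a \<in> S \<Longrightarrow> b \<in> S \<Longrightarrow> a * b \<in> S"
begin

lemma zero_closed: "0 \<in> S"
  using add_closed[OF one_closed uminus_closed[OF one_closed]] by simp

lemma diff_closed: "a \<in> S \<Longrightarrow> b \<in> S \<Longrightarrow> a - b \<in> S"
  using add_closed[of a "- b"] uminus_closed by simp

lemma ideal_uminus: "is_ideal S W \<Longrightarrow> a \<in> W \<Longrightarrow> - a \<in> W"
  using is_idealD(4)[of S W "-1" a] uminus_closed[OF one_closed] by simp

lemma ideal_diff: "is_ideal S W \<Longrightarrow> a \<in> W \<Longrightarrow> b \<in> W \<Longrightarrow> a - b \<in> W"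
  using is_idealD(3)[of S W a "- b"] ideal_uminus by simp

lemma ideal_sum: "is_ideal S W \<Longrightarrow> (\<And>i. i \<in> A \<Longrightarrow> g i \<in> W) \<Longrightarrow> sum g A \<in> W"
  by (induction A rule: infinite_finite_induct) (auto simp: is_ideal_def)

lemma is_ideal_carrier: "is_ideal S S"
  by (simp add: is_ideal_def zero_closed add_closed mult_closed)

lemma is_ideal_adjoin:
  assumes W: "is_ideal S W" and f: "f \<in> S"
  shows "is_ideal S (adjoin S W f)"
  unfolding is_ideal_def
proof (intro conjI ballI)
  show "adjoin S W f \<subseteq> S"
    using is_idealD(1)[OF W] f by (auto simp: adjoin_def intro!: add_closed mult_closed)
  show "0 \<in> adjoin S W f"
    unfolding adjoin_def using is_idealD(2)[OF W] zero_closed by (auto intro!: exI[of _ 0])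
  show "a + b \<in> adjoin S W f" if ab: "a \<in> adjoin S W f" "b \<in> adjoin S W f" for a b
  proof -
    obtain w s w' s' where "a = w + s * f" "b = w' + s' * f" "w \<in> W" "w' \<in> W" "s \<in> S" "s' \<in> S"
      using ab unfolding adjoin_def by blast
    moreover from this have "a + b = (w + w') + (s + s') * f"
      by (simp add: algebra_simps)
    ultimately show ?thesis
      unfolding adjoin_def using is_idealD(3)[OF W] add_closed by blast
  qed
  show "s * a \<in> adjoin S W f" if sa: "s \<in> S" "a \<in> adjoin S W f" for s a
  proof -
    obtain w t where "a = w + t * f" "w \<in> W" "t \<in> S"
      using sa unfolding adjoin_def by blast
    moreover from this have "s * a = s * w + (s * t) * f"
      by (simp add: algebra_simps)
    ultimately show ?thesis
      unfolding adjoin_def using is_idealD(4)[OF W] mult_closed sa by blast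
  qed
qed

lemma adjoin_superset: "W \<subseteq> adjoin S W f"
proof
  fix w assume "w \<in> W"
  moreover have "w = w + 0 * f" by simp
  ultimately show "w \<in> adjoin S W f" unfolding adjoin_def using zero_closed by blast
qed

lemma adjoin_gen:
  assumes "is_ideal S W"
  shows "f \<in> adjoin S W f"
proof -
  have "f = 0 + 1 * f" by simp
  then show ?thesis unfolding adjoin_def using one_closed is_idealD(2)[OF assms] by blast
qed

lemma adjoin_least:
  "is_ideal S W' \<Longrightarrow> W \<subseteq> W' \<Longrightarrow> f \<in> W' \<Longrightarrow> adjoin S W f \<subseteq> W'"
  unfolding adjoin_def by (auto simp: is_ideal_def)

lemma adjoin_commute: "adjoin S (adjoin S W f) g = adjoin S (adjoin S W g) f"
proof -
  have "adjoin S (adjoin S W f) g \<subseteq> adjoin S (adjoin S W g) f" for f g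
  proof
    fix x assume "x \<in> adjoin S (adjoin S W f) g"
    then obtain w s t where "x = (w + s * f) + t * g" "w \<in> W" "s \<in> S" "t \<in> S"
      unfolding adjoin_def by blast
    moreover from this have "x = (w + t * g) + s * f" by (simp add: algebra_simps)
    ultimately show "x \<in> adjoin S (adjoin S W g) f" unfolding adjoin_def by blast
  qed
  then show ?thesis by blast
qed

lemma adjoin_absorb: "is_ideal S W \<Longrightarrow> f \<in> W \<Longrightarrow> adjoin S W f = W"
  using adjoin_superset adjoin_least by blast

text \<open>If \<open>f x = w + s g\<close>, regularity of \<open>g\<close> modulo
  \<open>W + (f)\<close> puts \<open>s\<close> into \<open>W + (f)\<close>. A multiple of
  \<open>g\<close> can then be subtracted from \<open>x\<close> such that \<open>f\<close> times the
  difference lies in \<open>W\<close>, and \<open>f\<close> is regular modulo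
  \<open>W\<close>.\<close>

lemma regular_on_swap:
  assumes W: "is_ideal S W" and f: "f \<in> S" and g: "g \<in> S"
    and fr: "regular_on S W f" and gr: "regular_on S (adjoin S W f) g"
  shows "regular_on S (adjoin S W g) f"
  unfolding regular_on_def
proof (intro ballI impI)
  fix x assume x: "x \<in> S" "f * x \<in> adjoin S W g"
  then obtain w s where ws: "f * x = w + s * g" "w \<in> W" "s \<in> S" unfolding adjoin_def by blast
  have "g * s = - w + x * f" using ws by (simp add: algebra_simps)
  then have "g * s \<in> adjoin S W f" unfolding adjoin_def using ws x ideal_uminus[OF W] by blast
  then have "s \<in> adjoin S W f" using gr ws unfolding regular_on_def by blast
  then obtain w' s' where s': "s = w' + s' * f" "w' \<in> W" "s' \<in> S" unfolding adjoin_def by blast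
  have "f * (x - s' * g) = w + g * w'" using ws(1) s'(1) by (simp add: algebra_simps)
  then have "f * (x - s' * g) \<in> W" using ws s' W g by (simp add: is_ideal_def)
  then have "x - s' * g \<in> W" using fr x s' g diff_closed mult_closed unfolding regular_on_def by blast
  moreover have "x = (x - s' * g) + s' * g" by simp
  ultimately show "x \<in> adjoin S W g" unfolding adjoin_def using s' by blast
qed

end

text \<open>The chain condition asks only for one repetition \<open>F (Suc N) = F N\<close>. This
  suffices to refute strictly increasing chains and to find, in a sequence of generators, one that
  lies in the ideal of its predecessors.\<close>

locale noetherian_subring = carrier_subring S for S :: "'a::comm_ring_1 set" +
  assumes noetherian: "\<lbrakk>\<And>i::nat. is_ideal S (F i); \<And>i. F i \<subseteq> F (Suc i)\<rbrakk> \<Longrightarrow> \<exists>N. F (Suc N) = F N"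
begin

lemma ex_maximal_ideal:
  assumes "\<And>Q. Q \<in> \<Q> \<Longrightarrow> is_ideal S Q" and "Q0 \<in> \<Q>"
  shows "\<exists>Q\<in>\<Q>. Q0 \<subseteq> Q \<and> (\<forall>Q'\<in>\<Q>. Q \<subseteq> Q' \<longrightarrow> Q' = Q)"
proof (rule ccontr)
  assume neg: "\<not> ?thesis"
  have "\<forall>Q. \<exists>Q'. Q \<in> \<Q> \<and> Q0 \<subseteq> Q \<longrightarrow> Q' \<in> \<Q> \<and> Q \<subset> Q'"
  proof (intro allI)
    fix Q show "\<exists>Q'. Q \<in> \<Q> \<and> Q0 \<subseteq> Q \<longrightarrow> Q' \<in> \<Q> \<and> Q \<subset> Q'"
    proof (cases "Q \<in> \<Q> \<and> Q0 \<subseteq> Q")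
      case True
      then have "\<not> (\<forall>Q'\<in>\<Q>. Q \<subseteq> Q' \<longrightarrow> Q' = Q)" using neg by (auto dest: bspec)
      then obtain Q' where "Q' \<in> \<Q>" "Q \<subseteq> Q'" "Q' \<noteq> Q" by blast
      then show ?thesis by (auto intro!: exI[of _ Q'])
    qed auto
  qed
  from choice[OF this]
  obtain nxt where nxt: "\<forall>Q. Q \<in> \<Q> \<and> Q0 \<subseteq> Q \<longrightarrow> nxt Q \<in> \<Q> \<and> Q \<subset> nxt Q" ..
  define F where "F i = (nxt ^^ i) Q0" for i
  have F: "F i \<in> \<Q> \<and> Q0 \<subseteq> F i" for i
  proof (induction i)
    case (Suc i)
    then have "nxt (F i) \<in> \<Q>" "F i \<subset> nxt (F i)" using nxt by blast+
    then show ?case using Suc by (auto simp: F_def)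
  qed (use assms in \<open>simp add: F_def\<close>)
  have "F i \<subset> F (Suc i)" for i
    using nxt[rule_format, of "F i"] F[of i] by (simp add: F_def)
  moreover from this have "\<exists>N. F (Suc N) = F N"
    using noetherian[of F] F assms(1) by blast
  ultimately show False by blast
qed

section \<open>Maximal annihilators of elements, and prime avoidance\<close>

definition colon :: "'a set \<Rightarrow> 'a \<Rightarrow> 'a set" where
  "colon W a = {s \<in> S. s * a \<in> W}"

text \<open>The maximal members among the annihilators of nonzero elements of \<open>S/W\<close>;
  they are associated primes. Their union is the set of zero divisors on \<open>S/W\<close>, so they
  serve in place of a primary decomposition.\<close>

definition maximal_colons :: "'a set \<Rightarrow> 'a set set" where
  "maximal_colons W = {Q. \<exists>a\<in>S - W. Q = colon W a \<and> (\<forall>b\<in>S - W. Q \<subseteq> colon W b \<longrightarrow> colon W b = Q)}"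

lemma is_ideal_colon: "is_ideal S W \<Longrightarrow> a \<in> S \<Longrightarrow> is_ideal S (colon W a)"
  unfolding is_ideal_def colon_def
  by (auto simp: zero_closed add_closed mult_closed distrib_right mult.assoc)

text \<open>Let \<open>Q\<close> be the annihilator of \<open>a\<close>, with \<open>x y\<close> in
  \<open>Q\<close> and \<open>x\<close> not in \<open>Q\<close>. The annihilator of
  \<open>x a\<close> contains \<open>Q\<close>, hence equals it by maximality, and it contains
  \<open>y\<close>.\<close>

lemma maximal_colons_prime:
  assumes W: "is_ideal S W" and Q: "Q \<in> maximal_colons W"
  shows "is_ideal S Q" "1 \<notin> Q" "\<And>x y. x \<in> S \<Longrightarrow> y \<in> S \<Longrightarrow> x * y \<in> Q \<Longrightarrow> x \<in> Q \<or> y \<in> Q"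
proof -
  obtain a where a: "a \<in> S" "a \<notin> W" "Q = colon W a"
    and max: "\<And>b. b \<in> S \<Longrightarrow> b \<notin> W \<Longrightarrow> Q \<subseteq> colon W b \<Longrightarrow> colon W b = Q"
    using Q unfolding maximal_colons_def by blast
  show "is_ideal S Q" using is_ideal_colon[OF W] a by simp
  show "1 \<notin> Q" using a by (simp add: colon_def)
  fix x y assume xy: "x \<in> S" "y \<in> S" "x * y \<in> Q"
  show "x \<in> Q \<or> y \<in> Q"
  proof (rule ccontr)
    assume neg: "\<not> (x \<in> Q \<or> y \<in> Q)"
    then have xa: "x * a \<notin> W" using a xy by (auto simp: colon_def)
    have "Q \<subseteq> colon W (x * a)"
      unfolding a(3) colon_def using is_idealD(4)[OF W xy(1)] by (auto simp: mult.left_commute[of _ x])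
    then have "colon W (x * a) = Q" using max xa mult_closed xy a by blast
    moreover have "y \<in> colon W (x * a)"
      using xy a unfolding colon_def by (auto simp: mult.commute mult.left_commute)
    ultimately show False using neg by simp
  qed
qed

lemma prod_notin_prime:
  assumes "\<And>x y. x \<in> S \<Longrightarrow> y \<in> S \<Longrightarrow> x * y \<in> Q \<Longrightarrow> x \<in> Q \<or> y \<in> Q" "1 \<notin> Q" "finite A"
    and "\<And>i. i \<in> A \<Longrightarrow> g i \<in> S - Q"
  shows "prod g A \<in> S - Q"
  using assms(3,4)
proof (induction A)
  case empty then show ?case using assms(2) one_closed by simp
next
  case (insert i A)
  then have "g i \<in> S - Q" "prod g A \<in> S - Q" by auto
  then show ?case using assms(1)[of "g i" "prod g A"] mult_closed insert by auto
qed

text \<open>Choose elements \<open>a i\<close> with infinitely many distinct annihilators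
  \<open>Q i\<close>. By the chain condition some \<open>a t\<close> lies in the ideal generated by
  \<open>W\<close> and the preceding elements. A product of elements of \<open>Q i - Q t\<close> for
  \<open>i < t\<close> annihilates these, hence also \<open>a t\<close>, and thus lies in the prime
  \<open>Q t\<close>, a contradiction.\<close>

lemma finite_maximal_colons:
  assumes W: "is_ideal S W"
  shows "finite (maximal_colons W)"
proof (rule ccontr)
  assume "infinite (maximal_colons W)"
  then obtain Q :: "nat \<Rightarrow> 'a set" where Q: "inj Q" "range Q \<subseteq> maximal_colons W"
    using infinite_countable_subset by blast
  then have "\<forall>i. \<exists>a\<in>S - W. Q i = colon W a" unfolding maximal_colons_def by blast
  then obtain a where a: "\<And>i. a i \<in> S - W" "\<And>i. Q i = colon W (a i)" by metis
  define N where "N = rec_nat W (\<lambda>i X. adjoin S X (a i))"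
  have N0: "N 0 = W" and NS: "N (Suc i) = adjoin S (N i) (a i)" for i by (simp_all add: N_def)
  have Ni: "is_ideal S (N i)" for i
    by (induction i) (use W a in \<open>auto simp: N0 NS intro!: is_ideal_adjoin\<close>)
  have "N i \<subseteq> N (Suc i)" for i unfolding NS by (rule adjoin_superset)
  then obtain t where "N (Suc t) = N t" using noetherian[of N] Ni by blast
  then have at: "a t \<in> N t" using adjoin_gen[OF Ni[of t]] NS by blast
  have kill: "s * x \<in> W" if "x \<in> N i" "s \<in> S" "\<And>j. j < i \<Longrightarrow> s \<in> Q j" for i s x
    using that
  proof (induction i arbitrary: x)
    case 0 then show ?case using W by (auto simp: N0 is_ideal_def)
  next
    case (Suc i)
    obtain w u where wu: "x = w + u * a i" "w \<in> N i" "u \<in> S" using Suc.prems unfolding NS adjoin_def by blast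
    have "s * w \<in> W" using Suc.IH[OF wu(2)] Suc.prems by auto
    moreover have "s * a i \<in> W" using Suc.prems(3)[of i] a(2)[of i] by (simp add: colon_def)
    ultimately show ?case
      using is_idealD(3)[OF W, of "s * w" "u * (s * a i)"] is_idealD(4)[OF W wu(3), of "s * a i"]
      unfolding wu(1) by (simp add: distrib_left mult.left_commute)
  qed
  \<comment> \<open>Maximality of \<open>Q i\<close> makes an inclusion of \<open>Q i\<close> in
    \<open>Q t\<close> an equality, against injectivity.\<close>
  have "\<exists>q. q \<in> Q i \<and> q \<notin> Q t" if "i < t" for i
  proof (rule ccontr)
    assume "\<nexists>q. q \<in> Q i \<and> q \<notin> Q t"
    then have "colon W (a t) = Q i"
      using Q(2) a[of t] unfolding maximal_colons_def by blast
    then show False using Q(1) a(2)[of t] that by (metis injD less_irrefl)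
  qed
  then obtain q where q: "\<And>i. i < t \<Longrightarrow> q i \<in> Q i \<and> q i \<notin> Q t" by metis
  note prime = maximal_colons_prime[OF W subsetD[OF Q(2) rangeI]]
  have "prod q {..<t} \<in> S - Q t"
    using q is_idealD(1)[OF prime(1)] by (intro prod_notin_prime prime) auto
  moreover have "prod q {..<t} \<in> Q j" if "j < t" for j
  proof -
    have "prod q {..<t} = q j * prod q ({..<t} - {j})" using that by (simp add: prod.remove)
    moreover have "prod q ({..<t} - {j}) \<in> S - Q t"
      using q is_idealD(1)[OF prime(1)] by (intro prod_notin_prime prime) auto
    ultimately show ?thesis using q[OF that] is_idealD(5)[OF prime(1)] by auto
  qed
  ultimately have "prod q {..<t} * a t \<in> W" using kill[OF at] by blast
  then show False using \<open>prod q {..<t} \<in> S - Q t\<close> a(2)[of t] by (simp add: colon_def)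
qed

text \<open>Induction on the number of primes. A prime contained in another one may be dropped. In
  an antichain, an element \<open>f\<close> of \<open>m\<close> that avoids all primes but
  \<open>Q\<close> is corrected, if it lies in \<open>Q\<close>, by an element of \<open>m\<close>
  that lies in all the others and not in \<open>Q\<close>.\<close>

lemma prime_avoidance:
  assumes "finite \<Q>" and m: "is_ideal S m"
    and "\<And>Q. Q \<in> \<Q> \<Longrightarrow> is_ideal S Q \<and> 1 \<notin> Q \<and> (\<forall>x\<in>S. \<forall>y\<in>S. x * y \<in> Q \<longrightarrow> x \<in> Q \<or> y \<in> Q)"
    and "\<And>Q. Q \<in> \<Q> \<Longrightarrow> \<not> m \<subseteq> Q"
  shows "\<exists>f\<in>m. \<forall>Q\<in>\<Q>. f \<notin> Q"
  using assms(1,3,4)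
proof (induction "card \<Q>" arbitrary: \<Q> rule: less_induct)
  case less
  consider "\<Q> = {}" | Q1 Q2 where "Q1 \<in> \<Q>" "Q2 \<in> \<Q>" "Q1 \<noteq> Q2" "Q1 \<subseteq> Q2"
    | Q where "Q \<in> \<Q>" "\<forall>Q1\<in>\<Q>. \<forall>Q2\<in>\<Q>. Q1 \<subseteq> Q2 \<longrightarrow> Q1 = Q2" by blast
  then show ?case
  proof cases
    case 1 then show ?thesis using is_idealD(2)[OF m] by blast
  next
    case 2
    have "card (\<Q> - {Q1}) < card \<Q>" using less.prems(1) 2(1) by (rule card_Diff1_less)
    then obtain f where "f \<in> m" "\<forall>Q\<in>\<Q> - {Q1}. f \<notin> Q"
      using less.hyps[of "\<Q> - {Q1}"] less.prems by auto
    then show ?thesis using 2 by blast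
  next
    case 3
    have "card (\<Q> - {Q}) < card \<Q>" using less.prems(1) 3(1) by (rule card_Diff1_less)
    then obtain f where f: "f \<in> m" "\<forall>Q'\<in>\<Q> - {Q}. f \<notin> Q'"
      using less.hyps[of "\<Q> - {Q}"] less.prems by auto
    show ?thesis
    proof (cases "f \<in> Q")
      case False then show ?thesis using f by blast
    next
      case True
      note Q = less.prems(2)[OF 3(1)]
      have "\<exists>q. q \<in> Q' \<and> q \<notin> Q" if "Q' \<in> \<Q> - {Q}" for Q' using 3 that by blast
      then obtain q where q: "\<And>Q'. Q' \<in> \<Q> - {Q} \<Longrightarrow> q Q' \<in> Q' \<and> q Q' \<notin> Q" by metis
      have qS: "q Q' \<in> S" if "Q' \<in> \<Q> - {Q}" for Q'
        using q[OF that] less.prems(2)[of Q'] that is_idealD(1) by blast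
      obtain x where x: "x \<in> m" "x \<notin> Q" using less.prems(3)[OF 3(1)] by blast
      have xS: "x \<in> S" using x is_idealD(1)[OF m] by blast
      have P: "prod q (\<Q> - {Q}) \<in> S - Q"
        using Q less.prems(1) q qS by (intro prod_notin_prime) auto
      define y where "y = x * prod q (\<Q> - {Q})"
      have ym: "y \<in> m" unfolding y_def using x P is_idealD(5)[OF m] by blast
      have yQ: "y \<notin> Q" unfolding y_def using Q P x xS by blast
      have yQ': "y \<in> Q'" if Q': "Q' \<in> \<Q> - {Q}" for Q'
      proof -
        have "prod q (\<Q> - {Q}) = q Q' * prod q (\<Q> - {Q} - {Q'})"
          using Q' less.prems(1) by (simp add: prod.remove)
        then have "y = (x * prod q (\<Q> - {Q} - {Q'})) * q Q'" by (simp add: y_def ac_simps)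
        moreover have "prod q (\<Q> - {Q} - {Q'}) \<in> S - Q"
          using Q less.prems(1) q qS by (intro prod_notin_prime) auto
        ultimately show ?thesis
          using q[OF Q'] less.prems(2)[of Q'] Q' xS mult_closed by (simp add: is_ideal_def)
      qed
      have "f + y \<in> m" using f ym is_idealD(3)[OF m] by blast
      moreover have "f + y \<notin> Q"
        using ideal_diff[of Q "f + y" f] Q True yQ by auto
      moreover have "f + y \<notin> Q'" if "Q' \<in> \<Q> - {Q}" for Q'
        using ideal_diff[of Q' "f + y" y] less.prems(2)[of Q'] that yQ'[OF that] f by auto
      ultimately show ?thesis by blast
    qed
  qed
qed

text \<open>An element that is not regular modulo \<open>W\<close> annihilates some \<open>x\<close>
  outside \<open>W\<close>, and the annihilator of \<open>x\<close> lies in a maximal one. As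
  \<open>W\<close> is socle-free, \<open>m\<close> is contained in none of these primes, so some
  element of \<open>m\<close> avoids all of them, for all \<open>W\<close> in the finite family at
  once.\<close>

lemma ex_common_regular:
  assumes "finite \<W>" and W: "\<And>W. W \<in> \<W> \<Longrightarrow> is_ideal S W" "\<And>W. W \<in> \<W> \<Longrightarrow> socle_free S m W"
    and m: "is_ideal S m"
  shows "\<exists>f\<in>m. \<forall>W\<in>\<W>. regular_on S W f"
proof -
  have "\<exists>f\<in>m. \<forall>Q\<in>(\<Union>W\<in>\<W>. maximal_colons W). f \<notin> Q"
  proof (rule prime_avoidance[OF _ m])
    show "finite (\<Union>W\<in>\<W>. maximal_colons W)" using assms(1) finite_maximal_colons W by blast
    fix Q assume "Q \<in> (\<Union>W\<in>\<W>. maximal_colons W)"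
    then obtain W where Q: "W \<in> \<W>" "Q \<in> maximal_colons W" by blast
    show "is_ideal S Q \<and> 1 \<notin> Q \<and> (\<forall>x\<in>S. \<forall>y\<in>S. x * y \<in> Q \<longrightarrow> x \<in> Q \<or> y \<in> Q)"
      using maximal_colons_prime[OF W(1)[OF Q(1)] Q(2)] by blast
    show "\<not> m \<subseteq> Q"
      using W(2)[OF Q(1)] Q(2) unfolding maximal_colons_def socle_free_def colon_def by blast
  qed
  then obtain f where f: "f \<in> m" "\<And>W Q. W \<in> \<W> \<Longrightarrow> Q \<in> maximal_colons W \<Longrightarrow> f \<notin> Q" by blast
  have "x \<in> W" if x: "W \<in> \<W>" "x \<in> S" "f * x \<in> W" for W x
  proof (rule ccontr)
    assume "x \<notin> W"
    have "\<exists>Q\<in>colon W ` (S - W). colon W x \<subseteq> Q \<and> (\<forall>Q'\<in>colon W ` (S - W). Q \<subseteq> Q' \<longrightarrow> Q' = Q)"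
    proof (rule ex_maximal_ideal)
      show "is_ideal S Q" if "Q \<in> colon W ` (S - W)" for Q
        using that is_ideal_colon[OF W(1)[OF x(1)]] by blast
      show "colon W x \<in> colon W ` (S - W)" using \<open>x \<notin> W\<close> x(2) by (intro imageI) simp
    qed
    then obtain Q where Q: "Q \<in> colon W ` (S - W)" "colon W x \<subseteq> Q"
      "\<forall>Q'\<in>colon W ` (S - W). Q \<subseteq> Q' \<longrightarrow> Q' = Q" by (elim bexE conjE)
    then obtain a where "a \<in> S - W" "Q = colon W a" by (elim imageE)
    then have "Q \<in> maximal_colons W" unfolding maximal_colons_def using Q(3) by auto
    moreover have "f \<in> colon W x" using x f(1) is_idealD(1)[OF m] by (auto simp: colon_def)
    ultimately show False using f(2)[OF x(1)] Q(2) by blast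
  qed
  then show ?thesis using f(1) unfolding regular_on_def by blast
qed

end

text \<open>The name refers to the part played by \<open>\<mm>\<close>, in the application the
  irrelevant ideal; \<open>\<mm>\<close> may be any ideal of \<open>S\<close>.\<close>

locale noetherian_local = noetherian_subring S for S :: "'a::comm_ring_1 set" +
  fixes \<mm> :: "'a set"
  assumes mm: "is_ideal S \<mm>"
begin

abbreviation "adj \<equiv> adjoin S"
abbreviation "reg \<equiv> regular_on S"
abbreviation "dge \<equiv> depth_ge S \<mm>"

lemma mmS: "f \<in> \<mm> \<Longrightarrow> f \<in> S" using is_idealD(1)[OF mm] by blast

lemma regular_socle_free: "f \<in> \<mm> \<Longrightarrow> reg W f \<Longrightarrow> socle_free S \<mm> W"
  unfolding socle_free_def regular_on_def by blast

lemma depth_ge_1_iff: "is_ideal S W \<Longrightarrow> dge W (Suc 0) \<longleftrightarrow> socle_free S \<mm> W"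
  using ex_common_regular[of "{W}", OF _ _ _ mm] regular_socle_free by auto

lemma depth_ge_mono: "dge W d \<Longrightarrow> d' \<le> d \<Longrightarrow> dge W d'"
proof (induction d arbitrary: W d')
  case (Suc d) then show ?case by (cases d') auto
qed simp

text \<open>An elementary substitute for the isomorphisms of Hom(S/\<mm>, S/(W + (a))) and
  Hom(S/\<mm>, S/(W + (f))) with Ext^1(S/\<mm>, S/W). If \<open>\<mm> u\<close> lies in
  \<open>W + (f)\<close> and \<open>a u = w + v f\<close>, the class of \<open>v\<close> lies in the
  socle modulo \<open>W + (a)\<close>. Hence \<open>v\<close> lies in \<open>W + (a)\<close>, and
  this gives \<open>u\<close> in \<open>W + (f)\<close>.\<close>

lemma socle_free_adjoin_exchange:
  assumes W: "is_ideal S W" and a\<mm>: "a \<in> \<mm>" and ar: "reg W a" and f: "f \<in> S" "reg W f"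
    and sf: "socle_free S \<mm> (adj W a)"
  shows "socle_free S \<mm> (adj W f)"
  unfolding socle_free_def
proof (intro ballI impI)
  fix u assume u: "u \<in> S" and um: "\<forall>x\<in>\<mm>. x * u \<in> adj W f"
  note a = mmS[OF a\<mm>] ar
  show "u \<in> adj W f"
  proof -
    obtain w v where wv: "a * u = w + v * f" "w \<in> W" "v \<in> S" using um a\<mm> unfolding adjoin_def by blast
    have "x * v \<in> adj W a" if x: "x \<in> \<mm>" for x
    proof -
      obtain w' u' where w': "x * u = w' + u' * f" "w' \<in> W" "u' \<in> S"
        using um x unfolding adjoin_def by blast
      have "f * (x * v - a * u') = x * (v * f) - a * (u' * f)" by (simp add: algebra_simps)
      also have "\<dots> = x * (a * u - w) - a * (x * u - w')" using wv(1) w'(1) by simp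
      also have "\<dots> = a * w' - x * w" by (simp add: algebra_simps)
      also have "\<dots> \<in> W" using wv w' W a(1) mmS[OF x] by (intro ideal_diff is_idealD(4)) auto
      finally have "f * (x * v - a * u') \<in> W" .
      then have "x * v - a * u' \<in> W"
        using f(2) wv w' a(1) mmS[OF x] diff_closed mult_closed unfolding regular_on_def by blast
      moreover have "x * v = (x * v - a * u') + u' * a" by (simp add: mult.commute)
      ultimately show ?thesis unfolding adjoin_def using w' by blast
    qed
    then have "v \<in> adj W a" using sf wv unfolding socle_free_def by blast
    then obtain w' v' where v': "v = w' + v' * a" "w' \<in> W" "v' \<in> S" unfolding adjoin_def by blast
    have "a * (u - v' * f) = w + f * w'" using wv(1) v'(1) by (simp add: algebra_simps)
    then have "a * (u - v' * f) \<in> W" using wv v' f W by (simp add: is_ideal_def)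
    then have "u - v' * f \<in> W" using a(2) u v' f diff_closed mult_closed unfolding regular_on_def by blast
    moreover have "u = (u - v' * f) + v' * f" by simp
    ultimately show ?thesis unfolding adjoin_def using v' by blast
  qed
qed

text \<open>
  Rees' theorem on the length of regular sequences. To exchange \<open>f\<close> with the first element \<open>a\<close> of a
  given sequence, one passes through an element \<open>c\<close> that is regular modulo \<open>W\<close>, \<open>W + (a)\<close> and \<open>W + (f)\<close>.
\<close>

theorem depth_ge_adjoin:
  assumes "is_ideal S W" "f \<in> \<mm>" "reg W f"
  shows "dge W (Suc d) \<longleftrightarrow> dge (adj W f) d"
proof
  show "dge (adj W f) d \<Longrightarrow> dge W (Suc d)" using assms by auto
  show "dge (adj W f) d" if "dge W (Suc d)"
    using assms that
  proof (induction d arbitrary: W f)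
    case (Suc d)
    note W = Suc.prems(1) and f = Suc.prems(2,3)
    obtain a where a: "a \<in> \<mm>" "reg W a" "dge (adj W a) (Suc d)" using Suc.prems(4) by auto
    have Wa: "is_ideal S (adj W a)" and Wf: "is_ideal S (adj W f)"
      using is_ideal_adjoin[OF W] mmS a f by auto
    have "dge (adj W a) (Suc 0)" using a(3) by (rule depth_ge_mono) simp
    then have sfa: "socle_free S \<mm> (adj W a)" using depth_ge_1_iff[OF Wa] by blast
    have sff: "socle_free S \<mm> (adj W f)"
      using socle_free_adjoin_exchange[OF W _ _ _ _ sfa, of f] a f mmS by blast
    have "\<exists>c\<in>\<mm>. \<forall>W'\<in>{W, adj W a, adj W f}. reg W' c"
      using W Wa Wf sfa sff regular_socle_free[OF f] by (intro ex_common_regular[OF _ _ _ mm]) auto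
    then obtain c where c: "c \<in> \<mm>" "reg W c" "reg (adj W a) c" "reg (adj W f) c" by blast
    have Wc: "is_ideal S (adj W c)" using is_ideal_adjoin[OF W] mmS c by auto
    have "reg (adj W c) a" "reg (adj W c) f"
      using regular_on_swap[OF W] a f c mmS by blast+
    \<comment> \<open>The induction hypothesis is used for \<open>W + (a)\<close> with
      \<open>c\<close> and for \<open>W + (c)\<close> with \<open>f\<close>. In between,
      \<open>W + (a, c)\<close> is read as obtained from \<open>W + (c)\<close> by adjoining
      \<open>a\<close>.\<close>
    have "dge (adj (adj W a) c) d" using Suc.IH[OF Wa c(1,3) a(3)] .
    then have "dge (adj W c) (Suc d)"
      using \<open>reg (adj W c) a\<close> a(1) adjoin_commute[of W a c] by auto
    then have "dge (adj (adj W c) f) d" using Suc.IH[OF Wc f(1) \<open>reg (adj W c) f\<close>] by blast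
    then show ?case using c adjoin_commute[of W c f] by auto
  qed simp
qed

end

section \<open>Exponent vectors\<close>

abbreviation "lookup \<equiv> Poly_Mapping.lookup"
abbreviation "keys \<equiv> Poly_Mapping.keys"
abbreviation "single \<equiv> Poly_Mapping.single"

type_synonym expo = "nat \<Rightarrow>\<^sub>0 nat"

definition exps :: "nat set \<Rightarrow> expo set" where
  "exps V = {t. keys t \<subseteq> V}"

text \<open>The order \<open>\<le>\<close> on exponent vectors is lexicographic and serves for
  leading terms; divisibility of monomials is this componentwise order.\<close>

definition divs :: "expo \<Rightarrow> expo \<Rightarrow> bool" (infix \<open>divs\<close> 50) where
  "t divs u \<longleftrightarrow> (\<forall>v. lookup t v \<le> lookup u v)"

text \<open>The exponent sets of the monomial ideals in the variables \<open>V\<close>: the empty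
  set belongs to the zero ideal, \<open>exps V\<close> to the whole ring.\<close>

definition upset :: "nat set \<Rightarrow> expo set \<Rightarrow> bool" where
  "upset V E \<longleftrightarrow> E \<subseteq> exps V \<and> (\<forall>t\<in>E. \<forall>u\<in>exps V. t + u \<in> E)"

lemma keys_add_expo [simp]: "keys (t + u) = keys t \<union> keys (u :: expo)"
  by (auto simp: in_keys_iff lookup_add)

lemma expsI: "(\<And>v. v \<notin> V \<Longrightarrow> lookup t v = 0) \<Longrightarrow> t \<in> exps V"
  by (auto simp: exps_def in_keys_iff)

lemma exps_lookup: "t \<in> exps V \<Longrightarrow> v \<notin> V \<Longrightarrow> lookup t v = 0"
  by (auto simp: exps_def in_keys_iff)

lemma exps_iff: "t \<in> exps V \<longleftrightarrow> (\<forall>v. v \<notin> V \<longrightarrow> lookup t v = 0)"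
  using expsI exps_lookup by blast

lemma zero_exps [simp]: "0 \<in> exps V"
  by (simp add: exps_def)

lemma add_exps [simp]: "t + u \<in> exps V \<longleftrightarrow> t \<in> exps V \<and> u \<in> exps V"
  by (auto simp: exps_def)

lemma minus_exps: "t \<in> exps V \<Longrightarrow> t - u \<in> exps V"
  by (auto simp: exps_iff lookup_minus)

lemma exps_mono: "V \<subseteq> W \<Longrightarrow> exps V \<subseteq> exps W"
  by (auto simp: exps_def)

lemma single_exps [simp]: "single v n \<in> exps V \<longleftrightarrow> v \<in> V \<or> n = 0"
  by (auto simp: exps_def)

lemma divs_refl [simp]: "t divs t" and divs_zero [simp]: "0 divs t"
  and divs_add [simp]: "t divs t + u" "u divs t + u"
  by (simp_all add: divs_def lookup_add)

lemma divs_trans: "t divs u \<Longrightarrow> u divs w \<Longrightarrow> t divs w"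
  unfolding divs_def using order_trans by blast

lemma divs_antisym: "t divs u \<Longrightarrow> u divs t \<Longrightarrow> t = u"
  unfolding divs_def by (intro poly_mapping_eqI antisym) auto

lemma divs_minus: "t divs u \<Longrightarrow> t + (u - t) = u" "t divs u \<Longrightarrow> (u - t) + t = u"
  by (auto simp: divs_def lookup_add lookup_minus intro!: poly_mapping_eqI)

lemma divs_iff: "t divs u \<longleftrightarrow> (\<exists>w. u = t + w)"
  by (metis divs_add(1) divs_minus(1))

lemma add_divs_cancel [simp]: "t + u divs t + w \<longleftrightarrow> u divs w" "u + t divs w + t \<longleftrightarrow> u divs w"
  by (simp_all add: divs_def lookup_add)

lemma upset_divs: "upset V E \<Longrightarrow> t \<in> E \<Longrightarrow> t divs u \<Longrightarrow> u \<in> exps V \<Longrightarrow> u \<in> E"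
  unfolding upset_def divs_iff by auto

lemma upset_exps: "upset V (exps V)" by (simp add: upset_def)

lemma upsetD: "upset V E \<Longrightarrow> t \<in> E \<Longrightarrow> t \<in> exps V" by (auto simp: upset_def)

section \<open>Dickson's lemma and stabilisation of chains of monomial ideals\<close>

lemma nat_mono_subseq:
  fixes a :: "nat \<Rightarrow> nat"
  shows "\<exists>g :: nat \<Rightarrow> nat. strict_mono g \<and> mono (\<lambda>i. a (g i))"
proof -
  have ex: "\<exists>m\<ge>n. \<forall>j\<ge>n. a m \<le> a j" for n
    using ex_has_least_nat[of "\<lambda>m. m \<ge> n" n a] by auto
  \<comment> \<open>The subsequence runs through positions at which \<open>a\<close> attains its
    minimum over all later positions.\<close>
  have "\<exists>g. \<forall>i. (\<forall>j\<ge>g i. a (g i) \<le> a j) \<and> g i < g (Suc i)"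
  proof (rule dependent_nat_choice)
    show "\<exists>x. \<forall>j\<ge>x. a x \<le> a j" using ex[of 0] by auto
    show "\<exists>y. (\<forall>j\<ge>y. a y \<le> a j) \<and> x < y" for x n using ex[of "Suc x"] by (metis Suc_le_eq order_trans)
  qed
  then obtain g where g: "\<And>i j. j \<ge> g i \<Longrightarrow> a (g i) \<le> a j" "\<And>i. g i < g (Suc i)" by blast
  have "strict_mono g" using g(2) by (simp add: strict_mono_Suc_iff)
  moreover have "mono (\<lambda>i. a (g i))" unfolding mono_iff_le_Suc using g by (simp add: less_imp_le)
  ultimately show ?thesis by blast
qed

text \<open>Thin out the sequence for one variable after the other; monotonicity in the earlier
  variables survives each further thinning.\<close>

lemma Dickson_subseq:
  fixes s :: "nat \<Rightarrow> 'v \<Rightarrow> nat"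
  assumes "finite V"
  shows "\<exists>g :: nat \<Rightarrow> nat. strict_mono g \<and> (\<forall>v\<in>V. mono (\<lambda>i. s (g i) v))"
  using assms
proof (induction V)
  case empty then show ?case using strict_mono_id by blast
next
  case (insert v V)
  then obtain g :: "nat \<Rightarrow> nat" where g: "strict_mono g" "\<forall>v\<in>V. mono (\<lambda>i. s (g i) v)" by blast
  obtain h :: "nat \<Rightarrow> nat" where h: "strict_mono h" "mono (\<lambda>i. s (g (h i)) v)"
    using nat_mono_subseq[of "\<lambda>i. s (g i) v"] by (elim exE conjE)
  have "mono (\<lambda>i. s (g (h i)) u)" if "u \<in> V" for u
    using g(2) that strict_mono_mono[OF h(1)] unfolding mono_def by blast
  moreover have "strict_mono (\<lambda>i. g (h i))" using strict_mono_o[OF g(1) h(1)] by (simp add: o_def)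
  ultimately show ?case using h(2) by (intro exI[of _ "\<lambda>i. g (h i)"]) simp
qed

lemma Dickson:
  fixes s :: "nat \<Rightarrow> expo"
  assumes "finite V" "\<And>i. s i \<in> exps V"
  shows "\<exists>i j. i < j \<and> s i divs s j"
proof -
  obtain g :: "nat \<Rightarrow> nat" where g: "strict_mono g" "\<forall>v\<in>V. mono (\<lambda>i. lookup (s (g i)) v)"
    using Dickson_subseq[OF assms(1), of "\<lambda>i. lookup (s i)"] by blast
  have "s (g 0) divs s (g 1)"
    unfolding divs_def
  proof
    fix v show "lookup (s (g 0)) v \<le> lookup (s (g 1)) v"
      using g(2) assms(2)[of "g 0"] by (cases "v \<in> V") (auto simp: mono_def exps_lookup)
  qed
  then show ?thesis using g(1) by (meson strict_monoD zero_less_one)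
qed

text \<open>If the chain did not become stationary, there would be indices \<open>g i\<close> and
  exponents \<open>wit (g i)\<close> that are new between \<open>g i\<close> and
  \<open>g (Suc i)\<close>. By Dickson's lemma an earlier witness divides a later one, which
  therefore already belongs to the set it should avoid.\<close>

lemma upset_chain_stable:
  assumes V: "finite V" and E: "\<And>i::nat. upset V (E i)" "\<And>i. E i \<subseteq> E (Suc i)"
  shows "\<exists>N. \<forall>p\<ge>N. E p = E N"
proof (rule ccontr)
  assume neg: "\<nexists>N. \<forall>p\<ge>N. E p = E N"
  have mono: "E i \<subseteq> E j" if "i \<le> j" for i j using lift_Suc_mono_le[of E, OF E(2) that] .
  have ex: "\<exists>p w. N < p \<and> w \<in> E p - E N" for N
  proof -
    obtain p where "N \<le> p" "E p \<noteq> E N" using neg by blast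
    moreover from this have "N \<noteq> p" "\<exists>w. w \<in> E p - E N" using mono by auto
    ultimately show ?thesis by (metis le_neq_implies_less)
  qed
  then obtain nxt wit where nw: "\<And>N. N < nxt N" "\<And>N. wit N \<in> E (nxt N) - E N" by metis
  define g where "g i = (nxt ^^ i) 0" for i
  have gS: "g (Suc i) = nxt (g i)" for i by (simp add: g_def)
  have "strict_mono g" using nw(1) gS by (simp add: strict_mono_Suc_iff)
  have "\<exists>i j. i < j \<and> wit (g i) divs wit (g j)"
    using nw(2) upsetD[OF E(1)] by (intro Dickson[OF V]) blast
  then obtain i j where ij: "i < j" "wit (g i) divs wit (g j)" by blast
  have "g (Suc i) \<le> g j" using \<open>strict_mono g\<close> ij(1) by (simp add: strict_mono_less_eq)
  then have "wit (g i) \<in> E (g j)" using nw(2)[of "g i"] mono[of "g (Suc i)" "g j"] by (auto simp: gS)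
  then have "wit (g j) \<in> E (g j)"
    using upset_divs[OF E(1) _ ij(2)] nw(2)[of "g j"] upsetD[OF E(1)] by blast
  then show False using nw(2) by blast
qed

section \<open>Polynomials supported on a set of exponents\<close>

definition supported :: "expo set \<Rightarrow> 'k::field mpoly set" where
  "supported E = {p. keys p \<subseteq> E}"

text \<open>The linear projection that discards the monomials outside \<open>E\<close>; it
  represents residue classes modulo monomial ideals.\<close>

definition restr :: "expo set \<Rightarrow> 'k::field mpoly \<Rightarrow> 'k mpoly" where
  "restr E p = (\<Sum>t\<in>keys p \<inter> E. single t (lookup p t))"

lemma polys_eq: "polys V = supported (exps V)"
  by (auto simp: polys_def supported_def exps_def)

lemma lookup_restr: "lookup (restr E p) t = (if t \<in> E then lookup p t else 0)"
proof -
  have "lookup (restr E p) t = (\<Sum>s\<in>keys p \<inter> E. if s = t then lookup p t else 0)"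
    unfolding restr_def lookup_sum by (intro sum.cong refl) (auto simp: lookup_single)
  also have "\<dots> = (if t \<in> keys p \<inter> E then lookup p t else 0)" by simp
  finally show ?thesis by (auto simp: in_keys_iff)
qed

lemma keys_restr [simp]: "keys (restr E p) = keys p \<inter> E"
  by (auto simp: in_keys_iff lookup_restr split: if_splits)

lemma keys_eq_empty_mpoly [simp]: "keys p = {} \<longleftrightarrow> p = (0 :: 'k::field mpoly)"
  by (auto simp: in_keys_iff intro!: poly_mapping_eqI)

lemma restr_supported: "restr E p \<in> supported E"
  by (simp add: supported_def)

lemma restr_id: "p \<in> supported E \<Longrightarrow> restr E p = p"
  by (intro poly_mapping_eqI) (auto simp: lookup_restr supported_def in_keys_iff)

lemma restr_add: "restr E (p + q) = restr E p + restr E q"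
  by (intro poly_mapping_eqI) (simp add: lookup_restr lookup_add)

lemma restr_diff: "restr E (p - q) = restr E p - restr E q"
  by (intro poly_mapping_eqI) (simp add: lookup_restr lookup_minus)

lemma restr_zero [simp]: "restr E 0 = 0"
  by (simp add: restr_def)

lemma restr_eq_0_iff: "restr E p = 0 \<longleftrightarrow> keys p \<inter> E = {}"
  by (metis keys_eq_empty_mpoly keys_restr)

lemma mpoly_expand: "(p :: 'k::field mpoly) = (\<Sum>t\<in>keys p. single t (lookup p t))"
  using restr_id[of p UNIV] by (simp add: restr_def supported_def)

lemma supported_add: "p \<in> supported E \<Longrightarrow> q \<in> supported E \<Longrightarrow> p + q \<in> supported E"
  unfolding supported_def using keys_add[of p q] by blast

lemma supported_zero [simp]: "0 \<in> supported E" by (simp add: supported_def)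

lemma supported_sum: "(\<And>i. i \<in> A \<Longrightarrow> g i \<in> supported E) \<Longrightarrow> sum g A \<in> supported E"
  by (induction A rule: infinite_finite_induct) (auto intro: supported_add)

lemma supported_uminus: "p \<in> supported E \<Longrightarrow> - p \<in> supported E"
  by (simp add: supported_def subset_iff in_keys_iff)

lemma supported_diff: "p \<in> supported E \<Longrightarrow> q \<in> supported E \<Longrightarrow> p - q \<in> supported E"
  using supported_add[of p E "- q"] supported_uminus[of q E] by (simp del: add_uminus_conv_diff add: diff_conv_add_uminus)

lemma supported_mono: "E \<subseteq> F \<Longrightarrow> supported E \<subseteq> supported F"
  by (auto simp: supported_def)

lemma supported_single [simp]: "single t c \<in> supported E \<longleftrightarrow> t \<in> E \<or> c = 0"
  by (auto simp: supported_def)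

lemma supported_monomial [simp]: "monomial t \<in> supported E \<longleftrightarrow> t \<in> E"
  by (simp add: monomial_def)

lemma supported_subset_iff: "(supported E :: 'k::field mpoly set) \<subseteq> supported F \<longleftrightarrow> E \<subseteq> F"
  using supported_mono supported_monomial by (metis subset_iff)

lemma supported_eq_iff: "(supported E :: 'k::field mpoly set) = supported F \<longleftrightarrow> E = F"
  using supported_subset_iff by (metis subset_antisym order_refl)

lemma supported_mult:
  assumes "p \<in> supported E" "q \<in> supported F" "\<And>t u. t \<in> E \<Longrightarrow> u \<in> F \<Longrightarrow> t + u \<in> G"
  shows "p * q \<in> supported G"
  using assms keys_mult[of p q] by (fastforce simp: supported_def)

lemma monomial_0 [simp]: "monomial 0 = 1"
  by (simp add: monomial_def)

lemma monomial_add: "monomial (t + u) = monomial t * monomial u"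
  by (simp add: monomial_def mult_single)

lemma keys_monomial [simp]: "keys (monomial t) = {t}"
  by (simp add: monomial_def)

lemma monomial_inj [simp]: "monomial t = monomial u \<longleftrightarrow> t = u"
  using keys_monomial by (metis singleton_inject)

lemma single_eq_monomial: "single t c = single 0 c * monomial t"
  by (simp add: monomial_def mult_single)

lemma lookup_monomial_mult: "lookup (monomial u * p :: 'k::field mpoly) t = (if u divs t then lookup p (t - u) else 0)"
proof -
  have "monomial u * p = (\<Sum>s\<in>keys p. single (u + s) (lookup p s))"
    by (subst mpoly_expand[of p]) (simp add: sum_distrib_left monomial_def mult_single)
  then have "lookup (monomial u * p) t = (\<Sum>s\<in>keys p. if u + s = t then lookup p s else 0)"
    by (simp add: lookup_sum lookup_single when_def)
  also have "\<dots> = (\<Sum>s\<in>keys p. if u divs t \<and> s = t - u then lookup p s else 0)"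
    by (intro sum.cong refl) (auto simp: divs_minus)
  also have "\<dots> = (if u divs t then lookup p (t - u) else 0)"
    by (cases "u divs t") (auto simp: in_keys_iff)
  finally show ?thesis .
qed

lemma lookup_monomial_mult_add [simp]: "lookup (monomial u * p) (u + t) = lookup p t"
  by (simp add: lookup_monomial_mult)

lemma keys_monomial_mult: "keys (monomial u * p :: 'k::field mpoly) = (+) u ` keys p"
proof (rule Set.set_eqI)
  fix t
  show "t \<in> keys (monomial u * p) \<longleftrightarrow> t \<in> (+) u ` keys p"
  proof (cases "u divs t")
    case True
    then obtain w where "t = u + w" by (auto simp: divs_iff)
    then show ?thesis by (auto simp: in_keys_iff)
  next
    case False
    then show ?thesis by (auto simp: in_keys_iff lookup_monomial_mult)
  qed
qed

lemma upset_mult: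
  assumes "upset V E" "p \<in> polys V" "q \<in> supported E"
  shows "p * q \<in> supported E"
  using assms(2,3)[unfolded polys_eq] by (rule supported_mult) (metis assms(1) upset_def add.commute)

lemma is_ideal_supported: "upset V E \<Longrightarrow> is_ideal (polys V) (supported E)"
  unfolding is_ideal_def
  by (auto intro: supported_add upset_mult) (auto simp: polys_eq upset_def supported_def)

lemma carrier_subring_polys: "carrier_subring (polys V)"
  by unfold_locales
    (auto simp: polys_eq intro: supported_add supported_uminus supported_mult
      supported_monomial[of 0, THEN iffD2, unfolded monomial_0])

text \<open>Leading exponents refer to the lexicographic order on exponent vectors.\<close>

definition lead :: "'k::field mpoly \<Rightarrow> expo" where "lead p = Max (keys p)"

lemma lead_in_keys: "p \<noteq> 0 \<Longrightarrow> lead p \<in> keys p"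
  unfolding lead_def by (intro Max_in) auto

text \<open>The lexicographic order refines divisibility, since no vector of natural numbers lies
  below 0.\<close>

lemma divs_imp_le: "t divs u \<Longrightarrow> t \<le> u"
proof -
  assume "t divs u"
  then obtain w where "u = t + w" by (auto simp: divs_iff)
  moreover have "0 \<le> w"
  proof (rule ccontr)
    assume "\<not> 0 \<le> w"
    then have "w < 0" by simp
    then show False by (auto simp: less_poly_mapping.rep_eq less_fun_def)
  qed
  ultimately show ?thesis using add_left_mono[of 0 w t] by simp
qed

lemma lead_monomial_mult: "p \<noteq> 0 \<Longrightarrow> lead (monomial u * p) = u + lead p"
  unfolding lead_def keys_monomial_mult
  by (intro mono_Max_commute[symmetric] monoI add_left_mono) auto

text \<open>Hilbert's basis theorem. The leading exponents of a chain of ideals form a chain of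
  upsets, which stabilises. If \<open>F N\<close> and \<open>F (Suc N)\<close> have the same leading
  exponents, an element of the difference can be reduced by an element of \<open>F N\<close> to one
  with smaller leading exponent that is still in the difference, and so on without end.\<close>

lemma noetherian_polys:
  assumes V: "finite V"
  shows "noetherian_subring (polys V :: 'k::field mpoly set)"
proof -
  interpret carrier_subring "polys V :: 'k mpoly set" by (rule carrier_subring_polys)
  show ?thesis
  proof unfold_locales
    fix F :: "nat \<Rightarrow> 'k mpoly set"
    assume F: "\<And>i. is_ideal (polys V) (F i)" "\<And>i. F i \<subseteq> F (Suc i)"
    define L where "L i = lead ` (F i - {0})" for i
    have "upset V (L i)" for i
      unfolding upset_def
    proof (intro conjI ballI)
      show "L i \<subseteq> exps V"
        using is_idealD(1)[OF F(1)] lead_in_keys by (fastforce simp: L_def polys_eq supported_def)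
      fix t u assume "t \<in> L i" and u: "u \<in> exps V"
      then obtain p where p: "t = lead p" "p \<in> F i" "p \<noteq> 0" by (auto simp: L_def)
      have "monomial u * p \<in> F i" using p u is_idealD(4)[OF F(1)] by (auto simp: polys_eq)
      moreover have "monomial u * p \<noteq> 0" using p(3) keys_monomial_mult[of u p]
        by (metis image_is_empty keys_eq_empty_mpoly)
      ultimately show "t + u \<in> L i"
        using lead_monomial_mult[OF p(3), of u] p(1) unfolding L_def by (metis (no_types) DiffI add.commute imageI singletonD)
    qed
    moreover have "L i \<subseteq> L (Suc i)" for i using F(2) unfolding L_def by blast
    ultimately have "\<exists>N. \<forall>p\<ge>N. L p = L N" by (rule upset_chain_stable[OF V])
    then obtain N where N: "\<forall>p\<ge>N. L p = L N" ..
    have LN: "L (Suc N) = L N" by (rule N[rule_format]) simp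
    have "F (Suc N) \<subseteq> F N"
    proof (rule ccontr)
      assume neg: "\<not> F (Suc N) \<subseteq> F N"
      have step: "\<exists>q\<in>F (Suc N) - F N. lead q < lead p" if p: "p \<in> F (Suc N) - F N" for p
      proof -
        have p0: "p \<noteq> 0" using p is_idealD(2)[OF F(1)] by auto
        then have "lead p \<in> L N" using p LN by (auto simp: L_def)
        then obtain r where "lead p = lead r" "r \<in> F N - {0}" unfolding L_def by (rule imageE)
        then have r: "r \<in> F N" "r \<noteq> 0" "lead r = lead p" by auto
        define c where "c = lookup p (lead p) / lookup r (lead p)"
        define q where "q = p - single 0 c * r"
        have cr: "single 0 c * r \<in> F N"
          using r is_idealD(4)[OF F(1)] by (auto simp: polys_eq)
        have qF: "q \<in> F (Suc N) - F N"
        proof -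
          have "q \<in> F (Suc N)" unfolding q_def
            using p cr F(2) ideal_diff[OF F(1)] by blast
          moreover have "p = q + single 0 c * r" by (simp add: q_def)
          ultimately show ?thesis using p cr is_idealD(3)[OF F(1)] by blast
        qed
        then have q0: "q \<noteq> 0" using is_idealD(2)[OF F(1)] by auto
        have lk: "lookup q t = lookup p t - c * lookup r t" for t
          by (simp add: q_def lookup_minus flip: mult_map_scale_conv_mult) (simp add: Poly_Mapping.map.rep_eq when_def)
        have "lookup r (lead p) \<noteq> 0" using lead_in_keys[OF r(2)] r(3) by (simp add: in_keys_iff)
        then have "lookup q (lead p) = 0" unfolding lk by (simp add: c_def)
        moreover have "keys q \<subseteq> keys p \<union> keys r" by (auto simp: in_keys_iff lk)
        then have "lead q \<in> keys p \<union> keys r" using lead_in_keys[OF q0] by blast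
        then have "lead q \<le> lead p" using r(3) unfolding lead_def by (metis Max_ge UnE finite_keys)
        ultimately show ?thesis using qF lead_in_keys[OF q0]
          by (metis in_keys_iff le_neq_trans)
      qed
      obtain p0 where p0: "p0 \<in> F (Suc N) - F N" using neg by blast
      have "\<exists>f. \<forall>i. f i \<in> F (Suc N) - F N \<and> lead (f (Suc i)) < lead (f i)"
        by (rule dependent_nat_choice) (use p0 step in blast)+
      then obtain f where f: "\<And>i. f i \<in> F (Suc N) - F N" "\<And>i. lead (f (Suc i)) < lead (f i)" by blast
      have dec: "lead (f j) < lead (f i)" if "i < j" for i j
        using that by (induction j) (auto simp: less_Suc_eq intro: f(2) less_trans)
      have "lead (f i) \<in> exps V" for i
      proof -
        have "f i \<noteq> 0" using f(1)[of i] is_idealD(2)[OF F(1)] by auto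
        then show ?thesis using f(1)[of i] is_idealD(1)[OF F(1)] lead_in_keys
          by (fastforce simp: polys_eq supported_def)
      qed
      \<comment> \<open>In place of a well-foundedness argument, Dickson's lemma finds
        \<open>i < j\<close> such that \<open>lead (f i)\<close> divides \<open>lead (f j)\<close>
        and hence does not exceed it, although the leading exponents strictly decrease.\<close>
      then obtain i j where "i < j" "lead (f i) divs lead (f j)"
        using Dickson[OF V, of "\<lambda>i. lead (f i)"] by blast
      then show False using dec divs_imp_le by (metis leD)
    qed
    then show "\<exists>N. F (Suc N) = F N" using F(2) by blast
  qed
qed

section \<open>Monomial ideals\<close>

lemma poly_ring_simps [simp]:
  "carrier (poly_ring V) = polys V" "monoid.mult (poly_ring V) = (*)" "one (poly_ring V) = 1"
  "ring.zero (poly_ring V) = 0" "add (poly_ring V) = (+)"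
  by (simp_all add: poly_ring_def)

lemma cring_poly_ring: "cring (poly_ring V :: 'k::field mpoly ring)"
proof -
  interpret carrier_subring "polys V :: 'k mpoly set" by (rule carrier_subring_polys)
  show ?thesis
  proof (rule cringI)
    show "abelian_group (poly_ring V :: 'k mpoly ring)"
    proof (rule abelian_groupI)
      fix x :: "'k mpoly" assume "x \<in> carrier (poly_ring V)"
      then show "\<exists>y\<in>carrier (poly_ring V). y \<oplus>\<^bsub>poly_ring V\<^esub> x = \<zero>\<^bsub>poly_ring V\<^esub>"
        using uminus_closed by (intro bexI[of _ "- x"]) auto
    qed (auto simp: add_closed zero_closed algebra_simps)
    show "comm_monoid (poly_ring V :: 'k mpoly ring)"
      by (rule comm_monoidI) (auto simp: mult_closed one_closed algebra_simps)
  qed (auto simp: algebra_simps)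
qed

lemma ideal_iff_is_ideal:
  "ideal W (poly_ring V :: 'k::field mpoly ring) \<longleftrightarrow> is_ideal (polys V) W"
proof
  interpret R: cring "poly_ring V :: 'k mpoly ring" by (rule cring_poly_ring)
  interpret carrier_subring "polys V :: 'k mpoly set" by (rule carrier_subring_polys)
  show "is_ideal (polys V) W" if "ideal W (poly_ring V)"
  proof -
    interpret ideal W "poly_ring V :: 'k mpoly ring" by fact
    show ?thesis
      unfolding is_ideal_def using a_subset zero_closed a_closed I_l_closed by auto
  qed
  show "ideal W (poly_ring V)" if W: "is_ideal (polys V) W"
  proof (rule idealI[OF R.ring_axioms])
    show "subgroup W (add_monoid (poly_ring V :: 'k mpoly ring))"
    proof (rule R.add.subgroupI)
      fix a assume a: "a \<in> W"
      then have "a \<in> polys V" "- a \<in> polys V"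
        using is_idealD(1)[OF W] uminus_closed by auto
      then have "\<ominus>\<^bsub>poly_ring V\<^esub> a = - a" by (intro R.minus_equality) auto
      then show "\<ominus>\<^bsub>poly_ring V\<^esub> a \<in> W" using ideal_uminus[OF W a] by simp
    qed (use is_idealD[OF W] in auto)
  qed (use is_idealD[OF W] in auto)
qed

definition sumset :: "expo set \<Rightarrow> expo set \<Rightarrow> expo set" where
  "sumset E F = {t + u | t u. t \<in> E \<and> u \<in> F}"

lemma upset_sumset: "upset V E \<Longrightarrow> upset V F \<Longrightarrow> upset V (sumset E F)"
  unfolding upset_def sumset_def by (auto simp: add.assoc) blast

definition upset_gen :: "nat set \<Rightarrow> expo set \<Rightarrow> expo set" where
  "upset_gen V G = {t \<in> exps V. \<exists>g\<in>G. g divs t}"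

lemma upset_gen_superset: "G \<subseteq> exps V \<Longrightarrow> G \<subseteq> upset_gen V G"
  unfolding upset_gen_def using divs_refl by blast

lemma monomial_image_supported: "E \<subseteq> F \<Longrightarrow> monomial ` E \<subseteq> supported F"
  by auto

lemma upset_upset_gen: "upset V (upset_gen V G)"
  unfolding upset_def upset_gen_def using divs_trans divs_add(1) by (fastforce simp: add.commute)

lemma upset_gen_upset: "upset V E \<Longrightarrow> upset_gen V E = E"
  using upset_divs upsetD divs_refl unfolding upset_gen_def by blast

lemma mpoly_in_ideal:
  assumes W: "is_ideal (polys V) W" and p: "p \<in> polys V" "\<And>t. t \<in> keys p \<Longrightarrow> monomial t \<in> W"
  shows "p \<in> W"
proof -
  interpret carrier_subring "polys V :: 'a mpoly set" by (rule carrier_subring_polys)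
  have "(\<Sum>t\<in>keys p. single t (lookup p t)) \<in> W"
  proof (rule ideal_sum[OF W])
    fix t assume "t \<in> keys p"
    then have "single 0 (lookup p t) * monomial t \<in> W"
      by (intro is_idealD(4)[OF W] p(2)) (simp_all add: polys_eq)
    then show "single t (lookup p t) \<in> W" by (simp add: monomial_def mult_single)
  qed
  then show ?thesis using mpoly_expand[of p] by simp
qed

lemma genideal_monomials:
  assumes G: "G \<subseteq> exps V"
  shows "Idl\<^bsub>poly_ring V\<^esub> (monomial ` G :: 'k::field mpoly set) = supported (upset_gen V G)"
proof
  interpret R: cring "poly_ring V :: 'k mpoly ring" by (rule cring_poly_ring)
  have sub: "monomial ` G \<subseteq> (supported (upset_gen V G) :: 'k mpoly set)"
    by (rule monomial_image_supported[OF upset_gen_superset[OF G]])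
  have car: "monomial ` G \<subseteq> carrier (poly_ring V :: 'k mpoly ring)"
    using monomial_image_supported[OF G] by (simp add: polys_eq)
  show "Idl\<^bsub>poly_ring V\<^esub> (monomial ` G :: 'k mpoly set) \<subseteq> supported (upset_gen V G)"
    using R.genideal_minimal[OF _ sub] ideal_iff_is_ideal is_ideal_supported[OF upset_upset_gen] by blast
  have I: "is_ideal (polys V) (Idl\<^bsub>poly_ring V\<^esub> (monomial ` G :: 'k mpoly set))"
    using R.genideal_ideal[OF car] ideal_iff_is_ideal by blast
  show "supported (upset_gen V G) \<subseteq> Idl\<^bsub>poly_ring V\<^esub> (monomial ` G :: 'k mpoly set)"
  proof
    fix p :: "'k mpoly" assume p: "p \<in> supported (upset_gen V G)"
    show "p \<in> Idl\<^bsub>poly_ring V\<^esub> (monomial ` G)"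
    proof (rule mpoly_in_ideal[OF I])
      show "p \<in> polys V" using p upset_upset_gen[of V G] by (auto simp: polys_eq upset_def supported_def)
      fix t assume "t \<in> keys p"
      then obtain g where g: "t \<in> exps V" "g \<in> G" "g divs t" using p by (auto simp: supported_def upset_gen_def)
      then obtain w where w: "t = w + g" by (metis divs_iff add.commute)
      have "monomial g \<in> Idl\<^bsub>poly_ring V\<^esub> (monomial ` G :: 'k mpoly set)"
        using R.genideal_self[OF car] g by blast
      moreover have "monomial w \<in> (polys V :: 'k mpoly set)" using g w by (simp add: polys_eq)
      ultimately show "monomial t \<in> Idl\<^bsub>poly_ring V\<^esub> (monomial ` G :: 'k mpoly set)"
        unfolding w monomial_add by (intro is_idealD(4)[OF I])
    qed
  qed
qed

lemma monomials_eq: "monomials V = monomial ` exps V"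
  by (simp add: monomials_def exps_def)

lemma monomial_ideal_iff:
  "monomial_ideal V (I :: 'k::field mpoly set) \<longleftrightarrow> (\<exists>E. upset V E \<and> I = supported E)"
proof
  assume "monomial_ideal V I"
  then obtain S where "S \<subseteq> monomials V" "I = Idl\<^bsub>poly_ring V\<^esub> S" unfolding monomial_ideal_def by blast
  moreover from this obtain G where "S = monomial ` G" "G \<subseteq> exps V"
    unfolding monomials_eq subset_image_iff by blast
  ultimately show "\<exists>E. upset V E \<and> I = supported E" using genideal_monomials upset_upset_gen by blast
next
  assume "\<exists>E. upset V E \<and> I = supported E"
  then obtain E where E: "upset V E" "I = supported E" by blast
  then have "I = Idl\<^bsub>poly_ring V\<^esub> (monomial ` E)" "monomial ` E \<subseteq> (monomials V :: 'k mpoly set)"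
    using genideal_monomials[of E V] by (auto simp: upset_gen_upset monomials_eq upset_def)
  then show "monomial_ideal V I" unfolding monomial_ideal_def by blast
qed

text \<open>Extension of a monomial ideal to a larger polynomial ring; this is how the extended
  ideals of \<open>I\<close> and \<open>J\<close> in \<open>R\<close> are computed.\<close>

lemma genideal_supported:
  assumes "upset V E" "V \<subseteq> W"
  shows "Idl\<^bsub>poly_ring W\<^esub> (supported E :: 'k::field mpoly set) = supported (upset_gen W E)"
proof
  interpret R: cring "poly_ring W :: 'k mpoly ring" by (rule cring_poly_ring)
  have E: "E \<subseteq> exps W" using assms exps_mono[OF assms(2)] unfolding upset_def by (meson order_trans)
  show "Idl\<^bsub>poly_ring W\<^esub> (supported E :: 'k mpoly set) \<subseteq> supported (upset_gen W E)"
    by (rule R.genideal_minimal)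
      (simp_all add: ideal_iff_is_ideal is_ideal_supported upset_upset_gen supported_mono upset_gen_superset[OF E])
  have "Idl\<^bsub>poly_ring W\<^esub> (monomial ` E :: 'k mpoly set) \<subseteq> Idl\<^bsub>poly_ring W\<^esub> (supported E)"
  proof (rule R.genideal_minimal)
    have "supported E \<subseteq> carrier (poly_ring W :: 'k mpoly ring)"
      using E by (simp add: polys_eq supported_mono)
    then show "ideal (Idl\<^bsub>poly_ring W\<^esub> (supported E :: 'k mpoly set)) (poly_ring W)"
      "monomial ` E \<subseteq> Idl\<^bsub>poly_ring W\<^esub> (supported E :: 'k mpoly set)"
      using R.genideal_ideal R.genideal_self monomial_image_supported[of E E] by (blast, blast)
  qed
  then show "supported (upset_gen W E) \<subseteq> Idl\<^bsub>poly_ring W\<^esub> (supported E :: 'k mpoly set)"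
    using genideal_monomials[OF E] by blast
qed

lemma set_add_poly_ring: "A <+>\<^bsub>poly_ring V\<^esub> B = {a + b | a b. a \<in> A \<and> b \<in> B}"
  by (auto simp: set_add_defs)

lemma set_add_supported:
  "supported E <+>\<^bsub>poly_ring V\<^esub> supported F = (supported (E \<union> F) :: 'k::field mpoly set)"
proof
  show "supported E <+>\<^bsub>poly_ring V\<^esub> supported F \<subseteq> (supported (E \<union> F) :: 'k mpoly set)"
    unfolding set_add_poly_ring
    using supported_mono[of E "E \<union> F"] supported_mono[of F "E \<union> F"] by (auto intro!: supported_add)
  show "(supported (E \<union> F) :: 'k mpoly set) \<subseteq> supported E <+>\<^bsub>poly_ring V\<^esub> supported F"
  proof
    fix p :: "'k mpoly" assume p: "p \<in> supported (E \<union> F)"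
    have "keys (p - restr E p) \<subseteq> F"
      using p by (auto simp: in_keys_iff lookup_minus lookup_restr supported_def split: if_splits)
    then have "restr E p \<in> supported E" "p - restr E p \<in> supported F" "p = restr E p + (p - restr E p)"
      using restr_supported by (auto simp: supported_def)
    then show "p \<in> supported E <+>\<^bsub>poly_ring V\<^esub> supported F" unfolding set_add_poly_ring by blast
  qed
qed

lemma ideal_prod_supported:
  "ideal_prod (poly_ring V) (supported E) (supported F) = (supported (sumset E F) :: 'k::field mpoly set)"
    (is "?L = ?R")
proof
  show "?L \<subseteq> ?R"
  proof
    fix x :: "'k mpoly" assume "x \<in> ?L"
    then show "x \<in> ?R"
    proof (induction rule: ideal_prod.induct)
      case (prod i j) then show ?case by (auto simp: sumset_def intro: supported_mult)
    next
      case (sum a b) then show ?case by (simp add: supported_add)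
    qed
  qed
  show "?R \<subseteq> ?L"
  proof
    fix p :: "'k mpoly" assume p: "p \<in> ?R"
    have mono: "single t c \<in> ?L" if "t \<in> sumset E F" for t and c :: 'k
    proof -
      obtain u w where "t = u + w" "u \<in> E" "w \<in> F" using \<open>t \<in> sumset E F\<close> by (auto simp: sumset_def)
      then show ?thesis
        using ideal_prod.prod[of "single u c" "supported E" "monomial w" "supported F" "poly_ring V"]
        by (simp add: monomial_def mult_single)
    qed
    have "(\<Sum>t\<in>A. single t (lookup p t)) \<in> ?L" if "finite A" "A \<subseteq> keys p" for A
      using that
    proof (induction A)
      case empty
      then show ?case
        using ideal_prod.prod[of 0 "supported E" 0 "supported F" "poly_ring V"] by simp
    next
      case (insert t A)
      then have "single t (lookup p t) \<in> ?L" using p by (intro mono) (auto simp: supported_def)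
      then show ?case using insert ideal_prod.sum[of _ "poly_ring V"] by fastforce
    qed
    then show "p \<in> ?L" using mpoly_expand[of p] by (metis finite_keys order_refl)
  qed
qed

lemma irrelevant_ideal_eq:
  "irrelevant_ideal V = (supported (exps V - {0}) :: 'k::field mpoly set)"
proof -
  have "irrelevant_ideal V = (supported (upset_gen V ((\<lambda>v. single v 1) ` V)) :: 'k mpoly set)"
    using genideal_monomials[of "(\<lambda>v. single v 1) ` V" V, where ?'k = 'k]
    by (simp add: irrelevant_ideal_def image_image image_subset_iff)
  also have "upset_gen V ((\<lambda>v. single v 1) ` V) = exps V - {0}"
  proof (rule Set.set_eqI)
    fix t
    show "t \<in> upset_gen V ((\<lambda>v. single v 1) ` V) \<longleftrightarrow> t \<in> exps V - {0}"
    proof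
      assume "t \<in> upset_gen V ((\<lambda>v. single v 1) ` V)"
      then obtain v where "t \<in> exps V" "single v 1 divs t" by (auto simp: upset_gen_def)
      moreover from this have "lookup t v \<noteq> 0" unfolding divs_def
        by (metis lookup_single_eq not_one_le_zero)
      ultimately show "t \<in> exps V - {0}" by auto
    next
      assume t: "t \<in> exps V - {0}"
      then obtain v where v: "lookup t v \<noteq> 0" by (metis DiffE insertI1 lookup_zero poly_mapping_eqI)
      then have "v \<in> V" "single v 1 divs t"
        using t exps_lookup[of t V v] by (auto simp: divs_def lookup_single when_def)
      then show "t \<in> upset_gen V ((\<lambda>v. single v 1) ` V)" using t by (auto simp: upset_gen_def)
    qed
  qed
  finally show ?thesis .
qed

lemma upset_irrelevant: "upset V (exps V - {0})"
proof -
  have "t + u = 0 \<Longrightarrow> t = 0" for t u :: expo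
    by (metis add_eq_0_iff_both_eq_0 lookup_add lookup_zero poly_mapping_eqI)
  then show ?thesis unfolding upset_def by auto
qed

lemma noetherian_local_polys:
  "finite V \<Longrightarrow> noetherian_local (polys V) (irrelevant_ideal V :: 'k::field mpoly set)"
  using noetherian_polys[of V] is_ideal_supported[OF upset_irrelevant, of V]
  by (simp add: noetherian_local_def noetherian_local_axioms_def irrelevant_ideal_eq)

lemma proper_upset: "upset V E \<Longrightarrow> E \<noteq> exps V \<longleftrightarrow> 0 \<notin> E"
  unfolding upset_def by (metis add.left_neutral subset_antisym subset_iff zero_exps)

section \<open>Combinatorial Stanley decompositions\<close>

text \<open>For \<open>c = (t, Z)\<close>, the exponents that occur in the Stanley space generated
  by the monomial of \<open>t\<close> over \<open>K[Z]\<close>.\<close>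

definition cone :: "expo \<times> nat set \<Rightarrow> expo set" where
  "cone c = (+) (fst c) ` exps (snd c)"

text \<open>The combinatorial data of a Stanley decomposition of the span of the monomials in
  \<open>T\<close>, where \<open>T\<close> may be an upset, its complement or a difference of
  upsets. Disjointness is required for positions of the list, so that no cone is listed
  twice.\<close>

definition cone_partition :: "nat set \<Rightarrow> expo set \<Rightarrow> (expo \<times> nat set) list \<Rightarrow> bool" where
  "cone_partition V T D \<longleftrightarrow>
     (\<forall>c\<in>set D. snd c \<subseteq> V) \<and> T = (\<Union>c\<in>set D. cone c) \<and>
     (\<forall>i<length D. \<forall>j<length D. i \<noteq> j \<longrightarrow> cone (D ! i) \<inter> cone (D ! j) = {})"

definition cones_ge :: "nat set \<Rightarrow> expo set \<Rightarrow> nat \<Rightarrow> bool" where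
  "cones_ge V T q \<longleftrightarrow> (\<exists>D. cone_partition V T D \<and> (\<forall>c\<in>set D. q \<le> card (snd c)))"

lemma cone_nonempty: "fst c \<in> cone c"
  unfolding cone_def using zero_exps by (metis add.right_neutral imageI)

lemma cone_iff: "t \<in> cone c \<longleftrightarrow> fst c divs t \<and> t - fst c \<in> exps (snd c)"
  unfolding cone_def divs_iff by auto

text \<open>As cones are nonempty, disjointness forces the cones of a partition to be distinct, so
  partitions may be given as sets.\<close>

lemma cones_ge_iff:
  "cones_ge V T q \<longleftrightarrow> (\<exists>C. finite C \<and> (\<forall>c\<in>C. snd c \<subseteq> V \<and> q \<le> card (snd c)) \<and> T = (\<Union>c\<in>C. cone c) \<and>
     (\<forall>c\<in>C. \<forall>d\<in>C. c \<noteq> d \<longrightarrow> cone c \<inter> cone d = {}))" (is "_ \<longleftrightarrow> (\<exists>C. ?P C)")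
proof
  assume "cones_ge V T q"
  then obtain D where D: "cone_partition V T D" "\<forall>c\<in>set D. q \<le> card (snd c)"
    unfolding cones_ge_def by blast
  have "cone c \<inter> cone d = {}" if "c \<in> set D" "d \<in> set D" "c \<noteq> d" for c d
    using that D(1) unfolding cone_partition_def in_set_conv_nth by metis
  then have "?P (set D)" using D unfolding cone_partition_def by simp
  then show "\<exists>C. ?P C" ..
next
  assume "\<exists>C. ?P C"
  then obtain C where C: "?P C" ..
  then have disj: "cone c \<inter> cone d = {}" if "c \<in> C" "d \<in> C" "c \<noteq> d" for c d
    using that by simp
  from C have "finite C" by (rule conjunct1)
  then obtain D where D: "set D = C" "distinct D" using finite_distinct_list by blast
  have "cone (D ! i) \<inter> cone (D ! j) = {}" if "i < length D" "j < length D" "i \<noteq> j" for i j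
  proof -
    have "D ! i \<in> C" "D ! j \<in> C" "D ! i \<noteq> D ! j"
      using D that by (auto simp: nth_eq_iff_index_eq)
    then show ?thesis by (rule disj)
  qed
  then have "cone_partition V T D" using C D unfolding cone_partition_def by simp
  then show "cones_ge V T q" unfolding cones_ge_def using C D by blast
qed

lemma cones_ge_empty: "cones_ge V {} q"
  unfolding cones_ge_iff by (intro exI[of _ "{}"]) simp

lemma cones_ge_exps: "finite V \<Longrightarrow> cones_ge V (exps V) (card V)"
  unfolding cones_ge_iff by (intro exI[of _ "{(0, V)}"]) (simp add: cone_def)

lemma cones_ge_mono:
  assumes "cones_ge V T q" "V \<subseteq> W" "q' \<le> q"
  shows "cones_ge W T q'"
proof -
  obtain D where "cone_partition V T D" "\<forall>c\<in>set D. q \<le> card (snd c)"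
    using assms(1) unfolding cones_ge_def by blast
  then have "cone_partition W T D" "\<forall>c\<in>set D. q' \<le> card (snd c)"
    using assms(2,3) unfolding cone_partition_def by auto
  then show ?thesis unfolding cones_ge_def by blast
qed

lemma cones_ge_UN:
  assumes "finite A" "\<And>i. i \<in> A \<Longrightarrow> cones_ge V (T i) q"
    and "\<And>i j. i \<in> A \<Longrightarrow> j \<in> A \<Longrightarrow> i \<noteq> j \<Longrightarrow> T i \<inter> T j = {}"
  shows "cones_ge V (\<Union>i\<in>A. T i) q"
proof -
  have "\<forall>i\<in>A. \<exists>C. finite C \<and> (\<forall>c\<in>C. snd c \<subseteq> V \<and> q \<le> card (snd c)) \<and> T i = (\<Union>c\<in>C. cone c) \<and>
     (\<forall>c\<in>C. \<forall>d\<in>C. c \<noteq> d \<longrightarrow> cone c \<inter> cone d = {})"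
    using assms(2) unfolding cones_ge_iff by blast
  from bchoice[OF this] obtain C where C: "\<forall>i\<in>A. finite (C i) \<and> (\<forall>c\<in>C i. snd c \<subseteq> V \<and> q \<le> card (snd c)) \<and>
     T i = (\<Union>c\<in>C i. cone c) \<and> (\<forall>c\<in>C i. \<forall>d\<in>C i. c \<noteq> d \<longrightarrow> cone c \<inter> cone d = {})" ..
  have "cone c \<inter> cone d = {}" if "i \<in> A" "j \<in> A" "c \<in> C i" "d \<in> C j" "c \<noteq> d" for i j c d
  proof (cases "i = j")
    case True then show ?thesis using C that by blast
  next
    case False
    have "cone c \<subseteq> T i" "cone d \<subseteq> T j" using C that by auto
    then show ?thesis using assms(3)[OF that(1,2) False] by blast
  qed
  then show ?thesis
    unfolding cones_ge_iff using C assms(1) by (intro exI[of _ "\<Union>i\<in>A. C i"]) auto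
qed

lemma cones_ge_Un:
  assumes "cones_ge V S q" "cones_ge V T q" "S \<inter> T = {}"
  shows "cones_ge V (S \<union> T) q"
  using cones_ge_UN[of "{False, True}" V "\<lambda>b. if b then T else S" q] assms by (auto simp: Un_commute Int_commute)

lemma add_exps_eq_iff:
  assumes "V \<inter> W = {}" "s \<in> exps V" "s' \<in> exps V" "t \<in> exps W" "t' \<in> exps W"
  shows "s + t = s' + t' \<longleftrightarrow> s = s' \<and> t = t'"
proof
  assume eq: "s + t = s' + t'"
  have "lookup s v = lookup s' v \<and> lookup t v = lookup t' v" for v
  proof -
    have "lookup s v + lookup t v = lookup s' v + lookup t' v"
      using arg_cong[OF eq, of "\<lambda>x. lookup x v"] by (simp add: lookup_add)
    moreover have "v \<notin> V \<or> v \<notin> W" using assms(1) by blast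
    ultimately show ?thesis using assms(2-5) by (auto simp: exps_lookup)
  qed
  then show "s = s' \<and> t = t'" by (auto intro: poly_mapping_eqI)
qed auto

lemma exps_Un: "V \<inter> W = {} \<Longrightarrow> exps (V \<union> W) = sumset (exps V) (exps W)"
proof
  assume disj: "V \<inter> W = {}"
  show "exps (V \<union> W) \<subseteq> sumset (exps V) (exps W)"
  proof
    fix t assume t: "t \<in> exps (V \<union> W)"
    define s where "s = Abs_poly_mapping (\<lambda>v. if v \<in> V then lookup t v else 0)"
    have fin: "finite {v. (if v \<in> V then lookup t v else 0) \<noteq> 0}"
      by (rule finite_subset[OF _ finite_lookup[of t]]) auto
    have ls: "lookup s v = (if v \<in> V then lookup t v else 0)" for v
      unfolding s_def by (subst lookup_Abs_poly_mapping[OF fin]) simp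
    then have "s \<in> exps V" "s divs t" by (auto simp: exps_iff divs_def)
    moreover have "t - s \<in> exps W" using t ls by (auto simp: exps_iff lookup_minus)
    ultimately show "t \<in> sumset (exps V) (exps W)" unfolding sumset_def using divs_minus(1)[of s t] by force
  qed
  show "sumset (exps V) (exps W) \<subseteq> exps (V \<union> W)"
    using exps_mono[of V "V \<union> W"] exps_mono[of W "V \<union> W"] by (auto simp: sumset_def)
qed

text \<open>The product of two Stanley decompositions in disjoint sets of variables: apexes are
  added and sets of free variables united. A sum determines its two parts, so the resulting cones
  are again disjoint.\<close>

lemma cones_ge_sumset:
  assumes disj: "V \<inter> W = {}" and fin: "finite V" "finite W" and "cones_ge V S p" "cones_ge W T q"
    and S: "S \<subseteq> exps V" and T: "T \<subseteq> exps W"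
  shows "cones_ge (V \<union> W) (sumset S T) (p + q)"
proof -
  obtain C where C: "finite C" "\<forall>c\<in>C. snd c \<subseteq> V \<and> p \<le> card (snd c)" "S = (\<Union>c\<in>C. cone c)"
     "\<forall>c\<in>C. \<forall>d\<in>C. c \<noteq> d \<longrightarrow> cone c \<inter> cone d = {}"
    using assms(4) unfolding cones_ge_iff by blast
  obtain D where D: "finite D" "\<forall>c\<in>D. snd c \<subseteq> W \<and> q \<le> card (snd c)" "T = (\<Union>c\<in>D. cone c)"
     "\<forall>c\<in>D. \<forall>d\<in>D. c \<noteq> d \<longrightarrow> cone c \<inter> cone d = {}"
    using assms(5) unfolding cones_ge_iff by blast
  define f where "f = (\<lambda>(c, d). (fst c + fst d, snd c \<union> snd d) :: expo \<times> nat set)"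
  have cf: "cone (f (c, d)) = sumset (cone c) (cone d)" if "c \<in> C" "d \<in> D" for c d
  proof -
    have "snd c \<inter> snd d = {}" using disj C(2) D(2) that by blast
    then have "cone (f (c, d)) = (+) (fst c + fst d) ` sumset (exps (snd c)) (exps (snd d))"
      by (simp add: cone_def f_def exps_Un)
    also have "\<dots> = sumset (cone c) (cone d)"
      unfolding sumset_def cone_def by (force simp: ac_simps)
    finally show ?thesis .
  qed
  have disjC: "cone (f (c, d)) \<inter> cone (f (c', d')) = {}"
    if cd: "c \<in> C" "d \<in> D" "c' \<in> C" "d' \<in> D" "(c, d) \<noteq> (c', d')" for c d c' d'
  proof (rule ccontr)
    assume "cone (f (c, d)) \<inter> cone (f (c', d')) \<noteq> {}"
    then obtain u where "u \<in> cone (f (c, d))" "u \<in> cone (f (c', d'))" by blast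
    then obtain s t s' t' where st: "s + t = s' + t'" "s \<in> cone c" "t \<in> cone d" "s' \<in> cone c'" "t' \<in> cone d'"
      unfolding cf[OF cd(1,2)] cf[OF cd(3,4)] sumset_def by auto
    then have "s \<in> exps V" "s' \<in> exps V" "t \<in> exps W" "t' \<in> exps W"
      using S T C(3) D(3) cd by blast+
    then have "s = s'" "t = t'" using st(1) add_exps_eq_iff[OF disj] by blast+
    then show False using st cd C(4) D(4) by blast
  qed
  have "finite (f ` (C \<times> D))" using C(1) D(1) by simp
  moreover have "snd (f (c, d)) \<subseteq> V \<union> W \<and> p + q \<le> card (snd (f (c, d)))" if "c \<in> C" "d \<in> D" for c d
  proof -
    have "snd c \<subseteq> V" "snd d \<subseteq> W" "p \<le> card (snd c)" "q \<le> card (snd d)" using C D that by auto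
    moreover from this have "card (snd c \<union> snd d) = card (snd c) + card (snd d)"
      using fin disj by (intro card_Un_disjoint) (auto intro: finite_subset)
    ultimately show ?thesis by (auto simp: f_def)
  qed
  moreover have "sumset S T = (\<Union>c\<in>f ` (C \<times> D). cone c)"
  proof -
    have "sumset S T = (\<Union>(c, d)\<in>C \<times> D. sumset (cone c) (cone d))"
      unfolding C(3) D(3) sumset_def by blast
    also have "\<dots> = (\<Union>(c, d)\<in>C \<times> D. cone (f (c, d)))" using cf by auto
    finally show ?thesis by auto
  qed
  moreover have "cone x \<inter> cone y = {}" if "x \<in> f ` (C \<times> D)" "y \<in> f ` (C \<times> D)" "x \<noteq> y" for x y
  proof -
    obtain c d c' d' where "x = f (c, d)" "y = f (c', d')" "c \<in> C" "d \<in> D" "c' \<in> C" "d' \<in> D"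
      using \<open>x \<in> _\<close> \<open>y \<in> _\<close> by (elim imageE SigmaE) simp
    then show ?thesis using disjC[of c d c' d'] \<open>x \<noteq> y\<close> by blast
  qed
  ultimately show ?thesis unfolding cones_ge_iff by (intro exI[of _ "f ` (C \<times> D)"]) auto
qed

lemma cones_ge_translate:
  assumes "cones_ge V T q"
  shows "cones_ge V ((+) a ` T) q"
proof -
  obtain C where C: "finite C" "\<forall>c\<in>C. snd c \<subseteq> V \<and> q \<le> card (snd c)" "T = (\<Union>c\<in>C. cone c)"
     "\<forall>c\<in>C. \<forall>d\<in>C. c \<noteq> d \<longrightarrow> cone c \<inter> cone d = {}"
    using assms unfolding cones_ge_iff by blast
  define f where "f c = (a + fst c, snd c)" for c :: "expo \<times> nat set"
  have cf: "cone (f c) = (+) a ` cone c" for c by (simp add: cone_def f_def image_image add.assoc)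
  have "cone (f c) \<inter> cone (f d) = {}" if "c \<in> C" "d \<in> C" "f c \<noteq> f d" for c d
    using C(4) that unfolding cf by (metis image_Int image_is_empty inj_on_add)
  moreover have "(+) a ` T = (\<Union>c\<in>f ` C. cone c)" using C(3) cf by auto
  ultimately show ?thesis
    unfolding cones_ge_iff using C(1,2) by (intro exI[of _ "f ` C"]) (auto simp: f_def)
qed

text \<open>If \<open>t0 + u\<close> lies in the cone, the apex dominates \<open>u\<close> outside
  the free variables, so truncated subtraction is exact there. In a free variable the cone imposes
  only a lower bound, for which truncation at 0 is correct.\<close>

lemma cone_colon:
  "{t. t + u \<in> cone c} = {} \<or> {t. t + u \<in> cone c} = cone (fst c - u, snd c)"
proof (cases "\<exists>t. t + u \<in> cone c")
  case True
  then obtain t0 where t0: "t0 + u \<in> cone c" by blast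
  have "t + u \<in> cone c \<longleftrightarrow> t \<in> cone (fst c - u, snd c)" for t
  proof -
    have le: "lookup (fst c) v \<le> lookup t0 v + lookup u v" for v
      using t0 by (auto simp: cone_iff divs_def lookup_add)
    have eq: "lookup (fst c) v = lookup t0 v + lookup u v" if "v \<notin> snd c" for v
    proof -
      have "lookup (t0 + u - fst c) v = 0" using t0 that by (auto simp: cone_iff exps_lookup)
      then show ?thesis using le[of v] by (simp add: lookup_minus lookup_add)
    qed
    have "t + u \<in> cone c \<longleftrightarrow> (\<forall>v. lookup (fst c) v \<le> lookup t v + lookup u v \<and>
        (v \<notin> snd c \<longrightarrow> lookup t v + lookup u v \<le> lookup (fst c) v))"
      by (auto simp: cone_iff divs_def exps_iff lookup_add lookup_minus)
    also have "\<dots> \<longleftrightarrow> (\<forall>v. lookup (fst c) v - lookup u v \<le> lookup t v \<and>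
        (v \<notin> snd c \<longrightarrow> lookup t v \<le> lookup (fst c) v - lookup u v))"
      using eq by (intro all_cong1) fastforce
    also have "\<dots> \<longleftrightarrow> t \<in> cone (fst c - u, snd c)"
      by (auto simp: cone_iff divs_def exps_iff lookup_minus)
    finally show ?thesis .
  qed
  then show ?thesis by blast
qed blast

text \<open>Division by the monomial of \<open>u\<close> turns every cone into the empty set or into
  a cone with the same free variables. All monotonicity statements about Stanley depth come from
  this.\<close>

lemma cones_ge_colon:
  assumes "cones_ge V T q"
  shows "cones_ge V {t. t + u \<in> T} q"
proof -
  obtain C where C: "finite C" "\<forall>c\<in>C. snd c \<subseteq> V \<and> q \<le> card (snd c)" "T = (\<Union>c\<in>C. cone c)"
     "\<forall>c\<in>C. \<forall>d\<in>C. c \<noteq> d \<longrightarrow> cone c \<inter> cone d = {}"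
    using assms unfolding cones_ge_iff by blast
  have "cones_ge V (\<Union>c\<in>C. {t. t + u \<in> cone c}) q"
  proof (rule cones_ge_UN[OF C(1)])
    fix c assume c: "c \<in> C"
    have "cones_ge V (cone (fst c - u, snd c)) q"
      unfolding cones_ge_iff using C(2) c by (intro exI[of _ "{(fst c - u, snd c)}"]) auto
    then show "cones_ge V {t. t + u \<in> cone c} q" using cone_colon[of u c] cones_ge_empty by metis
  qed (use C(4) in blast)
  moreover have "(\<Union>c\<in>C. {t. t + u \<in> cone c}) = {t. t + u \<in> T}" using C(3) by auto
  ultimately show ?thesis by simp
qed

text \<open>Existence of some Stanley decomposition, by induction on the variables. The slices
  \<open>F p\<close> at \<open>x^p\<close> grow with \<open>p\<close> and are constant from some
  \<open>N\<close> on. The finitely many slices below \<open>N\<close> are treated separately, all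
  the others together as a ray in \<open>x\<close> times the slice at \<open>N\<close>.\<close>

lemma ex_cones_complement:
  assumes "finite V" "upset V E"
  shows "cones_ge V (exps V - E) 0"
  using assms
proof (induction V arbitrary: E)
  case empty
  have "exps {} = {0}" by (auto simp: exps_def poly_mapping_eq_iff fun_eq_iff in_keys_iff)
  then have "exps {} - E = {} \<or> exps {} - E = exps {}" by auto
  then show ?case using cones_ge_empty cones_ge_exps[of "{}"] by (metis card.empty finite.emptyI)
next
  case (insert x V)
  define F where "F p = {t \<in> exps V. t + single x p \<in> E}" for p
  have sub: "exps V \<subseteq> exps (insert x V)" by (rule exps_mono) blast
  have FU: "upset V (F p)" for p
    unfolding upset_def
  proof (intro conjI ballI)
    fix t u assume tu: "t \<in> F p" "u \<in> exps V"
    have "t + u + single x p = (t + single x p) + u" by (simp add: ac_simps)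
    then show "t + u \<in> F p" using tu insert.prems sub by (auto simp: F_def upset_def)
  qed (auto simp: F_def)
  have "F p \<subseteq> F (Suc p)" for p
  proof
    fix t assume t: "t \<in> F p"
    have "t + single x (Suc p) = (t + single x p) + single x 1" by (simp add: add.assoc flip: single_add)
    then show "t \<in> F (Suc p)" using t insert.prems by (auto simp: F_def upset_def)
  qed
  then have "\<exists>N. \<forall>p\<ge>N. F p = F N" by (rule upset_chain_stable[OF insert.hyps(1) FU])
  then obtain N where N: "\<forall>p\<ge>N. F p = F N" ..
  define T where "T p = (if p < N then sumset {single x p} (exps V - F p)
    else sumset ((+) (single x N) ` exps {x}) (exps V - F N))" for p
  have decomp: "\<exists>t\<in>exps V. \<exists>p. u = single x p + t" if u: "u \<in> exps (insert x V)" for u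
  proof -
    obtain a t where "u = a + t" "a \<in> exps {x}" "t \<in> exps V"
      using exps_Un[of "{x}" V] u insert.hyps(2) by (auto simp: sumset_def)
    moreover from this have "a = single x (lookup a x)"
      by (intro poly_mapping_eqI) (auto simp: lookup_single when_def exps_iff)
    ultimately show ?thesis by metis
  qed
  have inE: "single x p + t \<in> E \<longleftrightarrow> t \<in> F p" if "t \<in> exps V" for p t
    using that by (simp add: F_def add.commute)
  have lk: "lookup t x = 0" if "t \<in> exps V" for t using that insert.hyps(2) by (rule exps_lookup)
  have T_iff: "single x p + t \<in> T q \<longleftrightarrow> t \<notin> F p \<and> (if q < N then q = p else N \<le> p)"
    if t: "t \<in> exps V" for p t q
  proof (cases "q < N")
    case True
    have "single x p + t \<in> T q \<longleftrightarrow> (\<exists>t'\<in>exps V - F q. single x p + t = single x q + t')"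
      using True by (auto simp: T_def sumset_def)
    also have "\<dots> \<longleftrightarrow> (\<exists>t'\<in>exps V - F q. single x p = single x q \<and> t = t')"
      using add_exps_eq_iff[of "{x}" V "single x p"] t insert.hyps(2) by (intro bex_cong refl) auto
    also have "single x p = single x q \<longleftrightarrow> p = q" by (metis lookup_single_eq)
    finally show ?thesis using True t by auto
  next
    case False
    have "single x p + t \<in> T q \<longleftrightarrow> (\<exists>a\<in>exps {x}. \<exists>t'\<in>exps V - F N. single x p + t = (single x N + a) + t')"
      using False by (auto simp: T_def sumset_def)
    also have "\<dots> \<longleftrightarrow> (\<exists>a\<in>exps {x}. \<exists>t'\<in>exps V - F N. single x p = single x N + a \<and> t = t')"
      using add_exps_eq_iff[of "{x}" V "single x p"] t insert.hyps(2) by (intro bex_cong refl) auto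
    also have "\<dots> \<longleftrightarrow> (\<exists>a\<in>exps {x}. single x p = single x N + a) \<and> t \<notin> F N" using t by auto
    also have "(\<exists>a\<in>exps {x}. single x p = single x N + a) \<longleftrightarrow> N \<le> p"
    proof
      assume "\<exists>a\<in>exps {x}. single x p = single x N + a"
      then show "N \<le> p" by (metis le_add1 lookup_add lookup_single_eq)
    next
      assume "N \<le> p"
      then have "single x p = single x N + single x (p - N)" by (simp flip: single_add)
      then show "\<exists>a\<in>exps {x}. single x p = single x N + a" by (intro bexI) auto
    qed
    finally show ?thesis using N[rule_format, of p] False by auto
  qed
  have TV: "T q \<subseteq> exps (insert x V)" for q
  proof -
    have "exps {x} \<subseteq> exps (insert x V)" by (rule exps_mono) blast
    then show ?thesis using sub by (auto simp: T_def sumset_def)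
  qed
  have "cones_ge (insert x V) (\<Union>q\<in>{..N}. T q) 0"
  proof (rule cones_ge_UN)
    fix q
    have "cones_ge (insert x V) (sumset (exps {}) (exps V - F q)) (0 + 0)" for q
      using cones_ge_sumset[OF _ _ _ cones_ge_exps[of "{}"] insert.IH[OF FU[of q]]] insert.hyps(1)
      by (auto elim: cones_ge_mono)
    then have 1: "cones_ge (insert x V) ((+) (single x q) ` sumset (exps {}) (exps V - F q)) 0" for q
      using cones_ge_translate by fastforce
    have 2: "(+) (single x q) ` sumset (exps {}) G = sumset {single x q} G" for q G
    proof -
      have "exps {} = {0}" by (auto simp: exps_def poly_mapping_eq_iff fun_eq_iff in_keys_iff)
      then show ?thesis by (auto simp: sumset_def)
    qed
    have "cones_ge ({x} \<union> V) (sumset ((+) (single x N) ` exps {x}) (exps V - F N)) (1 + 0)"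
      using cones_ge_translate[OF cones_ge_exps[of "{x}"], of "single x N"] insert.hyps
      by (intro cones_ge_sumset insert.IH[OF FU]) auto
    then show "cones_ge (insert x V) (T q) 0"
      using 1[of q] unfolding 2 T_def by (auto elim: cones_ge_mono)
  next
    fix q q' assume "q \<in> {..N}" "q' \<in> {..N}" "q \<noteq> q'"
    moreover have False if "u \<in> T q" "u \<in> T q'" for u
    proof -
      obtain t p where "t \<in> exps V" "u = single x p + t" using decomp TV \<open>u \<in> T q\<close> by blast
      then show False
        using that T_iff[of t p q] T_iff[of t p q'] \<open>q \<in> {..N}\<close> \<open>q' \<in> {..N}\<close> \<open>q \<noteq> q'\<close>
        by (auto split: if_splits)
    qed
    ultimately show "T q \<inter> T q' = {}" by blast
  qed simp
  moreover have "(\<Union>q\<in>{..N}. T q) = exps (insert x V) - E"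
  proof (rule Set.set_eqI)
    fix u
    show "u \<in> (\<Union>q\<in>{..N}. T q) \<longleftrightarrow> u \<in> exps (insert x V) - E"
    proof (cases "u \<in> exps (insert x V)")
      case True
      then obtain t p where t: "t \<in> exps V" "u = single x p + t" using decomp by blast
      have "(\<exists>q\<in>{..N}. if q < N then q = p else N \<le> p)"
        by (cases "p < N") (auto intro: bexI[of _ p] bexI[of _ N])
      then show ?thesis using True unfolding t(2) by (auto simp: T_iff[OF t(1)] inE[OF t(1)])
    qed (use TV in auto)
  qed
  ultimately show ?case by simp
qed

section \<open>Stanley depth in terms of cones\<close>

definition cone_depth :: "nat set \<Rightarrow> expo set \<Rightarrow> enat" where
  "cone_depth V T = Sup {(INF Z \<in> snd ` set D. enat (card Z)) | D. cone_partition V T D}"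

lemma cones_ge_imp_le_cone_depth: "cones_ge V T q \<Longrightarrow> enat q \<le> cone_depth V T"
  unfolding cones_ge_def cone_depth_def
  by (elim exE conjE, rule Sup_upper2) (auto simp: le_INF_iff)

lemma enat_le_iff_all: "(x :: enat) \<le> y \<longleftrightarrow> (\<forall>q. enat q \<le> x \<longrightarrow> enat q \<le> y)"
proof
  assume *: "\<forall>q. enat q \<le> x \<longrightarrow> enat q \<le> y"
  show "x \<le> y"
  proof (cases x)
    case (enat n) then show ?thesis using * by simp
  next
    case infinity
    then have "y \<ge> enat q" for q using * by simp
    then show ?thesis by (metis enat.exhaust enat_ord_simps(1) enat_ord_simps(3) not_less_eq_eq order_refl)
  qed
qed (auto intro: order_trans)

lemma cone_depth_mono:
  assumes "\<And>q. cones_ge V T q \<Longrightarrow> cones_ge V T' q"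
  shows "cone_depth V T \<le> cone_depth V T'"
  unfolding cone_depth_def[of V T]
proof (rule Sup_least)
  fix x assume "x \<in> {(INF Z \<in> snd ` set D. enat (card Z)) | D. cone_partition V T D}"
  then obtain D where D: "x = (INF Z \<in> snd ` set D. enat (card Z))" "cone_partition V T D" by blast
  have "enat q \<le> cone_depth V T'" if "enat q \<le> x" for q
  proof -
    have "enat q \<le> enat (card (snd c))" if "c \<in> set D" for c
      using \<open>enat q \<le> x\<close> that unfolding D(1) by (auto simp: le_INF_iff)
    then have "cones_ge V T q" unfolding cones_ge_def using D(2) by auto
    then show ?thesis using assms cones_ge_imp_le_cone_depth by blast
  qed
  then show "x \<le> cone_depth V T'" by (subst enat_le_iff_all) blast
qed

text \<open>The supremum is attained. For \<open>q = 0\<close> the bound carries no information,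
  because the supremum of the empty set is 0; therefore the existence of some decomposition is
  assumed.\<close>

lemma le_cone_depth_imp_cones_ge:
  assumes "enat q \<le> cone_depth V T" "cones_ge V T 0"
  shows "cones_ge V T q"
proof (rule ccontr)
  assume neg: "\<not> cones_ge V T q"
  then obtain r where q: "q = Suc r" using assms(2) by (metis not0_implies_Suc)
  have "cone_depth V T \<le> enat r"
    unfolding cone_depth_def
  proof (rule Sup_least)
    fix x assume "x \<in> {(INF Z \<in> snd ` set D. enat (card Z)) | D. cone_partition V T D}"
    then obtain D where D: "x = (INF Z \<in> snd ` set D. enat (card Z))" "cone_partition V T D" by blast
    then obtain c where "c \<in> set D" "\<not> q \<le> card (snd c)" using neg unfolding cones_ge_def by blast
    then have "x \<le> enat (card (snd c))" "card (snd c) \<le> r" unfolding D(1) q by (auto intro: INF_lower)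
    then show "x \<le> enat r" by (meson enat_ord_simps(1) order_trans)
  qed
  then show False using assms(1) q by (metis Suc_n_not_le_n enat_ord_simps(1) order_trans)
qed

text \<open>The fine grading has components of dimension at most one, so a nonzero homogeneous
  polynomial is a multiple of a single monomial.\<close>

lemma keys_homogeneous:
  assumes "p \<in> homogeneous a" "t \<in> keys p"
  shows "p = single t (lookup p t)"
proof (rule poly_mapping_eqI)
  fix u show "lookup p u = lookup (single t (lookup p t)) u"
  proof (cases "u \<in> keys p")
    case True
    then have "Poly_Mapping.map int u = Poly_Mapping.map int t" using assms by (simp add: homogeneous_def)
    then have "lookup (Poly_Mapping.map int u) v = lookup (Poly_Mapping.map int t) v" for v by simp
    moreover have "lookup (Poly_Mapping.map int w) v = int (lookup w v)" for w v
      by (simp add: Poly_Mapping.map.rep_eq when_def)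
    ultimately have "lookup u v = lookup t v" for v by (metis of_nat_eq_iff)
    then have "u = t" by (rule poly_mapping_eqI)
    then show ?thesis by simp
  next
    case False
    then show ?thesis using assms(2) by (auto simp: lookup_single when_def in_keys_iff)
  qed
qed

text \<open>The module \<open>M\<close> is identified by \<open>\<kappa>\<close> with the span of
  the monomials in \<open>T\<close>, where multiplication is followed by truncation to
  \<open>T\<close>. A monomial ideal has this form with \<open>T\<close> an upset, a quotient of
  monomial ideals with \<open>T\<close> a difference of upsets; Stanley depth is thus computed once
  for both.\<close>

locale monomial_module =
  fixes V :: "nat set" and T :: "expo set" and M :: "('k::field mpoly, 'b) graded_module"
    and \<kappa> :: "'b \<Rightarrow> 'k mpoly"
  assumes T: "T \<subseteq> exps V"
    and bij: "bij_betw \<kappa> (carrier M) (supported T)"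
    and zeroM: "\<zero>\<^bsub>M\<^esub> \<in> carrier M" "\<kappa> \<zero>\<^bsub>M\<^esub> = 0"
    and addM: "x \<in> carrier M \<Longrightarrow> y \<in> carrier M \<Longrightarrow> x \<oplus>\<^bsub>M\<^esub> y \<in> carrier M"
      "x \<in> carrier M \<Longrightarrow> y \<in> carrier M \<Longrightarrow> \<kappa> (x \<oplus>\<^bsub>M\<^esub> y) = \<kappa> x + \<kappa> y"
    and smultM: "u \<in> polys V \<Longrightarrow> x \<in> carrier M \<Longrightarrow> u \<odot>\<^bsub>M\<^esub> x \<in> carrier M"
      "u \<in> polys V \<Longrightarrow> x \<in> carrier M \<Longrightarrow> \<kappa> (u \<odot>\<^bsub>M\<^esub> x) = restr T (u * \<kappa> x)"
    and componentM: "x \<in> carrier M \<Longrightarrow> x \<in> component M a \<longleftrightarrow> \<kappa> x \<in> homogeneous a"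
begin

lemma \<kappa>_eq_iff: "x \<in> carrier M \<Longrightarrow> y \<in> carrier M \<Longrightarrow> \<kappa> x = \<kappa> y \<longleftrightarrow> x = y"
  using bij by (auto simp: bij_betw_def inj_on_def)

lemma \<kappa>_supported: "x \<in> carrier M \<Longrightarrow> \<kappa> x \<in> supported T"
  using bij by (auto simp: bij_betw_def)

lemma \<kappa>_surj: "p \<in> supported T \<Longrightarrow> \<exists>x\<in>carrier M. \<kappa> x = p"
  using bij unfolding bij_betw_def by (metis imageE)

lemma abelian_monoid: "abelian_monoid M"
proof (rule abelian_monoidI)
  fix x y z assume "x \<in> carrier M" "y \<in> carrier M" "z \<in> carrier M"
  then show "x \<oplus>\<^bsub>M\<^esub> y \<oplus>\<^bsub>M\<^esub> z = x \<oplus>\<^bsub>M\<^esub> (y \<oplus>\<^bsub>M\<^esub> z)"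
    by (subst \<kappa>_eq_iff[symmetric]) (simp_all add: addM add.assoc)
next
  fix x assume "x \<in> carrier M"
  then show "\<zero>\<^bsub>M\<^esub> \<oplus>\<^bsub>M\<^esub> x = x"
    by (subst \<kappa>_eq_iff[symmetric]) (simp_all add: addM zeroM)
next
  fix x y assume "x \<in> carrier M" "y \<in> carrier M"
  then show "x \<oplus>\<^bsub>M\<^esub> y = y \<oplus>\<^bsub>M\<^esub> x"
    by (subst \<kappa>_eq_iff[symmetric]) (simp_all add: addM add.commute)
qed (use addM zeroM in auto)

lemma \<kappa>_finsum:
  assumes "finite A" "w \<in> A \<rightarrow> carrier M"
  shows "(\<Oplus>\<^bsub>M\<^esub>i\<in>A. w i) \<in> carrier M \<and> \<kappa> (\<Oplus>\<^bsub>M\<^esub>i\<in>A. w i) = (\<Sum>i\<in>A. \<kappa> (w i))"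
proof -
  interpret abelian_monoid M by (rule abelian_monoid)
  show ?thesis
    using assms by (induction A) (auto simp: zeroM addM)
qed

lemma \<kappa>_smult_cone:
  assumes "cone (t, Z) \<subseteq> T" "Z \<subseteq> V" "m \<in> carrier M" "\<kappa> m = single t c" "u \<in> polys Z"
  shows "\<kappa> (u \<odot>\<^bsub>M\<^esub> m) = u * single t c" "u * single t c \<in> supported (cone (t, Z))"
proof -
  show sup: "u * single t c \<in> supported (cone (t, Z))"
    using assms(5) unfolding polys_eq
    by (rule supported_mult[of u "exps Z" "single t c" "{t}"]) (auto simp: cone_def add.commute)
  have "u \<in> polys V" using assms(2,5) supported_mono[OF exps_mono] by (auto simp: polys_eq)
  then have "\<kappa> (u \<odot>\<^bsub>M\<^esub> m) = restr T (u * single t c)" using smultM assms by simp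
  then show "\<kappa> (u \<odot>\<^bsub>M\<^esub> m) = u * single t c"
    using restr_id sup supported_mono[OF assms(1)] by auto
qed

lemma stanley_space_eq:
  assumes "cone (t, Z) \<subseteq> T" "Z \<subseteq> V" "m \<in> carrier M" "\<kappa> m = single t c" "c \<noteq> 0"
  shows "stanley_space M m Z = {x \<in> carrier M. \<kappa> x \<in> supported (cone (t, Z))}"
proof
  have "u \<in> polys V" if "u \<in> polys Z" for u :: "'k mpoly"
    using that assms(2) supported_mono[OF exps_mono] by (auto simp: polys_eq)
  then show "stanley_space M m Z \<subseteq> {x \<in> carrier M. \<kappa> x \<in> supported (cone (t, Z))}"
    unfolding stanley_space_def using smultM(1)[OF _ assms(3)] \<kappa>_smult_cone[OF assms(1-4)] by auto
  show "{x \<in> carrier M. \<kappa> x \<in> supported (cone (t, Z))} \<subseteq> stanley_space M m Z"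
  proof
    fix x assume x: "x \<in> {x \<in> carrier M. \<kappa> x \<in> supported (cone (t, Z))}"
    define u where "u = (\<Sum>s\<in>keys (\<kappa> x). single (s - t) (lookup (\<kappa> x) s / c))"
    have key: "s - t \<in> exps Z" "(s - t) + t = s" if "s \<in> keys (\<kappa> x)" for s
      using x that divs_minus(2) by (auto simp: supported_def cone_iff)
    have u: "u \<in> polys Z" unfolding u_def polys_eq using key by (intro supported_sum) simp
    have "u * single t c = (\<Sum>s\<in>keys (\<kappa> x). single s (lookup (\<kappa> x) s))"
      unfolding u_def sum_distrib_right using key assms(5) by (intro sum.cong refl) (simp add: mult_single)
    then have "\<kappa> (u \<odot>\<^bsub>M\<^esub> m) = \<kappa> x"
      using \<kappa>_smult_cone(1)[OF assms(1-4) u] mpoly_expand[of "\<kappa> x"] by simp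
    moreover have "u \<odot>\<^bsub>M\<^esub> m \<in> carrier M"
      using u assms(2,3) supported_mono[OF exps_mono] by (intro smultM) (auto simp: polys_eq)
    ultimately have "x = u \<odot>\<^bsub>M\<^esub> m" using \<kappa>_eq_iff x by blast
    then show "x \<in> stanley_space M m Z" unfolding stanley_space_def using u by blast
  qed
qed

text \<open>Homogeneity makes \<open>m\<close> a multiple of one monomial. A monomial of its cone
  outside \<open>T\<close> would be truncated to 0, against injectivity of the
  multiplication.\<close>

lemma stanley_summand:
  assumes "m \<in> carrier M" "m \<in> component M a" "Z \<subseteq> V" "inj_on (\<lambda>u. u \<odot>\<^bsub>M\<^esub> m) (polys Z)"
  shows "\<exists>t c. \<kappa> m = single t c \<and> c \<noteq> 0 \<and> cone (t, Z) \<subseteq> T"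
proof -
  have sub: "polys Z \<subseteq> (polys V :: 'k mpoly set)"
    using supported_mono[OF exps_mono[OF assms(3)]] by (simp add: polys_eq)
  have inj: "u = u'" if "u \<in> polys Z" "u' \<in> polys Z" "restr T (u * \<kappa> m) = restr T (u' * \<kappa> m)" for u u'
  proof -
    have "u \<odot>\<^bsub>M\<^esub> m = u' \<odot>\<^bsub>M\<^esub> m"
      using that subsetD[OF sub] smultM assms(1) by (subst \<kappa>_eq_iff[symmetric]) simp_all
    then show ?thesis using assms(4) that by (auto dest: inj_onD)
  qed
  have zo: "0 \<in> (polys Z :: 'k mpoly set)" by (simp add: polys_eq)
  have "\<kappa> m \<noteq> 0"
    using inj[OF zo, of 1] supported_monomial[of 0 "exps Z"] by (auto simp: polys_eq)
  then obtain t where t: "t \<in> keys (\<kappa> m)" by (metis keys_eq_empty_mpoly ex_in_conv)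
  define c where "c = lookup (\<kappa> m) t"
  have m: "\<kappa> m = single t c"
    unfolding c_def using keys_homogeneous[OF _ t] componentM[OF assms(1)] assms(2) by blast
  have c: "c \<noteq> 0" using t by (simp add: c_def in_keys_iff)
  have "cone (t, Z) \<subseteq> T"
  proof
    fix s assume "s \<in> cone (t, Z)"
    then obtain w where w: "s = t + w" "w \<in> exps Z" by (auto simp: cone_def)
    show "s \<in> T"
    proof (rule ccontr)
      assume "s \<notin> T"
      then have "restr T (monomial w * \<kappa> m) = restr T (0 * \<kappa> m)"
        unfolding m using w by (simp add: monomial_def mult_single restr_eq_0_iff add.commute)
      then have "monomial w = (0 :: 'k mpoly)" using inj[OF _ zo, of "monomial w"] w(2) by (simp add: polys_eq)
      then show False using keys_monomial[of w] by (metis insert_not_empty keys_zero)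
    qed
  qed
  then show ?thesis using m c by blast
qed

text \<open>Writing the monomial of \<open>s\<close> as a sum of elements of the Stanley spaces
  shows that some cone contains \<open>s\<close>. If two cones contained \<open>s\<close>, its
  monomial could be placed in either summand, against uniqueness of the representation.\<close>

lemma stanley_imp_cones:
  assumes D: "stanley_decomposition V M D"
  shows "\<exists>D'. cone_partition V T D' \<and> map snd D' = map snd D"
proof -
  have "\<exists>t c. \<kappa> (fst (D ! i)) = single t c \<and> c \<noteq> 0 \<and> cone (t, snd (D ! i)) \<subseteq> T"
    and car: "fst (D ! i) \<in> carrier M" "snd (D ! i) \<subseteq> V" if "i < length D" for i
  proof -
    have "D ! i \<in> set D" using that by simp
    then have "fst (D ! i) \<in> carrier M \<and> (\<exists>a. fst (D ! i) \<in> component M a) \<and> snd (D ! i) \<subseteq> V \<and>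
      inj_on (\<lambda>u. u \<odot>\<^bsub>M\<^esub> fst (D ! i)) (polys (snd (D ! i)))"
      using D unfolding stanley_decomposition_def by (auto simp: case_prod_beta)
    then show "\<exists>t c. \<kappa> (fst (D ! i)) = single t c \<and> c \<noteq> 0 \<and> cone (t, snd (D ! i)) \<subseteq> T"
      "fst (D ! i) \<in> carrier M" "snd (D ! i) \<subseteq> V" using stanley_summand by blast+
  qed
  then obtain t c where tc: "\<And>i. i < length D \<Longrightarrow> \<kappa> (fst (D ! i)) = single (t i) (c i)"
    "\<And>i. i < length D \<Longrightarrow> c i \<noteq> 0" "\<And>i. i < length D \<Longrightarrow> cone (t i, snd (D ! i)) \<subseteq> T" by metis
  define C where "C i = cone (t i, snd (D ! i))" for i
  define W where "W i = {x \<in> carrier M. \<kappa> x \<in> supported (C i)}" for i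
  have space: "stanley_space M (fst (D ! i)) (snd (D ! i)) = W i" if "i < length D" for i
    unfolding W_def C_def by (rule stanley_space_eq) (use tc car that in auto)
  have unique: "\<exists>!w. w \<in> (\<Pi>\<^sub>E i \<in> {..<length D}. W i) \<and> x = (\<Oplus>\<^bsub>M\<^esub> i \<in> {..<length D}. w i)"
    if "x \<in> carrier M" for x
  proof -
    have "(\<Pi>\<^sub>E i \<in> {..<length D}. stanley_space M (fst (D ! i)) (snd (D ! i))) = (\<Pi>\<^sub>E i \<in> {..<length D}. W i)"
      using space by (intro PiE_cong) simp
    then show ?thesis using D that unfolding stanley_decomposition_def by simp
  qed
  define D' where "D' = map (\<lambda>i. (t i, snd (D ! i))) [0..<length D]"
  have D'nth: "cone (D' ! i) = C i" if "i < length D" for i using that by (simp add: D'_def C_def)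
  have len: "length D' = length D" by (simp add: D'_def)
  have Wcar: "w \<in> {..<length D} \<rightarrow> carrier M" if "w \<in> (\<Pi>\<^sub>E i \<in> {..<length D}. W i)" for w
    using that by (auto simp: W_def)
  have cover: "\<exists>i<length D. s \<in> C i" if "s \<in> T" for s
  proof -
    have "monomial s \<in> (supported T :: 'k mpoly set)" using that by simp
    then obtain x where x: "x \<in> carrier M" "\<kappa> x = monomial s" using \<kappa>_surj by blast
    obtain w where w: "w \<in> (\<Pi>\<^sub>E i \<in> {..<length D}. W i)" "x = (\<Oplus>\<^bsub>M\<^esub> i \<in> {..<length D}. w i)"
      using unique[OF x(1)] by blast
    have "monomial s = (\<Sum>i<length D. \<kappa> (w i))" using \<kappa>_finsum[OF _ Wcar[OF w(1)]] x w(2) by simp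
    then have "lookup (monomial s :: 'k mpoly) s = (\<Sum>i<length D. lookup (\<kappa> (w i)) s)" by (simp add: lookup_sum)
    then have "(\<Sum>i<length D. lookup (\<kappa> (w i)) s) \<noteq> 0" by (simp add: monomial_def)
    then obtain i where i: "i < length D" "lookup (\<kappa> (w i)) s \<noteq> 0" by (meson lessThan_iff sum.not_neutral_contains_not_neutral)
    then have "\<kappa> (w i) \<in> supported (C i)" using w(1) by (auto simp: W_def PiE_iff)
    then show ?thesis using i by (auto simp: supported_def in_keys_iff subset_iff)
  qed
  have disj: "C i \<inter> C j = {}" if ij: "i < length D" "j < length D" "i \<noteq> j" for i j
  proof (rule ccontr)
    assume "C i \<inter> C j \<noteq> {}"
    then obtain s where s: "s \<in> C i" "s \<in> C j" by blast
    then have "s \<in> T" using tc(3) ij by (auto simp: C_def)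
    then obtain x where x: "x \<in> carrier M" "\<kappa> x = monomial s"
      using \<kappa>_surj[of "monomial s"] by auto
    define w where "w l = (\<lambda>i\<in>{..<length D}. if i = l then x else \<zero>\<^bsub>M\<^esub>)" for l
    have wl: "w l \<in> (\<Pi>\<^sub>E i \<in> {..<length D}. W i) \<and> x = (\<Oplus>\<^bsub>M\<^esub> i \<in> {..<length D}. w l i)"
      if l: "l < length D" "s \<in> C l" for l
    proof
      show wP: "w l \<in> (\<Pi>\<^sub>E i \<in> {..<length D}. W i)"
        using l x zeroM by (auto simp: w_def W_def)
      have "\<kappa> (\<Oplus>\<^bsub>M\<^esub> i \<in> {..<length D}. w l i) = (\<Sum>i<length D. \<kappa> (w l i))"
        using \<kappa>_finsum[OF _ Wcar[OF wP]] by simp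
      also have "\<dots> = (\<Sum>i<length D. if i = l then monomial s else 0)"
        by (intro sum.cong refl) (simp add: w_def x zeroM)
      also have "\<dots> = \<kappa> x" using l x by simp
      finally show "x = (\<Oplus>\<^bsub>M\<^esub> i \<in> {..<length D}. w l i)"
        using \<kappa>_eq_iff x(1) \<kappa>_finsum[OF _ Wcar[OF wP]] by auto
    qed
    have "w i = w j" using unique[OF x(1)] wl[OF ij(1) s(1)] wl[OF ij(2) s(2)] by blast
    then have "w i i = w j i" by simp
    then have "x = \<zero>\<^bsub>M\<^esub>" using ij by (simp add: w_def)
    then have "monomial s = (0 :: 'k mpoly)" using x zeroM by simp
    then show False using keys_monomial[of s] by (metis insert_not_empty keys_zero)
  qed
  have "cone_partition V T D'"
    unfolding cone_partition_def
  proof (intro conjI ballI allI impI)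
    show "snd c \<subseteq> V" if c: "c \<in> set D'" for c
    proof -
      obtain i where "i < length D" "c = (t i, snd (D ! i))" using c by (auto simp: D'_def)
      then show ?thesis using car(2) by simp
    qed
    have "(\<Union>c\<in>set D'. cone c) = (\<Union>i<length D. C i)" by (auto simp: D'_def C_def)
    also have "\<dots> = T" using cover tc(3) by (fastforce simp: C_def)
    finally show "T = (\<Union>c\<in>set D'. cone c)" by simp
    show "cone (D' ! i) \<inter> cone (D' ! j) = {}" if "i < length D'" "j < length D'" "i \<noteq> j" for i j
      using that disj by (simp add: len D'nth)
  qed
  moreover have "map snd D' = map snd D" by (auto simp: D'_def intro: nth_equalityI)
  ultimately show ?thesis by blast
qed

text \<open>The component of \<open>x\<close> in a Stanley space is the truncation of
  \<open>x\<close> to the corresponding cone.\<close>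

lemma cones_imp_stanley:
  assumes D: "cone_partition V T D"
  shows "\<exists>D'. stanley_decomposition V M D' \<and> map snd D' = map snd D"
proof -
  have sub: "cone c \<subseteq> T" "fst c \<in> T" "snd c \<subseteq> V" if "c \<in> set D" for c
  proof -
    have T_eq: "T = (\<Union>c\<in>set D. cone c)" using D unfolding cone_partition_def by blast
    show "cone c \<subseteq> T" unfolding T_eq using that by blast
    then show "fst c \<in> T" using cone_nonempty by blast
    show "snd c \<subseteq> V" using D that unfolding cone_partition_def by blast
  qed
  have "\<forall>c\<in>set D. \<exists>x. x \<in> carrier M \<and> \<kappa> x = monomial (fst c)" using sub \<kappa>_surj by (simp add: Bex_def)
  from bchoice[OF this] obtain b where b: "\<And>c. c \<in> set D \<Longrightarrow> b c \<in> carrier M"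
    "\<And>c. c \<in> set D \<Longrightarrow> \<kappa> (b c) = monomial (fst c)" by blast
  define D' where "D' = map (\<lambda>c. (b c, snd c)) D"
  define W where "W i = {x \<in> carrier M. \<kappa> x \<in> supported (cone (D ! i))}" for i
  have "stanley_space M (fst (D' ! i)) (snd (D' ! i)) = W i" if "i < length D" for i
  proof -
    have "D ! i \<in> set D" using that by simp
    then show ?thesis
      using stanley_space_eq[of "fst (D ! i)" "snd (D ! i)" "b (D ! i)" 1] sub b that
      by (simp add: D'_def W_def monomial_def)
  qed
  then have space: "(\<Pi>\<^sub>E i \<in> {..<length D}. stanley_space M (fst (D' ! i)) (snd (D' ! i))) = (\<Pi>\<^sub>E i \<in> {..<length D}. W i)"
    by (intro PiE_cong) simp
  have "stanley_decomposition V M D'"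
    unfolding stanley_decomposition_def
  proof (intro conjI ballI)
    fix d assume "d \<in> set D'"
    then obtain c where c: "c \<in> set D" "d = (b c, snd c)" by (auto simp: D'_def)
    have "\<kappa> (b c) \<in> homogeneous (Poly_Mapping.map int (fst c))"
      using b(2)[OF c(1)] by (simp add: homogeneous_def)
    then have "\<exists>a. b c \<in> component M a" using componentM b(1)[OF c(1)] by blast
    moreover have "inj_on (\<lambda>u. u \<odot>\<^bsub>M\<^esub> b c) (polys (snd c))"
    proof (rule inj_onI)
      fix u u' assume u: "u \<in> polys (snd c)" "u' \<in> polys (snd c)" "u \<odot>\<^bsub>M\<^esub> b c = u' \<odot>\<^bsub>M\<^esub> b c"
      have m: "\<kappa> (b c) = single (fst c) 1" using b(2)[OF c(1)] by (simp add: monomial_def)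
      have co: "cone (fst c, snd c) \<subseteq> T" using sub(1)[OF c(1)] by simp
      have "u * single (fst c) 1 = u' * single (fst c) 1"
        using \<kappa>_smult_cone(1)[OF co sub(3)[OF c(1)] b(1)[OF c(1)] m] u by metis
      moreover have "single (fst c) 1 \<noteq> (0 :: 'k mpoly)" by (metis keys_single keys_zero insert_not_empty one_neq_zero)
      ultimately show "u = u'" by simp
    qed
    ultimately show "case d of (m, Z) \<Rightarrow> m \<in> carrier M \<and> (\<exists>a. m \<in> component M a) \<and> Z \<subseteq> V \<and>
        inj_on (\<lambda>u. u \<odot>\<^bsub>M\<^esub> m) (polys Z)"
      using c b sub by simp
  next
    fix x assume x: "x \<in> carrier M"
    have "restr (cone (D ! i)) (\<kappa> x) \<in> supported T" if "i < length D" for i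
      using restr_supported supported_mono[OF sub(1)] that nth_mem by blast
    then have "\<exists>y\<in>carrier M. \<kappa> y = restr (cone (D ! i)) (\<kappa> x)" if "i < length D" for i
      using \<kappa>_surj that by blast
    then obtain y where y: "\<And>i. i < length D \<Longrightarrow> y i \<in> carrier M"
      "\<And>i. i < length D \<Longrightarrow> \<kappa> (y i) = restr (cone (D ! i)) (\<kappa> x)" by metis
    have Wcar: "w \<in> {..<length D} \<rightarrow> carrier M" if "w \<in> (\<Pi>\<^sub>E i \<in> {..<length D}. W i)" for w
      using that by (auto simp: W_def)
    have disj: "cone (D ! i) \<inter> cone (D ! j) = {}" if "i < length D" "j < length D" "i \<noteq> j" for i j
      using D that unfolding cone_partition_def by blast
    show "\<exists>!w. w \<in> (\<Pi>\<^sub>E i \<in> {..<length D'}. stanley_space M (fst (D' ! i)) (snd (D' ! i))) \<and>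
        x = (\<Oplus>\<^bsub>M\<^esub> i \<in> {..<length D'}. w i)"
      unfolding D'_def length_map unfolding D'_def[symmetric] space
    proof (rule ex1I[of _ "restrict y {..<length D}"], intro conjI)
      show yP: "restrict y {..<length D} \<in> (\<Pi>\<^sub>E i \<in> {..<length D}. W i)"
        using y by (auto simp: W_def restr_supported)
      have "\<kappa> x = (\<Sum>i<length D. restr (cone (D ! i)) (\<kappa> x))"
      proof (rule poly_mapping_eqI)
        fix s
        show "lookup (\<kappa> x) s = lookup (\<Sum>i<length D. restr (cone (D ! i)) (\<kappa> x)) s"
        proof (cases "s \<in> T")
          case True
          then obtain c where "c \<in> set D" "s \<in> cone c" using D unfolding cone_partition_def by blast
          then obtain j where j: "j < length D" "s \<in> cone (D ! j)" by (metis in_set_conv_nth)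
          have "(\<Sum>i<length D. lookup (restr (cone (D ! i)) (\<kappa> x)) s) = (\<Sum>i<length D. if i = j then lookup (\<kappa> x) s else 0)"
            using j disj by (intro sum.cong refl) (auto simp: lookup_restr)
          then show ?thesis using j by (simp add: lookup_sum)
        next
          case False
          then have "lookup (\<kappa> x) s = 0" using \<kappa>_supported[OF x] by (auto simp: supported_def in_keys_iff subset_iff)
          then show ?thesis by (simp add: lookup_sum lookup_restr sum.neutral)
        qed
      qed
      also have "\<dots> = \<kappa> (\<Oplus>\<^bsub>M\<^esub> i \<in> {..<length D}. restrict y {..<length D} i)"
        using \<kappa>_finsum[OF _ Wcar[OF yP]] y by simp
      finally show "x = (\<Oplus>\<^bsub>M\<^esub> i \<in> {..<length D}. restrict y {..<length D} i)"
        using \<kappa>_eq_iff[OF x] \<kappa>_finsum[OF finite_lessThan Wcar[OF yP]] by blast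
    next
      fix w assume w: "w \<in> (\<Pi>\<^sub>E i \<in> {..<length D}. W i) \<and> x = (\<Oplus>\<^bsub>M\<^esub> i \<in> {..<length D}. w i)"
      have xs: "\<kappa> x = (\<Sum>i<length D. \<kappa> (w i))" using \<kappa>_finsum[OF _ Wcar] w by simp
      have "w j = restrict y {..<length D} j" for j
      proof (cases "j < length D")
        case True
        have wi: "keys (\<kappa> (w i)) \<subseteq> cone (D ! i)" if "i < length D" for i
          using w that by (auto simp: W_def PiE_iff supported_def)
        have "lookup (\<kappa> (w j)) s = lookup (restr (cone (D ! j)) (\<kappa> x)) s" for s
        proof (cases "s \<in> cone (D ! j)")
          case s: True
          have "(\<Sum>i<length D. lookup (\<kappa> (w i)) s) = (\<Sum>i<length D. if i = j then lookup (\<kappa> (w j)) s else 0)"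
          proof (intro sum.cong refl)
            fix i assume i: "i \<in> {..<length D}"
            show "lookup (\<kappa> (w i)) s = (if i = j then lookup (\<kappa> (w j)) s else 0)"
            proof (cases "i = j")
              case False
              then have "s \<notin> cone (D ! i)" using s disj[OF True, of i] i by auto
              then have "s \<notin> keys (\<kappa> (w i))" using wi[of i] i by blast
              then show ?thesis using False by (simp add: in_keys_iff)
            qed simp
          qed
          then show ?thesis using s True xs by (simp add: lookup_sum lookup_restr)
        next
          case False
          then show ?thesis using wi[OF True] by (auto simp: lookup_restr in_keys_iff subset_iff)
        qed
        then have "\<kappa> (w j) = \<kappa> (y j)" unfolding y(2)[OF True] by (rule poly_mapping_eqI)
        moreover have "w j \<in> carrier M" using w True by (auto simp: W_def PiE_iff)
        ultimately show ?thesis using \<kappa>_eq_iff y(1)[OF True] True by simp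
      next
        case False
        then show ?thesis using w by (simp add: PiE_iff extensional_def)
      qed
      then show "w = restrict y {..<length D}" by blast
    qed
  qed
  moreover have "map snd D' = map snd D" by (simp add: D'_def)
  ultimately show ?thesis by blast
qed

theorem sdepth_eq_cone_depth: "sdepth V M = cone_depth V T"
proof -
  have INF: "(INF (m, Z) \<in> set D. enat (card Z)) = (INF Z \<in> set (map snd D). enat (card Z))"
    for D :: "('c \<times> nat set) list" by (simp add: case_prod_beta image_image)
  have "{(INF (m, Z) \<in> set D. enat (card Z)) | D. stanley_decomposition V M D} =
     {(INF Z \<in> set (map snd D). enat (card Z)) | D. stanley_decomposition V M D}"
    by (simp add: INF)
  also have "\<dots> = {(INF Z \<in> set (map snd D). enat (card Z)) | D. cone_partition V T D}"
    (is "?A = ?B")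
  proof
    show "?A \<subseteq> ?B"
    proof
      fix x assume "x \<in> ?A"
      then obtain D where "x = (INF Z \<in> set (map snd D). enat (card Z))" "stanley_decomposition V M D" by blast
      moreover from this obtain D' where "cone_partition V T D'" "map snd D' = map snd D"
        using stanley_imp_cones by blast
      ultimately show "x \<in> ?B" by (intro CollectI exI[of _ D']) simp
    qed
    show "?B \<subseteq> ?A"
    proof
      fix x assume "x \<in> ?B"
      then obtain D where "x = (INF Z \<in> set (map snd D). enat (card Z))" "cone_partition V T D" by blast
      moreover from this obtain D' where "stanley_decomposition V M D'" "map snd D' = map snd D"
        using cones_imp_stanley by blast
      ultimately show "x \<in> ?A" by (intro CollectI exI[of _ D']) simp
    qed
  qed
  finally show ?thesis unfolding sdepth_def cone_depth_def by simp
qed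

end

lemma sdepth_ideal_module:
  assumes E: "upset V E"
  shows "sdepth V (ideal_module (supported E :: 'k::field mpoly set)) = cone_depth V E"
proof -
  have "monomial_module V E (ideal_module (supported E :: 'k mpoly set)) id"
  proof
    show "E \<subseteq> exps V" using E by (simp add: upset_def)
  qed (auto simp: ideal_module_def bij_betw_def supported_add upset_mult[OF E] restr_id[symmetric])
  then show ?thesis by (rule monomial_module.sdepth_eq_cone_depth)
qed

lemma coset_ideal_module: "N +>\<^bsub>ideal_module U\<^esub> x = {n + x | n. n \<in> N}"
  by (auto simp: a_r_coset_def' ideal_module_def)

text \<open>Arithmetic of cosets in terms of representatives, shared by the computations of Stanley
  depth and of depth.\<close>

locale ideal_quotient =
  fixes V :: "nat set" and U N :: "'k::field mpoly set"
  assumes U: "is_ideal (polys V) U" and N: "is_ideal (polys V) N"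
begin

abbreviation "M \<equiv> quotient_module (ideal_module U) N"

definition cs :: "'k mpoly \<Rightarrow> 'k mpoly set" where "cs x = {n + x | n. n \<in> N}"

lemma self_in_cs: "x \<in> cs x"
  unfolding cs_def using is_idealD(2)[OF N] by force

lemma cs_eq_iff: "cs x = cs y \<longleftrightarrow> x - y \<in> N"
proof
  assume "cs x = cs y"
  then show "x - y \<in> N" using self_in_cs[of x] by (auto simp: cs_def)
next
  assume d: "x - y \<in> N"
  have "n + x = (n + (x - y)) + y" "n + y = (n - (x - y)) + x" for n by simp_all
  then show "cs x = cs y"
    unfolding cs_def using d is_idealD(3)[OF N] carrier_subring.ideal_diff[OF carrier_subring_polys N] by blast
qed

lemma carrier_M: "carrier M = cs ` U"
  by (auto simp: quotient_module_def A_RCOSETS_def' coset_ideal_module cs_def a_r_coset_def' ideal_module_def)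

lemma zero_M: "\<zero>\<^bsub>M\<^esub> = cs 0"
  by (simp add: quotient_module_def cs_def)

lemma component_M: "component M a = cs ` (U \<inter> homogeneous a)"
  by (simp add: quotient_module_def coset_ideal_module cs_def) (simp add: ideal_module_def)

lemma add_M: "cs x \<oplus>\<^bsub>M\<^esub> cs y = cs (x + y)"
proof -
  have "cs x \<oplus>\<^bsub>M\<^esub> cs y = {a + b | a b. a \<in> cs x \<and> b \<in> cs y}"
    by (auto simp: quotient_module_def set_add_defs ideal_module_def)
  also have "\<dots> = cs (x + y)"
  proof (intro Set.set_eqI iffI)
    fix z assume "z \<in> {a + b | a b. a \<in> cs x \<and> b \<in> cs y}"
    then obtain n n' where "z = (n + x) + (n' + y)" "n \<in> N" "n' \<in> N" by (auto simp: cs_def)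
    moreover from this have "z = (n + n') + (x + y)" by (simp add: algebra_simps)
    ultimately show "z \<in> cs (x + y)" unfolding cs_def using is_idealD(3)[OF N] by blast
  next
    fix z assume "z \<in> cs (x + y)"
    then obtain n where "z = (n + x) + (0 + y)" "n \<in> N" by (auto simp: cs_def add.assoc)
    then show "z \<in> {a + b | a b. a \<in> cs x \<and> b \<in> cs y}" unfolding cs_def using is_idealD(2)[OF N] by blast
  qed
  finally show ?thesis .
qed

lemma smult_M:
  assumes u: "u \<in> polys V"
  shows "u \<odot>\<^bsub>M\<^esub> cs x = cs (u * x)"
proof -
  have "u \<odot>\<^bsub>M\<^esub> cs x = (\<Union>z\<in>cs x. cs (u * z))"
    by (simp add: quotient_module_def coset_ideal_module cs_def) (simp add: ideal_module_def)
  also have "cs (u * z) = cs (u * x)" if "z \<in> cs x" for z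
  proof -
    have "z - x \<in> N" using that by (auto simp: cs_def)
    then have "u * (z - x) \<in> N" using is_idealD(4)[OF N u] by blast
    then show ?thesis unfolding cs_eq_iff by (simp add: right_diff_distrib)
  qed
  then have "(\<Union>z\<in>cs x. cs (u * z)) = (\<Union>z\<in>cs x. cs (u * x))" by simp
  also have "\<dots> = cs (u * x)" using self_in_cs[of x] by blast
  finally show ?thesis .
qed

end

lemma sdepth_quotient_module:
  assumes E: "upset V E" and F: "upset V F" and FE: "F \<subseteq> E"
  shows "sdepth V (quotient_module (ideal_module (supported E :: 'k::field mpoly set)) (supported F)) =
    cone_depth V (E - F)"
proof -
  let ?U = "supported E :: 'k mpoly set" and ?N = "supported F :: 'k mpoly set"
  interpret ideal_quotient V ?U ?N
    by unfold_locales (rule is_ideal_supported[OF E], rule is_ideal_supported[OF F])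
  \<comment> \<open>Truncation to \<open>E - F\<close> is constant on each coset, so the choice of
    the representative is immaterial.\<close>
  define \<kappa> where "\<kappa> X = restr (E - F) (SOME x. x \<in> X)" for X :: "'k mpoly set"
  have resN: "restr (E - F) n = 0" if "n \<in> ?N" for n
    using that by (auto simp: restr_eq_0_iff supported_def)
  have \<kappa>: "\<kappa> (cs x) = restr (E - F) x" for x
  proof -
    have "(SOME y. y \<in> cs x) \<in> cs x" using self_in_cs by (rule someI)
    then show ?thesis unfolding \<kappa>_def using resN by (auto simp: cs_def restr_add)
  qed
  have restr_inj: "x - y \<in> ?N" if "x \<in> ?U" "restr (E - F) x = restr (E - F) y" "y \<in> ?U" for x y
  proof -
    have "restr (E - F) (x - y) = 0" using that(2) by (simp add: restr_diff)
    moreover have "keys (x - y) \<subseteq> E" using supported_diff[OF that(1,3)] by (simp add: supported_def)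
    ultimately show ?thesis unfolding restr_eq_0_iff supported_def by blast
  qed
  have "monomial_module V (E - F) M \<kappa>"
  proof
    show "E - F \<subseteq> exps V" using E by (auto simp: upset_def)
    show "bij_betw \<kappa> (carrier M) (supported (E - F))"
      unfolding bij_betw_def
    proof
      show "inj_on \<kappa> (carrier M)"
      proof (rule inj_onI)
        fix X Y assume "X \<in> carrier M" "Y \<in> carrier M" and eq: "\<kappa> X = \<kappa> Y"
        then obtain x y where xy: "X = cs x" "x \<in> ?U" "Y = cs y" "y \<in> ?U" unfolding carrier_M by blast
        then show "X = Y" using restr_inj[of x y] eq by (simp add: \<kappa> cs_eq_iff)
      qed
      show "\<kappa> ` carrier M = supported (E - F)"
      proof
        show "\<kappa> ` carrier M \<subseteq> supported (E - F)" unfolding carrier_M using \<kappa> restr_supported by auto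
        show "supported (E - F) \<subseteq> \<kappa> ` carrier M"
        proof
          fix p :: "'k mpoly" assume p: "p \<in> supported (E - F)"
          then have "p \<in> ?U" "\<kappa> (cs p) = p" using \<kappa> restr_id[OF p] by (auto simp: supported_def)
          then show "p \<in> \<kappa> ` carrier M" unfolding carrier_M by (metis imageI)
        qed
      qed
    qed
    show "\<zero>\<^bsub>M\<^esub> \<in> carrier M" "\<kappa> \<zero>\<^bsub>M\<^esub> = 0"
      unfolding zero_M carrier_M \<kappa> by auto
    show "x \<oplus>\<^bsub>M\<^esub> y \<in> carrier M" "\<kappa> (x \<oplus>\<^bsub>M\<^esub> y) = \<kappa> x + \<kappa> y"
      if "x \<in> carrier M" "y \<in> carrier M" for x y
      using that unfolding carrier_M by (auto simp: add_M \<kappa> restr_add supported_add)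
    show "u \<odot>\<^bsub>M\<^esub> x \<in> carrier M" "\<kappa> (u \<odot>\<^bsub>M\<^esub> x) = restr (E - F) (u * \<kappa> x)"
      if u: "u \<in> polys V" and xM: "x \<in> carrier M" for u x
    proof -
      obtain y where y: "x = cs y" "y \<in> ?U" using xM unfolding carrier_M by blast
      show "u \<odot>\<^bsub>M\<^esub> x \<in> carrier M"
        unfolding y smult_M[OF u] carrier_M using upset_mult[OF E u y(2)] by blast
      have "keys (y - restr (E - F) y) \<subseteq> F"
        using y(2) by (auto simp: in_keys_iff lookup_minus lookup_restr supported_def split: if_splits)
      then have "u * (y - restr (E - F) y) \<in> ?N"
        by (intro upset_mult[OF F u]) (simp add: supported_def)
      from resN[OF this] show "\<kappa> (u \<odot>\<^bsub>M\<^esub> x) = restr (E - F) (u * \<kappa> x)"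
        unfolding y smult_M[OF u] \<kappa> by (simp add: restr_diff right_diff_distrib)
    qed
    show "x \<in> component M a \<longleftrightarrow> \<kappa> x \<in> homogeneous a" if xM: "x \<in> carrier M" for x a
    proof -
      obtain y where y: "x = cs y" "y \<in> ?U" using xM unfolding carrier_M by blast
      have hres: "restr (E - F) p \<in> homogeneous a" if "p \<in> homogeneous a" for p :: "'k mpoly"
        using that by (auto simp: homogeneous_def)
      show ?thesis
      proof
        assume "x \<in> component M a"
        then show "\<kappa> x \<in> homogeneous a" unfolding component_M using hres \<kappa> by auto
      next
        assume h: "\<kappa> x \<in> homogeneous a"
        have "restr (E - F) y \<in> ?U" by (auto simp: supported_def)
        moreover from this have "y - restr (E - F) y \<in> ?N"
          using y(2) by (intro restr_inj) (auto simp: restr_id[OF restr_supported])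
        ultimately show "x \<in> component M a"
          unfolding component_M y using h by (metis IntI \<kappa> cs_eq_iff imageI y(1))
      qed
    qed
  qed
  then show ?thesis by (rule monomial_module.sdepth_eq_cone_depth)
qed

section \<open>The exponents of the powers of the sum\<close>

definition part :: "nat set \<Rightarrow> expo \<Rightarrow> expo" where
  "part V t = Abs_poly_mapping (\<lambda>v. if v \<in> V then lookup t v else 0)"

lemma lookup_part: "lookup (part V t) v = (if v \<in> V then lookup t v else 0)"
proof -
  have "finite {v. (if v \<in> V then lookup t v else 0) \<noteq> 0}"
    by (rule finite_subset[OF _ finite_lookup[of t]]) auto
  then show ?thesis by (simp add: part_def)
qed

lemma part_exps: "part V t \<in> exps V"
  by (simp add: exps_iff lookup_part)

lemma part_add: "part V (t + u) = part V t + part V u"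
  by (rule poly_mapping_eqI) (simp add: lookup_part lookup_add)

lemma part_id: "t \<in> exps V \<Longrightarrow> part V t = t"
  by (rule poly_mapping_eqI) (auto simp: lookup_part exps_iff)

lemma part_disjoint: "t \<in> exps W \<Longrightarrow> V \<inter> W = {} \<Longrightarrow> part V t = 0"
  by (rule poly_mapping_eqI) (auto simp: lookup_part exps_iff)

lemma part_divs: "part V t divs t"
  by (simp add: divs_def lookup_part)

lemma part_add_part: "t \<in> exps (V \<union> W) \<Longrightarrow> V \<inter> W = {} \<Longrightarrow> part V t + part W t = t"
  by (rule poly_mapping_eqI) (auto simp: lookup_add lookup_part exps_iff)

text \<open>By \<open>le_gmult_iff\<close> this is the largest \<open>c\<close> such that the
  \<open>c\<close>-th power of the monomial \<open>g\<close> divides \<open>t\<close>. The minimum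
  has this meaning only for a nonempty support, hence the hypothesis
  \<open>keys g \<noteq> {}\<close> below.\<close>

definition gmult :: "expo \<Rightarrow> expo \<Rightarrow> nat" where
  "gmult g t = (MIN v \<in> keys g. lookup t v div lookup g v)"

lemma le_gmult_iff: "keys g \<noteq> {} \<Longrightarrow> c \<le> gmult g t \<longleftrightarrow> (\<forall>v. c * lookup g v \<le> lookup t v)"
proof -
  assume g: "keys g \<noteq> {}"
  have "c \<le> gmult g t \<longleftrightarrow> (\<forall>v\<in>keys g. c \<le> lookup t v div lookup g v)"
    unfolding gmult_def using g by simp
  also have "\<dots> \<longleftrightarrow> (\<forall>v\<in>keys g. c * lookup g v \<le> lookup t v)"
    by (intro ball_cong refl) (simp add: in_keys_iff less_eq_div_iff_mult_less_eq)
  also have "\<dots> \<longleftrightarrow> (\<forall>v. c * lookup g v \<le> lookup t v)"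
    by (metis in_keys_iff mult_0_right zero_le)
  finally show ?thesis .
qed

lemma nat_eqI_le: "(\<And>c. c \<le> a \<longleftrightarrow> c \<le> (b :: nat)) \<Longrightarrow> a = b"
  by (metis le_antisym order_refl)

lemma gmult_self_add: "keys g \<noteq> {} \<Longrightarrow> gmult g (t + g) = Suc (gmult g t)"
proof (rule nat_eqI_le)
  fix c assume g: "keys g \<noteq> {}"
  show "c \<le> gmult g (t + g) \<longleftrightarrow> c \<le> Suc (gmult g t)"
  proof (cases c)
    case (Suc d)
    have "c \<le> gmult g (t + g) \<longleftrightarrow> (\<forall>v. d * lookup g v \<le> lookup t v)"
      unfolding le_gmult_iff[OF g] Suc by (simp add: lookup_add)
    then show ?thesis unfolding le_gmult_iff[OF g, symmetric] Suc by simp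
  qed simp
qed

lemma gmult_cong: "(\<And>v. v \<in> keys g \<Longrightarrow> lookup t v = lookup u v) \<Longrightarrow> gmult g t = gmult g u"
  unfolding gmult_def by (intro arg_cong[of _ _ Min] image_cong refl) simp

lemma gmult_superadd: "keys g \<noteq> {} \<Longrightarrow> gmult g t + gmult g u \<le> gmult g (t + u)"
  using le_gmult_iff[of g "gmult g t" t] le_gmult_iff[of g "gmult g u" u]
  by (auto simp: le_gmult_iff lookup_add distrib_right intro: add_mono)

definition scale :: "nat \<Rightarrow> expo \<Rightarrow> expo" where
  "scale c g = Poly_Mapping.map ((*) c) g"

lemma lookup_scale: "lookup (scale c g) v = c * lookup g v"
  by (simp add: scale_def Poly_Mapping.map.rep_eq when_def)

lemma scale_exps: "g \<in> exps V \<Longrightarrow> scale c g \<in> exps V"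
  by (simp add: exps_iff lookup_scale)

section \<open>Cones of exponents with prescribed multiplicities\<close>

lemma cones_ge_lookup_less: "cones_ge {v} {w \<in> exps {v}. lookup w v < m} 0"
proof -
  have "{w \<in> exps {v}. lookup w v < m} = (\<Union>c\<in>{..<m}. {single v c})"
  proof (intro Set.set_eqI iffI)
    fix w assume w: "w \<in> {w \<in> exps {v}. lookup w v < m}"
    then have "w = single v (lookup w v)"
      by (intro poly_mapping_eqI) (auto simp: lookup_single when_def exps_iff)
    then show "w \<in> (\<Union>c\<in>{..<m}. {single v c})" using w by auto
  qed auto
  moreover have "cones_ge {v} (\<Union>c\<in>{..<m}. {single v c}) 0"
  proof (rule cones_ge_UN)
    fix c
    have "cones_ge {v} ((+) (single v c) ` exps {}) 0"
      by (rule cones_ge_translate, rule cones_ge_mono[of "{}" _ 0]) (use cones_ge_exps[of "{}"] in auto)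
    moreover have "exps {} = {0}" by (auto simp: exps_def poly_mapping_eq_iff fun_eq_iff in_keys_iff)
    ultimately show "cones_ge {v} {single v c} 0" by simp
  qed (auto dest: arg_cong[of "single v _" _ "\<lambda>t. lookup t v"])
  ultimately show ?thesis by simp
qed

text \<open>The exponents on \<open>K\<close> that do not dominate \<open>g\<close> are split by the
  exponent of one variable \<open>v\<close>. If it is below that of \<open>g\<close>, the other
  variables are free; otherwise a ray in \<open>v\<close> is combined with the same problem for the
  remaining variables. Either way only one dimension is lost.\<close>

lemma cones_ge_not_divs:
  assumes "finite K" "K \<noteq> {}"
  shows "cones_ge K {w \<in> exps K. \<exists>v\<in>K. lookup w v < lookup g v} (card K - 1)"
  using assms
proof (induction K rule: finite_ne_induct)
  case (singleton v)
  then show ?case using cones_ge_lookup_less[of v "lookup g v"] by simp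
next
  case (insert v F)
  let ?low = "{w \<in> exps {v}. lookup w v < lookup g v}" and ?high = "{w \<in> exps {v}. lookup g v \<le> lookup w v}"
  let ?F = "{w \<in> exps F. \<exists>u\<in>F. lookup w u < lookup g u}"
  have high: "?high = (+) (single v (lookup g v)) ` exps {v}"
  proof (intro Set.set_eqI iffI)
    fix w assume "w \<in> ?high"
    then have "w = single v (lookup g v) + (w - single v (lookup g v))" "w - single v (lookup g v) \<in> exps {v}"
      by (auto intro!: poly_mapping_eqI simp: lookup_add lookup_minus lookup_single when_def minus_exps)
    then show "w \<in> (+) (single v (lookup g v)) ` exps {v}" by blast
  qed (auto simp: lookup_add)
  have hi: "cones_ge {v} ?high 1" unfolding high using cones_ge_translate[OF cones_ge_exps[of "{v}"]] by simp
  have F: "card F - 1 + 1 = card F" "card (insert v F) - 1 = card F"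
    using insert.hyps by (auto simp: Suc_leI card_gt_0_iff)
  have d: "{v} \<inter> F = {}" using insert.hyps by blast
  have "cones_ge ({v} \<union> F) (sumset ?low (exps F)) (0 + card F)"
    by (rule cones_ge_sumset[OF d _ _ cones_ge_lookup_less cones_ge_exps]) (use insert.hyps in auto)
  moreover have "cones_ge ({v} \<union> F) (sumset ?high ?F) (1 + (card F - 1))"
    by (rule cones_ge_sumset[OF d _ _ hi insert.IH]) (use insert.hyps in auto)
  moreover
  have lk: "lookup (a + b) v = lookup a v" "u \<in> F \<Longrightarrow> lookup (a + b) u = lookup b u"
    if "a \<in> exps {v}" "b \<in> exps F" for a b u
    using that d by (auto simp: lookup_add exps_iff)
  have "sumset ?low (exps F) \<inter> sumset ?high ?F = {}"
  proof -
    have "lookup w v < lookup g v" if "w \<in> sumset ?low (exps F)" for w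
      using that lk(1) by (auto simp: sumset_def)
    moreover have "lookup g v \<le> lookup w v" if "w \<in> sumset ?high ?F" for w
      using that lk(1) by (auto simp: sumset_def)
    ultimately show ?thesis by (meson disjoint_iff not_less)
  qed
  ultimately have "cones_ge ({v} \<union> F) (sumset ?low (exps F) \<union> sumset ?high ?F) (card F)"
    using F(1) by (intro cones_ge_Un) auto
  moreover have "sumset ?low (exps F) \<union> sumset ?high ?F =
      {w \<in> exps (insert v F). \<exists>u\<in>insert v F. lookup w u < lookup g u}" (is "?A = ?B")
  proof
    have "exps (insert v F) = sumset (exps {v}) (exps F)" using exps_Un[OF d] by simp
    then show "?A \<subseteq> ?B" using lk by (fastforce simp: sumset_def)
    show "?B \<subseteq> ?A"
    proof
      fix w assume w: "w \<in> ?B"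
      then obtain a b where ab: "w = a + b" "a \<in> exps {v}" "b \<in> exps F"
        using exps_Un[OF d] by (auto simp: sumset_def)
      show "w \<in> ?A"
      proof (cases "lookup a v < lookup g v")
        case True then show ?thesis using ab by (auto simp: sumset_def)
      next
        case False
        then have "\<exists>u\<in>F. lookup b u < lookup g u" using w lk[OF ab(2,3)] by (auto simp: ab(1))
        then have "a \<in> ?high" "b \<in> ?F" using ab False by auto
        then show ?thesis unfolding ab(1) sumset_def by blast
      qed
    qed
  qed
  ultimately show ?case using F(2) by simp
qed

text \<open>Division by the \<open>a\<close>-th power of \<open>g\<close> reduces multiplicity
  \<open>a\<close> to multiplicity 0, which means that \<open>g\<close> does not divide.\<close>

lemma cones_ge_gmult:
  assumes "keys g \<noteq> {}"
  shows "cones_ge (keys g) {w \<in> exps (keys g). gmult g w = a} (card (keys g) - 1)"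
proof -
  have ndiv: "(\<exists>v\<in>keys g. lookup w v < lookup g v) \<longleftrightarrow> gmult g w = 0" for w
  proof -
    have "(\<forall>v. lookup g v \<le> lookup w v) \<longleftrightarrow> (\<forall>v\<in>keys g. lookup g v \<le> lookup w v)"
      by (metis in_keys_iff zero_le)
    then show ?thesis using le_gmult_iff[OF assms, of 1 w] by (auto simp: not_less not_le)
  qed
  have sc: "gmult g (scale a g + w) = a + gmult g w" for w
  proof (induction a)
    case 0
    have "scale 0 g = 0" by (rule poly_mapping_eqI) (simp add: lookup_scale)
    then show ?case by simp
  next
    case (Suc a)
    have "scale (Suc a) g + w = (scale a g + w) + g"
      by (rule poly_mapping_eqI) (simp add: lookup_scale lookup_add)
    then show ?case using gmult_self_add[OF assms] Suc by simp
  qed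
  have "{w \<in> exps (keys g). gmult g w = a} = (+) (scale a g) ` {w \<in> exps (keys g). gmult g w = 0}"
  proof (intro Set.set_eqI iffI)
    fix w assume w: "w \<in> {w \<in> exps (keys g). gmult g w = a}"
    then have "scale a g divs w" using le_gmult_iff[OF assms, of a w] by (simp add: divs_def lookup_scale)
    then have "w = scale a g + (w - scale a g)" by (simp add: divs_minus)
    moreover from this have "gmult g (w - scale a g) = 0" using sc[of "w - scale a g"] w by simp
    ultimately show "w \<in> (+) (scale a g) ` {w \<in> exps (keys g). gmult g w = 0}"
      using w minus_exps[of w "keys g"] by (intro image_eqI[of _ _ "w - scale a g"]) simp_all
  next
    fix w assume "w \<in> (+) (scale a g) ` {w \<in> exps (keys g). gmult g w = 0}"
    moreover have "scale a g \<in> exps (keys g)" by (rule scale_exps) (simp add: exps_def)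
    ultimately show "w \<in> {w \<in> exps (keys g). gmult g w = a}" by (auto simp: sc)
  qed
  then show ?thesis
    using cones_ge_translate[OF cones_ge_not_divs[OF _ assms, of g], of "scale a g"] ndiv by simp
qed

text \<open>Each support contributes a variable outside \<open>Z\<close>, and these variables are
  distinct. The lemma bounds both the free variables of a cone outside \<open>(I + J)^n\<close> and
  the variables that avoid a prime containing \<open>J\<close>.\<close>

lemma card_ge_disjoint_supports:
  assumes "finite Y" and f: "\<And>j. j < k \<Longrightarrow> keys (f j) \<noteq> {} \<and> keys (f j) \<subseteq> Y"
    and disj: "\<And>i j. i < k \<Longrightarrow> j < k \<Longrightarrow> i \<noteq> j \<Longrightarrow> keys (f i) \<inter> keys (f j) = {}"
    and Z: "\<And>j. j < k \<Longrightarrow> \<not> keys (f j) \<subseteq> Z"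
  shows "card (Y \<inter> Z) + k \<le> card Y"
proof -
  have "\<forall>j\<in>{..<k}. \<exists>v. v \<in> keys (f j) \<and> v \<notin> Z" using Z by blast
  from bchoice[OF this] obtain v where v: "\<And>j. j < k \<Longrightarrow> v j \<in> keys (f j) \<and> v j \<notin> Z" by auto
  have "inj_on v {..<k}"
  proof (rule inj_onI)
    fix i j assume "i \<in> {..<k}" "j \<in> {..<k}" "v i = v j"
    then show "i = j" using v[of i] v[of j] disj[of i j] by (metis disjoint_iff lessThan_iff)
  qed
  then have "k = card (v ` {..<k})" by (simp add: card_image)
  moreover have "v ` {..<k} \<subseteq> Y - Z" using v f by (auto simp: subset_iff)
  ultimately have "k \<le> card (Y - Z)" using assms(1) by (metis card_mono finite_Diff)
  moreover have "card Y = card (Y \<inter> Z) + card (Y - Z)" using assms(1) by (metis card_Int_Diff)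
  ultimately show ?thesis by simp
qed

text \<open>Induction on the number of monomials: exponents are sorted by the multiplicity
  \<open>a\<close> of the last monomial, whose support is split off. Each support costs one
  dimension.\<close>

lemma cones_ge_ord:
  assumes "finite Y" and "\<And>j. j < k \<Longrightarrow> keys (f j) \<noteq> {} \<and> keys (f j) \<subseteq> Y"
    and "\<And>i j. i < k \<Longrightarrow> j < k \<Longrightarrow> i \<noteq> j \<Longrightarrow> keys (f i) \<inter> keys (f j) = {}"
  shows "cones_ge Y {t \<in> exps Y. (\<Sum>j<k. gmult (f j) t) = i} (card Y - k)"
  using assms
proof (induction k arbitrary: Y i)
  case 0
  then show ?case using cones_ge_exps[of Y] cones_ge_empty by (cases i) simp_all
next
  case (Suc k)
  define K where "K = keys (f k)"
  have KY: "K \<subseteq> Y" "K \<noteq> {}" "finite K" using Suc.prems(2)[of k] by (auto simp: K_def)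
  have d: "(Y - K) \<inter> K = {}" and Y: "(Y - K) \<union> K = Y" using KY by auto
  have fY: "keys (f j) \<noteq> {} \<and> keys (f j) \<subseteq> Y - K" if "j < k" for j
    using Suc.prems(2)[of j] Suc.prems(3)[of j k] that by (auto simp: K_def)
  have IH: "cones_ge (Y - K) {t \<in> exps (Y - K). (\<Sum>j<k. gmult (f j) t) = i} (card (Y - K) - k)" for i
    using Suc.prems(1,3) fY by (intro Suc.IH) auto
  \<comment> \<open>The case of empty \<open>Z\<close> gives \<open>k \<le> card (Y - K)\<close>, so
    that the truncated differences below add up correctly.\<close>
  have "card ((Y - K) \<inter> {}) + k \<le> card (Y - K)"
    using Suc.prems(1,3) fY by (intro card_ge_disjoint_supports[of _ _ f]) auto
  then have k: "k \<le> card (Y - K)" by simp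
  have card: "card Y = card (Y - K) + card K" "card K > 0"
    using KY Suc.prems(1) by (auto simp: card_Diff_subset card_mono card_gt_0_iff)
  define T where "T a = sumset {t \<in> exps (Y - K). (\<Sum>j<k. gmult (f j) t) = i - a} {w \<in> exps K. gmult (f k) w = a}" for a
  have lk: "(\<Sum>j<k. gmult (f j) (t + w)) = (\<Sum>j<k. gmult (f j) t)" "gmult (f k) (t + w) = gmult (f k) w"
    if "t \<in> exps (Y - K)" "w \<in> exps K" for t w
  proof -
    show "(\<Sum>j<k. gmult (f j) (t + w)) = (\<Sum>j<k. gmult (f j) t)"
      using fY that by (intro sum.cong refl gmult_cong) (auto simp: lookup_add exps_iff)
    show "gmult (f k) (t + w) = gmult (f k) w"
      using that by (intro gmult_cong) (auto simp: lookup_add exps_iff K_def)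
  qed
  have "cones_ge Y (\<Union>a\<in>{..i}. T a) (card Y - Suc k)"
  proof (rule cones_ge_UN)
    fix a
    have "cones_ge ((Y - K) \<union> K) (T a) ((card (Y - K) - k) + (card K - 1))"
      unfolding T_def using KY Suc.prems(1) cones_ge_gmult[of "f k" a]
      by (intro cones_ge_sumset[OF d] IH) (auto simp: K_def)
    then show "cones_ge Y (T a) (card Y - Suc k)" using Y k card by simp
  next
    fix a b :: nat assume "a \<noteq> b"
    moreover have "gmult (f k) t = a" if "t \<in> T a" for t a using that lk(2) by (auto simp: T_def sumset_def)
    ultimately show "T a \<inter> T b = {}" by (metis disjoint_iff)
  qed simp
  moreover have "(\<Union>a\<in>{..i}. T a) = {t \<in> exps Y. (\<Sum>j<Suc k. gmult (f j) t) = i}"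
  proof
    show "(\<Union>a\<in>{..i}. T a) \<subseteq> {t \<in> exps Y. (\<Sum>j<Suc k. gmult (f j) t) = i}"
    proof
      fix t assume "t \<in> (\<Union>a\<in>{..i}. T a)"
      then obtain a u w where "a \<le> i" "t = u + w" "u \<in> exps (Y - K)" "w \<in> exps K"
        "(\<Sum>j<k. gmult (f j) u) = i - a" "gmult (f k) w = a" by (auto simp: T_def sumset_def)
      moreover from this have "t \<in> exps Y" using exps_Un[OF d] Y by (auto simp: sumset_def)
      ultimately show "t \<in> {t \<in> exps Y. (\<Sum>j<Suc k. gmult (f j) t) = i}" using lk by simp
    qed
    show "{t \<in> exps Y. (\<Sum>j<Suc k. gmult (f j) t) = i} \<subseteq> (\<Union>a\<in>{..i}. T a)"
    proof
      fix t assume t: "t \<in> {t \<in> exps Y. (\<Sum>j<Suc k. gmult (f j) t) = i}"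
      then obtain u w where uw: "t = u + w" "u \<in> exps (Y - K)" "w \<in> exps K"
        using exps_Un[OF d] Y by (auto simp: sumset_def)
      then have "(\<Sum>j<k. gmult (f j) u) + gmult (f k) w = i" using t lk[OF uw(2,3)] by simp
      then have le: "gmult (f k) w \<le> i" and "(\<Sum>j<k. gmult (f j) u) = i - gmult (f k) w" by linarith+
      then have "t \<in> T (gmult (f k) w)" unfolding T_def sumset_def using uw by blast
      then show "t \<in> (\<Union>a\<in>{..i}. T a)" using le by blast
    qed
  qed
  ultimately show ?case by simp
qed

text \<open>Here \<open>P i\<close> is the exponent set of the \<open>i\<close>-th power of
  \<open>I\<close>, and the \<open>f j\<close> are the generators of \<open>J\<close>. The set
  \<open>Y\<close> and the monomials are parameters because the depth computation replaces them
  whenever two variables are identified.\<close>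

locale mixed_powers =
  fixes X Y :: "nat set" and P :: "nat \<Rightarrow> expo set" and k :: nat and f :: "nat \<Rightarrow> expo"
  assumes fin: "finite X" "finite Y" and disj: "X \<inter> Y = {}"
    and P0: "P 0 = exps X" and P1: "upset X (P 1)" "0 \<notin> P 1" and PSuc: "P (Suc i) = sumset (P i) (P 1)"
    and k: "k \<ge> 1"
    and f: "j < k \<Longrightarrow> keys (f j) \<noteq> {}" "j < k \<Longrightarrow> keys (f j) \<subseteq> Y"
    and fdisj: "i < k \<Longrightarrow> j < k \<Longrightarrow> i \<noteq> j \<Longrightarrow> keys (f i) \<inter> keys (f j) = {}"
begin

abbreviation "V \<equiv> X \<union> Y"

definition ord :: "expo \<Rightarrow> nat" where "ord t = (\<Sum>j<k. gmult (f j) t)"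

text \<open>Truncated subtraction includes the case \<open>ord t \<ge> n\<close>, where
  \<open>P 0\<close> imposes no condition.\<close>

definition E :: "nat \<Rightarrow> expo set" where
  "E n = {t \<in> exps V. part X t \<in> P (n - ord t)}"

lemma upset_P: "upset X (P i)"
  by (induction i) (auto simp only: P0 PSuc intro: upset_exps upset_sumset P1(1))

lemma P_Suc_subset: "P (Suc i) \<subseteq> P i"
  using upset_P[of i] upsetD[OF P1(1)] unfolding PSuc sumset_def upset_def by blast

lemma P_antimono: "i \<le> j \<Longrightarrow> P j \<subseteq> P i"
  using lift_Suc_antimono_le[of P, OF P_Suc_subset] by blast

lemma zero_notin_P: "i \<ge> 1 \<Longrightarrow> 0 \<notin> P i"
  using P_antimono[of 1 i] P1(2) by blast

lemma P_add: "t \<in> P i \<Longrightarrow> u \<in> exps X \<Longrightarrow> t + u \<in> P i"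
  using upset_P[of i] by (simp add: upset_def)

lemma part_X_f: "j < k \<Longrightarrow> part X (f j) = 0"
  using part_disjoint[of "f j" Y X] f(2) disj by (auto simp: exps_def)

lemma ord_add_f: "j < k \<Longrightarrow> ord (t + f j) = Suc (ord t)"
proof -
  assume j: "j < k"
  have "gmult (f i) (t + f j) = (if i = j then Suc (gmult (f i) t) else gmult (f i) t)" if "i < k" for i
  proof (cases "i = j")
    case True then show ?thesis using gmult_self_add f(1) j by simp
  next
    case False
    have "lookup (f j) v = 0" if "v \<in> keys (f i)" for v
      using fdisj[OF \<open>i < k\<close> j False] that by (auto simp: in_keys_iff)
    then show ?thesis using False gmult_cong[of "f i" "t + f j" t] by (simp add: lookup_add)
  qed
  then have "ord (t + f j) = (\<Sum>i<k. gmult (f i) t + (if i = j then 1 else 0))"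
    unfolding ord_def by (intro sum.cong refl) auto
  then show ?thesis using j by (simp add: ord_def sum.distrib)
qed

lemma ord_nonzero: "ord t \<noteq> 0 \<Longrightarrow> \<exists>j<k. f j divs t"
proof -
  assume "ord t \<noteq> 0"
  then obtain j where j: "j < k" "gmult (f j) t \<noteq> 0" unfolding ord_def by auto
  then have "1 \<le> gmult (f j) t" by simp
  then show ?thesis unfolding le_gmult_iff[OF f(1)[OF j(1)]] using j(1) by (auto simp: divs_def)
qed

lemma ord_superadd: "ord t + ord u \<le> ord (t + u)"
  unfolding ord_def sum.distrib[symmetric] by (intro sum_mono gmult_superadd f) simp

lemma ord_cong: "(\<And>v. v \<in> Y \<Longrightarrow> lookup t v = lookup u v) \<Longrightarrow> ord t = ord u"
  unfolding ord_def using f(2) by (intro sum.cong refl gmult_cong) auto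

lemma ord_add_X: "u \<in> exps X \<Longrightarrow> ord (u + t) = ord t"
  using disj by (intro ord_cong) (auto simp: lookup_add exps_iff)

text \<open>Multiplication by \<open>f j\<close> raises the order by exactly one and leaves the part
  in \<open>X\<close> alone; in terms of ideals this computes the colon by
  \<open>f j\<close>.\<close>

lemma E_add_f: "j < k \<Longrightarrow> t + f j \<in> E (Suc n) \<longleftrightarrow> t \<in> E n"
  using f(2)[of j] exps_mono[of Y V] by (auto simp: E_def ord_add_f part_add part_X_f exps_def)

lemma upset_E: "upset V (E n)"
  unfolding upset_def
proof (intro conjI ballI)
  fix t u assume t: "t \<in> E n" and u: "u \<in> exps V"
  have "ord t \<le> ord (t + u)" using ord_superadd[of t u] by simp
  then have "P (n - ord t) \<subseteq> P (n - ord (t + u))" by (intro P_antimono) simp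
  moreover have "part X t + part X u \<in> P (n - ord t)"
    using t part_exps by (intro P_add) (simp_all add: E_def)
  ultimately show "t + u \<in> E n" using t u by (auto simp: E_def part_add)
qed (auto simp: E_def)

lemma E_0: "E 0 = exps V"
  using P0 part_exps by (auto simp: E_def)

lemma E_1: "E 1 = upset_gen V (P 1 \<union> f ` {..<k})"
proof (intro Set.set_eqI iffI)
  fix t assume t: "t \<in> E 1"
  show "t \<in> upset_gen V (P 1 \<union> f ` {..<k})"
  proof (cases "ord t = 0")
    case True
    then have "part X t \<in> P 1" using t by (simp add: E_def)
    then show ?thesis using t part_divs[of X t] by (auto simp: upset_gen_def E_def)
  next
    case False
    then obtain j where j: "j < k" "f j divs t" using ord_nonzero by blast
    then show ?thesis using t by (auto simp: upset_gen_def E_def)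
  qed
next
  fix t assume "t \<in> upset_gen V (P 1 \<union> f ` {..<k})"
  then obtain g where g: "t \<in> exps V" "g divs t" "g \<in> P 1 \<or> g \<in> f ` {..<k}" by (auto simp: upset_gen_def)
  have "g \<in> E 1"
  proof (cases "g \<in> P 1")
    case True
    then have gX: "g \<in> exps X" using upsetD[OF P1(1)] by blast
    then have "part X g = g" "g \<in> exps V" using part_id exps_mono[of X V] by auto
    moreover have "P 1 \<subseteq> P (1 - ord g)" by (rule P_antimono) simp
    ultimately show ?thesis using True by (auto simp: E_def)
  next
    case False
    then obtain j where j: "j < k" "g = f j" using g by blast
    have "0 + f j \<in> E (Suc 0)" unfolding E_add_f[OF j(1)] E_0 by simp
    then show ?thesis using j by simp
  qed
  then show "t \<in> E 1" using upset_divs[OF upset_E] g by blast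
qed

text \<open>If some \<open>f j\<close> divides \<open>t\<close>, it is split off; otherwise
  \<open>ord t = 0\<close>, and the part in \<open>X\<close> is a sum of an element of
  \<open>P n\<close> and one of \<open>P 1\<close>. The other inclusion rests on superadditivity of
  \<open>ord\<close>.\<close>

lemma E_Suc: "E (Suc n) = sumset (E n) (E 1)"
proof (intro Set.set_eqI iffI)
  fix t assume t: "t \<in> E (Suc n)"
  show "t \<in> sumset (E n) (E 1)"
  proof (cases "ord t = 0")
    case True
    then have "part X t \<in> P (Suc n)" using t by (simp add: E_def)
    then have "part X t \<in> sumset (P n) (P 1)" by (simp only: PSuc)
    then obtain a b where ab: "part X t = a + b" "a \<in> P n" "b \<in> P 1" by (auto simp: sumset_def)
    have "part X t + part Y t = t" using t disj by (intro part_add_part) (auto simp: E_def)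
    then have eq: "t = (a + part Y t) + b" using ab by (simp add: ac_simps)
    have aX: "a \<in> exps X" "b \<in> exps X" using ab upsetD[OF upset_P] by blast+
    then have "b \<in> E 1"
      unfolding E_1 upset_gen_def using ab(3) exps_mono[of X V] divs_refl by blast
    moreover have "a + part Y t \<in> E n"
    proof -
      have "part X (a + part Y t) = a"
        using part_id[OF aX(1)] part_disjoint[OF part_exps disj] by (simp add: part_add)
      moreover have "a + part Y t \<in> exps V" using aX part_exps[of Y t] exps_mono[of X V] exps_mono[of Y V] by auto
      moreover have "P n \<subseteq> P (n - ord (a + part Y t))" by (rule P_antimono) simp
      ultimately show ?thesis using ab by (auto simp: E_def)
    qed
    ultimately show ?thesis using eq unfolding sumset_def by blast
  next
    case False
    then obtain j where j: "j < k" "f j divs t" using ord_nonzero by blast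
    then have eq: "t = (t - f j) + f j" by (simp add: divs_minus)
    moreover have "t - f j \<in> E n" using t eq E_add_f[OF j(1)] by metis
    moreover have "f j \<in> E 1" using E_add_f[OF j(1), of 0 0] E_0 by simp
    ultimately show ?thesis unfolding sumset_def by blast
  qed
next
  fix t assume "t \<in> sumset (E n) (E 1)"
  then obtain a b where ab: "t = a + b" "a \<in> E n" "b \<in> E 1" by (auto simp: sumset_def)
  \<comment> \<open>A positive order of \<open>b\<close> already pays for the additional factor; if
    the order is 0, membership in \<open>E 1\<close> supplies a factor in
    \<open>P 1\<close>.\<close>
  have le: "Suc n - ord t \<le> (if ord b = 0 then Suc (n - ord a) else n - ord a)"
    using ord_superadd[of a b] ab(1) by auto
  have "part X t \<in> P (if ord b = 0 then Suc (n - ord a) else n - ord a)"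
  proof (cases "ord b = 0")
    case True
    then have "part X a \<in> P (n - ord a)" "part X b \<in> P 1" using ab by (auto simp: E_def)
    then have "part X t \<in> P (Suc (n - ord a))" unfolding PSuc sumset_def ab(1) part_add by blast
    then show ?thesis using True by simp
  next
    case False
    have "part X a + part X b \<in> P (n - ord a)" using ab part_exps by (intro P_add) (auto simp: E_def)
    then show ?thesis using False ab(1) by (simp add: part_add)
  qed
  then have "part X t \<in> P (Suc n - ord t)" using P_antimono[OF le] by blast
  moreover have "t \<in> exps V" using ab by (auto simp: E_def)
  ultimately show "t \<in> E (Suc n)" by (simp add: E_def)
qed

lemma E_Suc_subset: "E (Suc n) \<subseteq> E n"
proof
  fix t assume "t \<in> E (Suc n)"
  moreover have "P (Suc n - ord t) \<subseteq> P (n - ord t)" by (rule P_antimono) simp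
  ultimately show "t \<in> E n" by (auto simp: E_def)
qed

lemma ord_0: "ord 0 = 0"
proof (rule ccontr)
  assume "ord 0 \<noteq> 0"
  then obtain j where "j < k" "f j divs 0" using ord_nonzero by blast
  moreover from this have "f j = 0" by (intro divs_antisym) simp_all
  ultimately show False using f(1) by auto
qed

lemma zero_notin_E: "n \<ge> 1 \<Longrightarrow> 0 \<notin> E n"
  using zero_notin_P[of n] part_id[of 0 X] ord_0 by (simp add: E_def)

section \<open>Stanley depth of the powers: bounds and monotonicity\<close>

lemma cones_ge_complement_E:
  assumes "\<And>i. i \<in> {1..n} \<Longrightarrow> cones_ge X (exps X - P i) p"
  shows "cones_ge V (exps V - E n) (p + (card Y - k))"
proof -
  \<comment> \<open>Orders \<open>i \<ge> n\<close> contribute nothing, since their exponents lie in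
    \<open>E n\<close>; for \<open>i < n\<close> the index \<open>n - i\<close> lies in the range of
    the assumption.\<close>
  define T where "T i = sumset (exps X - P (n - i)) {t \<in> exps Y. ord t = i}" for i
  have cY: "cones_ge Y {t \<in> exps Y. ord t = i} (card Y - k)" for i
    unfolding ord_def by (rule cones_ge_ord) (use fin f fdisj in auto)
  have "cones_ge V (\<Union>i\<in>{..<n}. T i) (p + (card Y - k))"
  proof (rule cones_ge_UN)
    show "cones_ge V (T i) (p + (card Y - k))" if "i \<in> {..<n}" for i
      unfolding T_def using that fin by (intro cones_ge_sumset[OF disj] cY assms) auto
    have "ord t = i" if "t \<in> T i" for t i using that ord_add_X by (auto simp: T_def sumset_def)
    then show "T i \<inter> T j = {}" if "i \<noteq> j" for i j using that by (metis disjoint_iff)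
  qed simp
  moreover have "(\<Union>i\<in>{..<n}. T i) = exps V - E n"
  proof (intro Set.set_eqI iffI)
    fix t assume "t \<in> (\<Union>i\<in>{..<n}. T i)"
    then obtain i a b where "i < n" "t = a + b" "a \<in> exps X" "a \<notin> P (n - i)" "b \<in> exps Y" "ord b = i"
      by (auto simp: T_def sumset_def)
    moreover from this have "part X t = a" "ord t = i" "t \<in> exps V"
      using part_id part_disjoint[OF _ disj] ord_add_X exps_mono[of X V] exps_mono[of Y V]
      by (auto simp: part_add)
    ultimately show "t \<in> exps V - E n" by (simp add: E_def)
  next
    fix t assume t: "t \<in> exps V - E n"
    have eq: "part X t + part Y t = t" using t disj by (intro part_add_part) auto
    have o: "ord (part Y t) = ord t" by (rule ord_cong) (simp add: lookup_part)
    have nP: "part X t \<notin> P (n - ord t)" using t by (auto simp: E_def)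
    have "ord t < n"
    proof (rule ccontr)
      assume "\<not> ord t < n"
      then have "part X t \<in> P (n - ord t)" using P0 part_exps by simp
      then show False using nP by simp
    qed
    moreover have "t \<in> T (ord t)"
      unfolding T_def sumset_def using eq[symmetric] nP part_exps o by blast
    ultimately show "t \<in> (\<Union>i\<in>{..<n}. T i)" by blast
  qed
  ultimately show ?thesis by simp
qed

lemma cones_ge_complement_E_bound:
  assumes "cones_ge V (exps V - E n) q" "n \<ge> 1"
  shows "q \<le> card X + (card Y - k)"
proof -
  obtain D where D: "cone_partition V (exps V - E n) D" "\<forall>c\<in>set D. q \<le> card (snd c)"
    using assms(1) unfolding cones_ge_def by blast
  \<comment> \<open>Here \<open>n \<ge> 1\<close> enters: the complement is nonempty, so there is a
    cone whose dimension can be bounded.\<close>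
  have "0 \<in> exps V - E n" using zero_notin_E[OF assms(2)] by simp
  then obtain c where c: "c \<in> set D" using D(1) unfolding cone_partition_def by auto
  have cT: "cone c \<subseteq> exps V - E n" and cV: "snd c \<subseteq> V" using D(1) c unfolding cone_partition_def by auto
  have "\<not> keys (f j) \<subseteq> snd c" if j: "j < k" for j
  proof
    assume sub: "keys (f j) \<subseteq> snd c"
    then have fe: "scale n (f j) \<in> exps (snd c)" by (intro scale_exps) (simp add: exps_def)
    \<comment> \<open>The \<open>i\<close>-th power of \<open>f j\<close> carries every exponent
      into \<open>E i\<close>; hence a cone in which all variables of \<open>f j\<close> are free
      would meet \<open>E n\<close>.\<close>
    have "t + scale i (f j) \<in> E i" if "t \<in> exps V" for t i
    proof (induction i)
      case 0
      have "scale 0 (f j) = 0" by (rule poly_mapping_eqI) (simp add: lookup_scale)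
      then show ?case using that E_0 by simp
    next
      case (Suc i)
      have "t + scale (Suc i) (f j) = (t + scale i (f j)) + f j"
        by (rule poly_mapping_eqI) (simp add: lookup_scale lookup_add)
      then show ?case using Suc E_add_f[OF j] by simp
    qed
    moreover have "fst c \<in> exps V" using cT cone_nonempty by blast
    ultimately have "fst c + scale n (f j) \<in> E n" by blast
    moreover have "fst c + scale n (f j) \<in> cone c" using fe by (auto simp: cone_def)
    ultimately show False using cT by blast
  qed
  then have "card (Y \<inter> snd c) + k \<le> card Y"
    using fin f fdisj by (intro card_ge_disjoint_supports[of Y k f]) auto
  moreover have "card (snd c) \<le> card X + card (Y \<inter> snd c)"
  proof -
    have "card (snd c) \<le> card (X \<union> (Y \<inter> snd c))" using cV fin by (intro card_mono) auto
    also have "\<dots> \<le> card X + card (Y \<inter> snd c)" by (rule card_Un_le)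
    finally show ?thesis .
  qed
  ultimately show ?thesis using D(2) c by fastforce
qed

lemma k_le_card_Y: "k \<le> card Y"
  using card_ge_disjoint_supports[of Y k f "{}"] fin f fdisj by auto

lemma cone_depth_complement_antimono: "cone_depth V (exps V - E (Suc n)) \<le> cone_depth V (exps V - E n)"
proof (rule cone_depth_mono)
  have "{t. t + f 0 \<in> exps V - E (Suc n)} = exps V - E n"
    using E_add_f[of 0] k f(2)[of 0] by (auto simp: exps_def)
  then show "cones_ge V (exps V - E (Suc n)) q \<Longrightarrow> cones_ge V (exps V - E n) q" for q
    using cones_ge_colon[of V "exps V - E (Suc n)" q "f 0"] by simp
qed

lemma cone_depth_E_antimono: "cone_depth V (E (Suc n)) \<le> cone_depth V (E n)"
proof (rule cone_depth_mono)
  have "{t. t + f 0 \<in> E (Suc n)} = E n" using E_add_f[of 0] k by auto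
  then show "cones_ge V (E (Suc n)) q \<Longrightarrow> cones_ge V (E n) q" for q
    using cones_ge_colon[of V "E (Suc n)" q "f 0"] by simp
qed

lemma cone_depth_quotient_antimono:
  "cone_depth V (E (Suc n) - E (Suc (Suc n))) \<le> cone_depth V (E n - E (Suc n))"
proof (rule cone_depth_mono)
  have "{t. t + f 0 \<in> E (Suc n) - E (Suc (Suc n))} = E n - E (Suc n)" using E_add_f[of 0] k by auto
  then show "cones_ge V (E (Suc n) - E (Suc (Suc n))) q \<Longrightarrow> cones_ge V (E n - E (Suc n)) q" for q
    using cones_ge_colon[of V "E (Suc n) - E (Suc (Suc n))" q "f 0"] by simp
qed

lemma cone_depth_complement_bounds:
  assumes "n \<ge> 1"
  shows "cone_depth V (exps V - E n) \<le> enat (card X + (card Y - k))"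
    "(MIN i \<in> {1..n}. cone_depth X (exps X - P i) + enat (card Y - k)) \<le> cone_depth V (exps V - E n)"
proof -
  have ex: "cones_ge X (exps X - P i) 0" for i using ex_cones_complement[OF fin(1) upset_P] .
  have ex': "cones_ge V (exps V - E n) 0" using ex_cones_complement[OF _ upset_E] fin by simp
  show "cone_depth V (exps V - E n) \<le> enat (card X + (card Y - k))"
    unfolding enat_le_iff_all[of "cone_depth _ _"]
    using le_cone_depth_imp_cones_ge[OF _ ex'] cones_ge_complement_E_bound[OF _ assms] by simp
  show "(MIN i \<in> {1..n}. cone_depth X (exps X - P i) + enat (card Y - k)) \<le> cone_depth V (exps V - E n)"
    unfolding enat_le_iff_all[of "Min _"]
  proof (intro allI impI)
    fix q assume q: "enat q \<le> (MIN i \<in> {1..n}. cone_depth X (exps X - P i) + enat (card Y - k))"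
    have "cones_ge X (exps X - P i) (q - (card Y - k))" if i: "i \<in> {1..n}" for i
    proof -
      have "enat q \<le> cone_depth X (exps X - P i) + enat (card Y - k)"
        using q i assms by (simp add: Min_ge_iff)
      then have "enat (q - (card Y - k)) \<le> cone_depth X (exps X - P i)"
        by (cases "cone_depth X (exps X - P i)") auto
      then show ?thesis using le_cone_depth_imp_cones_ge ex by blast
    qed
    \<comment> \<open>If \<open>q < card Y - k\<close>, the truncated difference is 0 and the cones
      obtained are larger than required; the next step lowers the bound to \<open>q\<close>.\<close>
    then have "cones_ge V (exps V - E n) (q - (card Y - k) + (card Y - k))" by (rule cones_ge_complement_E)
    then have "cones_ge V (exps V - E n) q" by (rule cones_ge_mono) auto
    then show "enat q \<le> cone_depth V (exps V - E n)" by (rule cones_ge_imp_le_cone_depth)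
  qed
qed

end

section \<open>Krull dimension\<close>

definition is_prime :: "nat set \<Rightarrow> 'k::field mpoly set \<Rightarrow> bool" where
  "is_prime V Q \<longleftrightarrow> is_ideal (polys V) Q \<and> 1 \<notin> Q \<and>
     (\<forall>x\<in>polys V. \<forall>y\<in>polys V. x * y \<in> Q \<longrightarrow> x \<in> Q \<or> y \<in> Q)"

lemma primeideal_iff: "primeideal Q (poly_ring V :: 'k::field mpoly ring) \<longleftrightarrow> is_prime V Q"
proof
  assume "primeideal Q (poly_ring V)"
  then interpret primeideal Q "poly_ring V :: 'k mpoly ring" .
  have "1 \<notin> Q" using one_imp_carrier I_notcarr by auto
  then show "is_prime V Q"
    unfolding is_prime_def using ideal_iff_is_ideal ideal_axioms I_prime by auto
next
  assume Q: "is_prime V Q"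
  then have "1 \<in> (polys V :: 'k mpoly set) - Q"
    unfolding is_prime_def using carrier_subring.one_closed[OF carrier_subring_polys] by blast
  then have "polys V \<noteq> Q" by blast
  with Q show "primeideal Q (poly_ring V)"
    unfolding is_prime_def using ideal_iff_is_ideal cring_poly_ring
    by (intro primeidealI) auto
qed

section \<open>Algebraic independence along chains of primes\<close>

fun powers :: "'k::field mpoly list \<Rightarrow> nat list \<Rightarrow> 'k mpoly" where
  "powers (f # fs) (a # as) = f ^ a * powers fs as"
| "powers _ _ = 1"

lemma powers_polys: "set fs \<subseteq> polys V \<Longrightarrow> powers fs as \<in> polys V"
proof (induction fs as rule: powers.induct)
  interpret carrier_subring "polys V :: 'a mpoly set" by (rule carrier_subring_polys)
  {
    case (1 g gs a as)
    have "g ^ a \<in> polys V" using 1(2) by (induction a) (auto intro: mult_closed one_closed)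
    then show ?case using 1 by (auto intro: mult_closed)
  }
qed (auto intro: carrier_subring.one_closed[OF carrier_subring_polys])

definition box :: "nat \<Rightarrow> nat \<Rightarrow> nat list set" where
  "box t l = {as. set as \<subseteq> {..t} \<and> length as = l}"

text \<open>Linear independence over \<open>K\<close> of the classes modulo \<open>Q\<close>. It is
  stated for an indexed family, so that a repeated member counts as a dependence and members can be
  counted by their indices.\<close>

definition indep_mod :: "'k::field mpoly set \<Rightarrow> ('i \<Rightarrow> 'k mpoly) \<Rightarrow> 'i set \<Rightarrow> bool" where
  "indep_mod Q g A \<longleftrightarrow> (\<forall>c :: 'i \<Rightarrow> 'k. (\<Sum>i\<in>A. single 0 (c i) * g i) \<in> Q \<longrightarrow> (\<forall>i\<in>A. c i = 0))"

lemma finite_box: "finite (box t l)"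
  by (simp add: box_def finite_lists_length_eq)

lemma card_box: "card (box t l) = Suc t ^ l"
  by (simp add: box_def card_lists_length_eq)

lemma box_Suc: "box t (Suc l) = (\<lambda>(a, as). a # as) ` ({..t} \<times> box t l)"
proof
  show "box t (Suc l) \<subseteq> (\<lambda>(a, as). a # as) ` ({..t} \<times> box t l)"
  proof
    fix x assume "x \<in> box t (Suc l)"
    moreover from this obtain a as where "x = a # as" by (cases x) (auto simp: box_def)
    ultimately show "x \<in> (\<lambda>(a, as). a # as) ` ({..t} \<times> box t l)" by (auto simp: box_def)
  qed
qed (auto simp: box_def)

lemma const_polys [simp]: "single 0 c \<in> (polys V :: 'k::field mpoly set)"
  by (simp add: polys_eq)

text \<open>The sum is a polynomial in \<open>f\<close> with coefficients in the span of the
  \<open>g i\<close>. Modulo \<open>Q1\<close>, which contains \<open>f\<close>, only the constant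
  coefficient remains, and it is 0 by independence. What is left is \<open>f\<close> times a
  polynomial in \<open>f\<close> of lower degree, and since the prime \<open>Q0\<close> does not
  contain \<open>f\<close>, the factor can be cancelled.\<close>

lemma indep_mod_powers_aux:
  fixes g :: "'i \<Rightarrow> 'k::field mpoly"
  assumes Q0: "is_prime V Q0" and Q1: "is_ideal (polys V) Q1" and sub: "Q0 \<subseteq> Q1"
    and f: "f \<in> Q1" "f \<notin> Q0" and g: "\<And>i. i \<in> A \<Longrightarrow> g i \<in> polys V" and ind: "indep_mod Q1 g A"
    and "finite A" and "(\<Sum>a\<le>t. f ^ a * (\<Sum>i\<in>A. single 0 (c a i) * g i)) \<in> Q0"
  shows "\<forall>a\<le>t. \<forall>i\<in>A. c a i = 0"
  using assms(9)
proof (induction t arbitrary: c)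
  case 0
  then have "(\<Sum>i\<in>A. single 0 (c 0 i) * g i) \<in> Q1" using sub by auto
  then show ?case using ind by (auto simp: indep_mod_def)
next
  case (Suc t)
  interpret carrier_subring "polys V :: 'k mpoly set" by (rule carrier_subring_polys)
  have Q0I: "is_ideal (polys V) Q0" using Q0 by (simp add: is_prime_def)
  define H where "H a = (\<Sum>i\<in>A. single 0 (c a i) * g i)" for a
  have Hp: "H a \<in> polys V" for a
    unfolding H_def by (intro ideal_sum[OF is_ideal_carrier] mult_closed const_polys g)
  have fp: "f \<in> polys V" using is_idealD(1)[OF Q1] f by blast
  have fa: "f ^ a \<in> polys V" for a by (induction a) (auto intro: mult_closed fp one_closed)
  define R where "R = (\<Sum>a\<le>t. f ^ a * H (Suc a))"
  have Rp: "R \<in> polys V" unfolding R_def by (intro ideal_sum[OF is_ideal_carrier] mult_closed fa Hp)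
  have eq: "(\<Sum>a\<le>Suc t. f ^ a * H a) = H 0 + f * R"
    unfolding R_def by (subst sum.atMost_Suc_shift) (simp add: sum_distrib_left mult.assoc)
  have in0: "H 0 + f * R \<in> Q0" using Suc.prems unfolding H_def[symmetric] eq .
  have "f * R \<in> Q1" using f(1) Rp is_idealD(5)[OF Q1] by blast
  then have "H 0 + f * R - f * R \<in> Q1" using in0 sub by (intro ideal_diff[OF Q1]) auto
  then have "H 0 \<in> Q1" by simp
  then have c0: "\<forall>i\<in>A. c 0 i = 0" using ind unfolding H_def indep_mod_def by blast
  then have "H 0 = 0" by (simp add: H_def)
  then have "R \<in> Q0" using in0 Q0 f fp Rp unfolding is_prime_def by auto
  then have "\<forall>a\<le>t. \<forall>i\<in>A. c (Suc a) i = 0"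
    unfolding R_def H_def by (rule Suc.IH)
  then show ?case using c0 by (metis Suc_le_mono not0_implies_Suc)
qed

text \<open>Induction from the top of the chain: polynomials for the chain without
  \<open>Q 0\<close> are extended by an element of the second prime that is not in
  \<open>Q 0\<close>. For \<open>l = 0\<close> the claim is that \<open>Q 0\<close> contains no
  nonzero constant.\<close>

lemma ex_indep_powers:
  assumes "\<And>i. i \<le> l \<Longrightarrow> is_prime V (Q i :: 'k::field mpoly set)" "\<And>i. i < l \<Longrightarrow> Q i \<subset> Q (Suc i)"
  shows "\<exists>fs. length fs = l \<and> set fs \<subseteq> polys V \<and> (\<forall>t. indep_mod (Q 0) (powers fs) (box t l))"
  using assms
proof (induction l arbitrary: Q)
  case 0
  have "indep_mod (Q 0) (powers []) (box t 0)" for t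
    unfolding indep_mod_def
  proof (intro allI impI ballI)
    fix c :: "nat list \<Rightarrow> 'k" and i
    assume s: "(\<Sum>i\<in>box t 0. single 0 (c i) * powers [] i) \<in> Q 0" and i: "i \<in> box t 0"
    have b: "box t 0 = {[]}" by (auto simp: box_def)
    have Q: "is_prime V (Q 0)" using 0 by simp
    have s: "single 0 (c []) \<in> Q 0" using s by (simp add: b)
    show "c i = 0"
    proof (rule ccontr)
      assume "c i \<noteq> 0"
      then have "c [] \<noteq> 0" using i b by simp
      then have "single 0 (1 / c []) * single 0 (c []) = (1 :: 'k mpoly)"
        by (simp add: mult_single)
      moreover have "single 0 (1 / c []) * single 0 (c []) \<in> Q 0"
        using Q s unfolding is_prime_def by (intro is_idealD(4)[of "polys V"]) auto
      ultimately show False using Q unfolding is_prime_def by simp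
    qed
  qed
  then show ?case by simp
next
  case (Suc l)
  obtain fs where fs: "length fs = l" "set fs \<subseteq> polys V" "\<And>t. indep_mod (Q (Suc 0)) (powers fs) (box t l)"
    using Suc.IH[of "\<lambda>i. Q (Suc i)"] Suc.prems by auto
  interpret carrier_subring "polys V :: 'k mpoly set" by (rule carrier_subring_polys)
  have Q0: "is_prime V (Q 0)" and Q1: "is_ideal (polys V) (Q (Suc 0))"
    using Suc.prems(1)[of 0] Suc.prems(1)[of "Suc 0"] by (auto simp: is_prime_def)
  have "Q 0 \<subset> Q (Suc 0)" using Suc.prems(2)[of 0] by simp
  then obtain f where f: "f \<in> Q (Suc 0)" "f \<notin> Q 0" and sub: "Q 0 \<subseteq> Q (Suc 0)" by blast
  have fp: "f \<in> polys V" using is_idealD(1)[OF Q1] f by blast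
  have "indep_mod (Q 0) (powers (f # fs)) (box t (Suc l))" for t
    unfolding indep_mod_def
  proof (intro allI impI)
    fix c :: "nat list \<Rightarrow> 'k"
    assume s: "(\<Sum>i\<in>box t (Suc l). single 0 (c i) * powers (f # fs) i) \<in> Q 0"
    have "(\<Sum>i\<in>box t (Suc l). single 0 (c i) * powers (f # fs) i) =
        (\<Sum>(a, as)\<in>{..t} \<times> box t l. single 0 (c (a # as)) * (f ^ a * powers fs as))"
      unfolding box_Suc by (subst sum.reindex) (auto simp: inj_on_def intro!: sum.cong)
    also have "\<dots> = (\<Sum>a\<le>t. \<Sum>as\<in>box t l. single 0 (c (a # as)) * (f ^ a * powers fs as))"
      by (simp add: sum.cartesian_product)
    also have "\<dots> = (\<Sum>a\<le>t. f ^ a * (\<Sum>as\<in>box t l. single 0 (c (a # as)) * powers fs as))"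
      by (simp add: sum_distrib_left mult.left_commute)
    finally have "(\<Sum>a\<le>t. f ^ a * (\<Sum>as\<in>box t l. single 0 (c (a # as)) * powers fs as)) \<in> Q 0"
      using s by simp
    then have "\<forall>a\<le>t. \<forall>as\<in>box t l. c (a # as) = 0"
      by (rule indep_mod_powers_aux[OF Q0 Q1 sub f powers_polys[OF fs(2)] fs(3) finite_box])
    then show "\<forall>i\<in>box t (Suc l). c i = 0" unfolding box_Suc by auto
  qed
  then show ?case using fs fp by (intro exI[of _ "f # fs"]) auto
qed

text \<open>With a bound on each exponent instead of the total degree, at most
  \<open>(N + 1)^m\<close> exponents in \<open>m\<close> variables are admissible.\<close>

definition bounded :: "nat \<Rightarrow> 'k::field mpoly \<Rightarrow> bool" where
  "bounded N p \<longleftrightarrow> (\<forall>t\<in>keys p. \<forall>v. lookup t v \<le> N)"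

lemma bounded_mult: "bounded a p \<Longrightarrow> bounded b q \<Longrightarrow> bounded (a + b) (p * q)"
  using keys_mult[of p q] by (fastforce simp: bounded_def lookup_add intro: add_mono)

lemma ex_bounded: "\<exists>N. bounded N p"
proof -
  define N where "N = Max (insert 0 (\<Union>t\<in>keys p. lookup t ` keys t))"
  have fin: "finite (insert 0 (\<Union>t\<in>keys p. lookup t ` keys t))" by auto
  have "lookup t v \<le> N" if "t \<in> keys p" for t v
  proof (cases "v \<in> keys t")
    case True
    then show ?thesis unfolding N_def using fin that by (intro Max_ge) auto
  qed (simp add: in_keys_iff)
  then show ?thesis unfolding bounded_def by blast
qed

lemma bounded_powers:
  assumes "\<And>f. f \<in> set fs \<Longrightarrow> bounded N f" "set as \<subseteq> {..t}"
  shows "bounded (length fs * (t * N)) (powers fs as)"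
  using assms
proof (induction fs as rule: powers.induct)
  case (1 f fs a as)
  have "bounded (b * N) (f ^ b)" for b
  proof (induction b)
    case (Suc b)
    then show ?case using bounded_mult[of N f "b * N" "f ^ b"] 1(2) by (simp add: add.commute)
  qed (simp add: bounded_def)
  moreover have "a * N \<le> t * N" using 1(3) by (intro mult_right_mono) auto
  ultimately have "bounded (t * N) (f ^ a)" unfolding bounded_def by (meson order_trans)
  then show ?case using bounded_mult[OF _ 1(1)] 1(2,3) by (auto simp: add.commute)
qed (auto simp: bounded_def)

lemma card_bounded_exps:
  assumes "finite Z"
  shows "finite {u \<in> exps Z. \<forall>v. lookup u v \<le> N}" "card {u \<in> exps Z. \<forall>v. lookup u v \<le> N} \<le> Suc N ^ card Z"
proof -
  let ?B = "{u \<in> exps Z. \<forall>v. lookup u v \<le> N}"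
  have inj: "inj_on (\<lambda>u. restrict (lookup u) Z) ?B"
  proof (rule inj_onI)
    fix u w assume uw: "u \<in> ?B" "w \<in> ?B" "restrict (lookup u) Z = restrict (lookup w) Z"
    show "u = w"
    proof (rule poly_mapping_eqI)
      fix v show "lookup u v = lookup w v"
      proof (cases "v \<in> Z")
        case True
        then show ?thesis using fun_cong[OF uw(3), of v] by simp
      qed (use uw in \<open>simp add: exps_iff\<close>)
    qed
  qed
  have im: "(\<lambda>u. restrict (lookup u) Z) ` ?B \<subseteq> Z \<rightarrow>\<^sub>E {..N}" by auto
  have fin: "finite (Z \<rightarrow>\<^sub>E {..N})" using assms by (intro finite_PiE) auto
  then show "finite ?B" using im inj by (meson finite_imageD finite_subset)
  have "card ?B \<le> card (Z \<rightarrow>\<^sub>E {..N})" using card_inj_on_le[OF inj im fin] .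
  then show "card ?B \<le> Suc N ^ card Z" using assms by (simp add: card_PiE)
qed

lemma indep_card_le:
  fixes g :: "'i \<Rightarrow> 'k::field mpoly"
  assumes A: "finite A" and B: "finite B" and g: "\<And>i. i \<in> A \<Longrightarrow> g i \<in> supported B" and ind: "indep_mod {0} g A"
  shows "card A \<le> card B"
proof -
  interpret vs: vector_space "\<lambda>(c :: 'k) (p :: 'k mpoly). single 0 c * p"
    by unfold_locales (simp_all add: algebra_simps mult_single single_add flip: mult.assoc)
  have inj: "inj_on g A"
  proof (rule inj_onI, rule ccontr)
    fix i j assume ij: "i \<in> A" "j \<in> A" "g i = g j" "i \<noteq> j"
    define c where "c x = (if x = i then 1 else if x = j then -1 else (0 :: 'k))" for x
    have "(\<Sum>x\<in>A. single 0 (c x) * g x) = (\<Sum>x\<in>{i, j}. single 0 (c x) * g x)"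
      using A ij by (intro sum.mono_neutral_right) (auto simp: c_def)
    also have "\<dots> = 0" using ij by (simp add: c_def single_uminus)
    finally have "c i = 0" using ind ij(1) unfolding indep_mod_def by (metis singletonI)
    then show False by (simp add: c_def)
  qed
  have "vs.independent (g ` A)"
  proof
    assume "vs.dependent (g ` A)"
    then obtain u v where uv: "v \<in> g ` A" "u v \<noteq> 0" "(\<Sum>v\<in>g ` A. single 0 (u v) * v) = 0"
      using vs.dependent_finite[of "g ` A"] A by auto
    have "(\<Sum>i\<in>A. single 0 (u (g i)) * g i) = 0" using uv(3) by (simp add: sum.reindex[OF inj])
    then have "\<forall>i\<in>A. u (g i) = 0" using ind[unfolded indep_mod_def, rule_format, of "\<lambda>i. u (g i)"] by auto
    then show False using uv by auto
  qed
  moreover have "g ` A \<subseteq> vs.span (monomial ` B)"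
  proof
    fix p assume "p \<in> g ` A"
    then have p: "keys p \<subseteq> B" using g by (auto simp: supported_def)
    have "(\<Sum>t\<in>keys p. single 0 (lookup p t) * monomial t) \<in> vs.span (monomial ` B)"
      using p by (intro vs.span_sum vs.span_scale vs.span_base) auto
    then show "p \<in> vs.span (monomial ` B)"
      using mpoly_expand[of p] by (simp flip: single_eq_monomial)
  qed
  ultimately have "card (g ` A) \<le> card (monomial ` B :: 'k mpoly set)"
    using vs.independent_span_bound B by blast
  also have "\<dots> \<le> card B" using B by (rule card_image_le)
  finally show ?thesis using card_image[OF inj] by simp
qed

text \<open>Modulo \<open>Q 0\<close> every polynomial is congruent to one in the variables
  \<open>Z\<close>. The \<open>(t + 1)^l\<close> products of powers with exponents at most
  \<open>t\<close> stay independent after this reduction, while their monomials have exponents at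
  most \<open>l t N\<close>. The resulting inequality
  \<open>(t + 1)^l \<le> (l t N + 1)^(card Z)\<close> fails for a suitable \<open>t\<close> if
  \<open>l > card Z\<close>.\<close>

lemma prime_chain_length:
  fixes Q :: "nat \<Rightarrow> 'k::field mpoly set"
  assumes V: "finite V" and Q: "\<And>i. i \<le> l \<Longrightarrow> is_prime V (Q i)" "\<And>i. i < l \<Longrightarrow> Q i \<subset> Q (Suc i)"
    and Z: "Z \<subseteq> V" "\<And>v. v \<in> V - Z \<Longrightarrow> monomial (single v 1) \<in> Q 0"
  shows "l \<le> card Z"
proof (rule ccontr)
  assume "\<not> l \<le> card Z"
  then have l: "Suc (card Z) \<le> l" by simp
  have Q0: "is_ideal (polys V) (Q 0)" using Q(1)[of 0] by (simp add: is_prime_def)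
  interpret carrier_subring "polys V :: 'k mpoly set" by (rule carrier_subring_polys)
  have finZ: "finite Z" using V Z(1) finite_subset by blast
  have "monomial t \<in> Q 0" if t: "t \<in> exps V" "t \<notin> exps Z" for t
  proof -
    obtain v where v: "v \<notin> Z" "lookup t v \<noteq> 0" using t(2) by (auto simp: exps_iff)
    then have "v \<in> V" "single v 1 divs t" using t(1) exps_lookup[of t V v]
      by (auto simp: divs_def lookup_single when_def)
    then have "monomial t = monomial (t - single v 1) * (monomial (single v 1) :: 'k mpoly)"
      using divs_minus(2) by (simp flip: monomial_add)
    moreover have "monomial (t - single v 1) \<in> (polys V :: 'k mpoly set)"
      using minus_exps[OF t(1)] by (simp add: polys_eq)
    moreover have "monomial (single v 1) \<in> Q 0" using Z(2) v \<open>v \<in> V\<close> by blast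
    ultimately show ?thesis using is_idealD(4)[OF Q0] by simp
  qed
  note mono0 = this
  have red: "p - restr (exps Z) p \<in> Q 0" if p: "p \<in> polys V" for p
  proof (rule mpoly_in_ideal[OF Q0])
    have k: "t \<in> keys p \<and> t \<notin> exps Z" if "t \<in> keys (p - restr (exps Z) p)" for t
      using that by (auto simp: in_keys_iff lookup_minus lookup_restr split: if_splits)
    then show "p - restr (exps Z) p \<in> polys V" using p unfolding polys_eq supported_def by blast
    show "monomial t \<in> Q 0" if "t \<in> keys (p - restr (exps Z) p)" for t
      using k[OF that] p mono0 unfolding polys_eq supported_def by blast
  qed
  have "\<exists>fs. length fs = l \<and> set fs \<subseteq> polys V \<and> (\<forall>t. indep_mod (Q 0) (powers fs) (box t l))"
    using Q by (rule ex_indep_powers)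
  then obtain fs where fs: "length fs = l" "set fs \<subseteq> polys V" "\<And>t. indep_mod (Q 0) (powers fs) (box t l)"
    by blast
  have "\<exists>N. \<forall>f\<in>set fs. bounded N f"
  proof -
    have "\<forall>f :: 'k mpoly. \<exists>N. bounded N f" using ex_bounded by blast
    from choice[OF this] obtain b where b: "\<And>f :: 'k mpoly. bounded (b f) f" by blast
    have "bounded (Max (b ` set fs)) f" if "f \<in> set fs" for f
    proof -
      have "b f \<le> Max (b ` set fs)" using that by (intro Max_ge) auto
      then show ?thesis using b[of f] unfolding bounded_def by (meson order_trans)
    qed
    then show ?thesis by blast
  qed
  then obtain N where N: "\<And>f. f \<in> set fs \<Longrightarrow> bounded N f" by blast
  note pow = powers_polys[OF fs(2)]
  have le: "Suc t ^ l \<le> Suc (l * (t * N)) ^ card Z" for t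
  proof -
    let ?B = "{u \<in> exps Z. \<forall>v. lookup u v \<le> l * (t * N)}"
    define g where "g as = restr (exps Z) (powers fs as)" for as
    have "indep_mod {0} g (box t l)"
      unfolding indep_mod_def
    proof (intro allI impI)
      fix c :: "nat list \<Rightarrow> 'k"
      assume "(\<Sum>i\<in>box t l. single 0 (c i) * g i) \<in> {0}"
      then have "(\<Sum>i\<in>box t l. single 0 (c i) * powers fs i) = (\<Sum>i\<in>box t l. single 0 (c i) * (powers fs i - g i))"
        by (simp add: right_diff_distrib sum_subtractf)
      also have "\<dots> \<in> Q 0"
        unfolding g_def by (intro ideal_sum[OF Q0] is_idealD(4)[OF Q0] const_polys red pow)
      finally show "\<forall>i\<in>box t l. c i = 0" using fs(3) unfolding indep_mod_def by blast
    qed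
    moreover have "g as \<in> supported ?B" if "as \<in> box t l" for as
      using bounded_powers[of fs N as t] N that fs(1)
      by (auto simp: g_def supported_def bounded_def box_def)
    ultimately have "card (box t l) \<le> card ?B"
      using finite_box card_bounded_exps(1)[OF finZ] by (intro indep_card_le)
    also have "\<dots> \<le> Suc (l * (t * N)) ^ card Z" by (rule card_bounded_exps(2)[OF finZ])
    finally show ?thesis by (simp add: card_box)
  qed
  \<comment> \<open>For \<open>t = D\<close> the right-hand side is at most
    \<open>(l N + 1)^(card Z)\<close> times \<open>(D + 1)^(card Z)\<close>, that is
    \<open>D (D + 1)^(card Z)\<close>, which is less than
    \<open>(D + 1)^(card Z + 1)\<close>.\<close>
  define D where "D = Suc (l * N) ^ card Z"
  have "Suc D * Suc D ^ card Z \<le> Suc D ^ l" using l by (metis power_Suc power_increasing le_add1 plus_1_eq_Suc)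
  also have "\<dots> \<le> Suc (l * (D * N)) ^ card Z" by (rule le)
  also have "\<dots> \<le> (Suc (l * N) * Suc D) ^ card Z" by (intro power_mono) (auto simp: algebra_simps)
  also have "\<dots> = D * Suc D ^ card Z" by (simp only: D_def power_mult_distrib)
  finally show False by simp
qed

text \<open>Modulo the variables in \<open>T\<close>, a polynomial is congruent to its part in the
  remaining variables; the claim thus reduces to the absence of zero divisors among
  polynomials.\<close>

lemma is_prime_variables:
  assumes "T \<subseteq> V"
  shows "is_prime V (supported {t \<in> exps V. keys t \<inter> T \<noteq> {}} :: 'k::field mpoly set)"
proof -
  define U where "U = {t \<in> exps V. keys t \<inter> T \<noteq> {}}"
  interpret carrier_subring "polys V :: 'k mpoly set" by (rule carrier_subring_polys)
  have U: "upset V U" by (auto simp: upset_def U_def)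
  note I = is_ideal_supported[OF U, where ?'a = 'k]
  have rest: "p - restr (exps (V - T)) p \<in> supported U" if "p \<in> polys V" for p :: "'k mpoly"
  proof -
    have "t \<in> U" if "t \<in> keys p" "t \<notin> exps (V - T)" for t
      using that \<open>p \<in> polys V\<close> by (auto simp: polys_eq supported_def U_def exps_def)
    then show ?thesis by (auto simp: supported_def in_keys_iff lookup_minus lookup_restr split: if_splits)
  qed
  have UT: "U \<inter> exps (V - T) = {}" by (auto simp: U_def exps_def)
  have "x \<in> supported U \<or> y \<in> supported U" if xy: "x \<in> polys V" "y \<in> polys V" "x * y \<in> supported U" for x y :: "'k mpoly"
  proof -
    define x' y' where "x' = restr (exps (V - T)) x" and "y' = restr (exps (V - T)) y"
    have sub: "x' \<in> polys V" "y' \<in> polys V"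
      using xy(1,2) by (auto simp: x'_def y'_def polys_eq supported_def)
    have "x * y - x' * y' = (x - x') * y + (y - y') * x'" by (simp add: algebra_simps)
    also have "\<dots> \<in> supported U"
      using rest[OF xy(1)] rest[OF xy(2)] xy sub is_idealD(3,5)[OF I] unfolding x'_def y'_def by blast
    finally have "x * y - (x * y - x' * y') \<in> supported U" using xy(3) by (rule supported_diff[rotated])
    then have "x' * y' \<in> supported U" by simp
    moreover have "x' * y' \<in> supported (exps (V - T))"
      unfolding x'_def y'_def by (rule supported_mult[OF restr_supported restr_supported]) simp
    ultimately have "keys (x' * y') = {}" using UT unfolding supported_def by blast
    then have "x' = 0 \<or> y' = 0" by simp
    then show ?thesis using rest[OF xy(1)] rest[OF xy(2)] by (auto simp: x'_def y'_def)
  qed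
  moreover have "1 \<notin> (supported U :: 'k mpoly set)"
    using supported_monomial[of 0 U, where ?'a = 'k] by (simp add: U_def)
  ultimately show ?thesis using I unfolding is_prime_def U_def by blast
qed

text \<open>The second claim recovers \<open>Q\<close> from its image, so that strict inclusions of
  primes stay strict in the quotient.\<close>

lemma primeideal_quotient_image:
  fixes R (structure)
  assumes "cring R" "ideal J R" "primeideal Q R" "J \<subseteq> Q"
  shows "primeideal ((+>) J ` Q) (R Quot J)" "x \<in> carrier R \<Longrightarrow> J +> x \<in> (+>) J ` Q \<Longrightarrow> x \<in> Q"
proof -
  interpret R: cring R by fact
  interpret J: ideal J R by fact
  interpret Q: primeideal Q R by fact
  show mem: "x \<in> Q" if x: "x \<in> carrier R" "J +> x \<in> (+>) J ` Q" for x
  proof -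
    obtain q where q: "q \<in> Q" "J +> x = J +> q" using x(2) by blast
    have "x \<in> J +> x" using J.a_rcos_self x(1) by blast
    then obtain j where "j \<in> J" "x = j \<oplus> q" unfolding q(2) by (auto simp: a_r_coset_def')
    then show ?thesis using q(1) assms(4) Q.a_closed by blast
  qed
  interpret S: cring "R Quot J" by (rule J.quotient_is_cring[OF assms(1)])
  have hom: "(+>) J \<in> ring_hom R (R Quot J)" by (rule J.rcos_ring_hom)
  have car: "carrier (R Quot J) = (+>) J ` carrier R"
    by (auto simp: FactRing_def A_RCOSETS_def')
  show "primeideal ((+>) J ` Q) (R Quot J)"
  proof (rule primeidealI)
    show "ideal ((+>) J ` Q) (R Quot J)"
      using R.ring_ideal_imp_quot_ideal[OF assms(2) Q.ideal_axioms] .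
    show "cring (R Quot J)" ..
    show "carrier (R Quot J) \<noteq> (+>) J ` Q"
    proof
      assume eq: "carrier (R Quot J) = (+>) J ` Q"
      have "x \<in> Q" if x: "x \<in> carrier R" for x
      proof (rule mem[OF x])
        have "J +> x \<in> (+>) J ` carrier R" using x by (rule imageI)
        then show "J +> x \<in> (+>) J ` Q" using eq unfolding car by simp
      qed
      then have "carrier R = Q" using Q.a_subset by blast
      then show False using Q.I_notcarr by simp
    qed
    fix a b assume ab: "a \<in> carrier (R Quot J)" "b \<in> carrier (R Quot J)" "a \<otimes>\<^bsub>R Quot J\<^esub> b \<in> (+>) J ` Q"
    then obtain x y where xy: "x \<in> carrier R" "y \<in> carrier R" "a = J +> x" "b = J +> y" unfolding car by blast
    then have "J +> (x \<otimes> y) \<in> (+>) J ` Q"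
      using ab(3) ring_hom_mult[OF hom xy(1,2)] unfolding xy(3,4) by (simp only:)
    then have "x \<otimes> y \<in> Q" by (rule mem[OF R.m_closed[OF xy(1,2)]])
    then have "x \<in> Q \<or> y \<in> Q" using Q.I_prime xy(1,2) by blast
    then show "a \<in> (+>) J ` Q \<or> b \<in> (+>) J ` Q" unfolding xy(3,4) by (elim disjE) (auto intro: imageI)
  qed
qed

text \<open>Upper bound: a prime containing \<open>J\<close> contains a variable of each
  \<open>f j\<close>, so at most \<open>card Y - k\<close> variables avoid it. Lower bound: start
  with the prime generated by one variable from each support and adjoin the other variables one at a
  time.\<close>

theorem krull_dim_quotient:
  fixes f :: "nat \<Rightarrow> expo"
  assumes Y: "finite Y" and f: "\<And>j. j < k \<Longrightarrow> keys (f j) \<noteq> {} \<and> keys (f j) \<subseteq> Y"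
    and fdisj: "\<And>i j. i < k \<Longrightarrow> j < k \<Longrightarrow> i \<noteq> j \<Longrightarrow> keys (f i) \<inter> keys (f j) = {}"
  defines "J \<equiv> (supported (upset_gen Y (f ` {..<k})) :: 'k::field mpoly set)"
  shows "krull_dim (poly_ring Y Quot J) = enat (card Y - k)"
proof -
  let ?B = "poly_ring Y :: 'k mpoly ring"
  interpret B: cring ?B by (rule cring_poly_ring)
  have JI: "ideal J ?B"
    unfolding ideal_iff_is_ideal J_def by (rule is_ideal_supported[OF upset_upset_gen])
  interpret J: ideal J ?B by (rule JI)
  have fJ: "monomial (f j) \<in> J" if "j < k" for j
  proof -
    have "f j \<in> exps Y" using f[OF that] by (simp add: exps_def)
    then have "f j \<in> upset_gen Y (f ` {..<k})" unfolding upset_gen_def using that divs_refl by blast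
    then show ?thesis by (simp add: J_def)
  qed
  have upper: "l \<le> card Y - k"
    if chain: "\<And>i. i \<le> l \<Longrightarrow> primeideal (P i) (?B Quot J)" "\<And>i. i < l \<Longrightarrow> P i \<subset> P (Suc i)" for l P
  proof -
    define Q where "Q i = {x \<in> carrier ?B. J +>\<^bsub>?B\<^esub> x \<in> P i}" for i
    interpret h: ring_hom_ring ?B "?B Quot J" "(+>\<^bsub>?B\<^esub>) J" by (rule J.rcos_ring_hom_ring)
    have Qp: "is_prime Y (Q i)" if "i \<le> l" for i
      unfolding primeideal_iff[symmetric] Q_def by (rule h.primeideal_vimage[OF B.cring_axioms chain(1)[OF that]])
    have car: "carrier (?B Quot J) = (+>\<^bsub>?B\<^esub>) J ` carrier ?B"
      unfolding FactRing_def A_RCOSETS_def' by auto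
    have Qs: "Q i \<subset> Q (Suc i)" if i: "i < l" for i
    proof -
      obtain b where b: "b \<in> P (Suc i)" "b \<notin> P i" using chain(2)[OF i] by blast
      interpret P: primeideal "P (Suc i)" "?B Quot J" using chain(1)[of "Suc i"] i by simp
      have "b \<in> carrier (?B Quot J)" using P.Icarr[OF b(1)] .
      then obtain x where "x \<in> carrier ?B" "b = J +>\<^bsub>?B\<^esub> x" unfolding car by blast
      then have "x \<in> Q (Suc i)" "x \<notin> Q i" using b by (auto simp: Q_def)
      moreover have "Q i \<subseteq> Q (Suc i)" using chain(2)[OF i] by (auto simp: Q_def)
      ultimately show ?thesis by blast
    qed
    have JQ: "J \<subseteq> Q 0"
    proof
      fix x assume x: "x \<in> J"
      interpret P: primeideal "P 0" "?B Quot J" using chain(1)[of 0] by simp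
      have "J +>\<^bsub>?B\<^esub> x = J" using J.a_rcos_const[OF x] .
      then show "x \<in> Q 0" using J.Icarr[OF x] P.zero_closed by (simp add: Q_def FactRing_def)
    qed
    define Z where "Z = {v \<in> Y. monomial (single v 1) \<notin> Q 0}"
    have Q0: "is_prime Y (Q 0)" by (rule Qp) simp
    have prim: "keys t \<subseteq> Z \<Longrightarrow> monomial t \<notin> Q 0" for t
    proof (induction "\<Sum>v\<in>keys t. lookup t v" arbitrary: t rule: less_induct)
      case less
      show ?case
      proof (cases "t = 0")
        case True then show ?thesis using Q0 by (simp add: is_prime_def)
      next
        case False
        then obtain v where v: "v \<in> keys t" by (metis ex_in_conv keys_eq_empty)
        define u where "u = t - single v 1"
        have tu: "t = u + single v 1" unfolding u_def
          using v by (intro divs_minus(2)[symmetric]) (auto simp: divs_def lookup_single when_def in_keys_iff)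
        have uk: "keys u \<subseteq> keys t" unfolding tu by (simp add: subset_insertI)
        have "(\<Sum>v\<in>keys u. lookup u v) \<le> (\<Sum>v\<in>keys t. lookup u v)"
          using uk by (intro sum_mono2) auto
        also have "\<dots> < (\<Sum>v\<in>keys t. lookup t v)"
          using v by (intro sum_strict_mono_ex1) (auto simp: tu lookup_add)
        finally have "monomial u \<notin> Q 0" using uk less by blast
        moreover have "monomial (single v 1) \<notin> Q 0" using v less.prems by (auto simp: Z_def)
        moreover have "monomial u \<in> (polys Y :: 'k mpoly set)" "monomial (single v 1) \<in> (polys Y :: 'k mpoly set)"
          using uk v less.prems by (auto simp: polys_eq exps_def Z_def)
        ultimately show ?thesis using Q0 unfolding is_prime_def tu monomial_add by blast
      qed
    qed
    have "l \<le> card Z"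
      by (rule prime_chain_length[where Q = Q, OF Y Qp Qs]) (auto simp: Z_def)
    moreover have "card (Y \<inter> Z) + k \<le> card Y"
    proof (rule card_ge_disjoint_supports[OF Y f fdisj])
      show "\<not> keys (f j) \<subseteq> Z" if "j < k" for j using prim[of "f j"] fJ[OF that] JQ by blast
    qed
    moreover have "Y \<inter> Z = Z" by (auto simp: Z_def)
    ultimately show ?thesis by simp
  qed
  have lower: "\<exists>P. (\<forall>i \<le> card Y - k. primeideal (P i) (?B Quot J)) \<and> (\<forall>i < card Y - k. P i \<subset> P (Suc i))"
  proof -
    have "\<forall>j\<in>{..<k}. \<exists>v. v \<in> keys (f j)" using f by blast
    from bchoice[OF this] obtain v where v: "\<And>j. j < k \<Longrightarrow> v j \<in> keys (f j)" by auto
    have "card (v ` {..<k}) \<le> k" using card_image_le[of "{..<k}" v] by simp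
    moreover have "v ` {..<k} \<subseteq> Y" using v f by blast
    ultimately have cd: "card Y - k \<le> card (Y - v ` {..<k})" using Y by (simp add: card_Diff_subset finite_subset)
    obtain ys where ys: "set ys = Y - v ` {..<k}" "distinct ys"
      using finite_distinct_list[OF finite_Diff[OF Y, of "v ` {..<k}"]] by (elim exE conjE)
    have len: "card Y - k \<le> length ys" using cd distinct_card[OF ys(2)] ys(1) by simp
    define T where "T i = v ` {..<k} \<union> set (take i ys)" for i
    define Q where "Q i = (supported {t \<in> exps Y. keys t \<inter> T i \<noteq> {}} :: 'k mpoly set)" for i
    have TY: "T i \<subseteq> Y" for i using \<open>v ` {..<k} \<subseteq> Y\<close> ys set_take_subset[of i ys] by (auto simp: T_def)
    have Qp: "primeideal (Q i) ?B" for i unfolding primeideal_iff Q_def by (rule is_prime_variables[OF TY])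
    have JQ: "J \<subseteq> Q i" for i
      unfolding J_def Q_def
    proof (rule supported_mono, rule subsetI)
      fix t assume "t \<in> upset_gen Y (f ` {..<k})"
      then obtain j where j: "t \<in> exps Y" "j < k" "f j divs t" by (auto simp: upset_gen_def)
      then obtain w where "t = f j + w" by (auto simp: divs_iff)
      then have "v j \<in> keys t \<inter> T i" using v[OF j(2)] j(2) by (auto simp: T_def)
      then show "t \<in> {t \<in> exps Y. keys t \<inter> T i \<noteq> {}}" using j by blast
    qed
    have im: "primeideal ((+>\<^bsub>?B\<^esub>) J ` Q i) (?B Quot J)"
      and mem: "x \<in> carrier ?B \<Longrightarrow> J +>\<^bsub>?B\<^esub> x \<in> (+>\<^bsub>?B\<^esub>) J ` Q i \<Longrightarrow> x \<in> Q i" for i x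
      by (rule primeideal_quotient_image(1)[OF B.cring_axioms JI Qp JQ],
          rule primeideal_quotient_image(2)[OF B.cring_axioms JI Qp JQ])
    have "(+>\<^bsub>?B\<^esub>) J ` Q i \<subset> (+>\<^bsub>?B\<^esub>) J ` Q (Suc i)" if "i < card Y - k" for i
    proof
      have iT: "T i \<subseteq> T (Suc i)" unfolding T_def using set_take_subset_set_take[of i "Suc i" ys] by auto
      then show "(+>\<^bsub>?B\<^esub>) J ` Q i \<subseteq> (+>\<^bsub>?B\<^esub>) J ` Q (Suc i)"
        unfolding Q_def by (intro image_mono supported_mono) blast
      have i: "i < length ys" using that len by simp
      define x where "x = (monomial (single (ys ! i) 1) :: 'k mpoly)"
      have "ys ! i \<in> T (Suc i)" using i by (auto simp: T_def take_Suc_conv_app_nth)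
      then have "x \<in> Q (Suc i)" using TY by (auto simp: x_def Q_def)
      moreover have "ys ! i \<notin> T i"
      proof -
        have "ys ! i \<notin> set (take i ys)" using ys(2) i by (auto simp: in_set_conv_nth nth_eq_iff_index_eq)
        moreover have "ys ! i \<notin> v ` {..<k}" using ys(1) i nth_mem by blast
        ultimately show ?thesis by (simp add: T_def)
      qed
      then have "x \<notin> Q i" by (auto simp: x_def Q_def)
      moreover have "x \<in> carrier ?B" using ys(1) i nth_mem by (auto simp: x_def polys_eq)
      ultimately show "(+>\<^bsub>?B\<^esub>) J ` Q i \<noteq> (+>\<^bsub>?B\<^esub>) J ` Q (Suc i)"
        using mem[of x i] imageI[of x "Q (Suc i)" "(+>\<^bsub>?B\<^esub>) J"] by auto
    qed
    then show ?thesis using im by (intro exI[of _ "\<lambda>i. (+>\<^bsub>?B\<^esub>) J ` Q i"]) blast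
  qed
  show ?thesis
    unfolding krull_dim_def
  proof (rule antisym)
    show "Sup {enat l | l. \<exists>P. (\<forall>i \<le> l. primeideal (P i) (?B Quot J)) \<and> (\<forall>i < l. P i \<subset> P (Suc i))} \<le> enat (card Y - k)"
    proof (rule Sup_least)
      fix x assume "x \<in> {enat l | l. \<exists>P. (\<forall>i \<le> l. primeideal (P i) (?B Quot J)) \<and> (\<forall>i < l. P i \<subset> P (Suc i))}"
      then obtain l P where lP: "x = enat l" "\<forall>i \<le> l. primeideal (P i) (?B Quot J)" "\<forall>i < l. P i \<subset> P (Suc i)"
        by blast
      have "l \<le> card Y - k" by (rule upper[of l P]) (use lP in auto)
      then show "x \<le> enat (card Y - k)" using lP by simp
    qed
    show "enat (card Y - k) \<le> Sup {enat l | l. \<exists>P. (\<forall>i \<le> l. primeideal (P i) (?B Quot J)) \<and> (\<forall>i < l. P i \<subset> P (Suc i))}"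
      using lower by (intro Sup_upper) blast
  qed
qed

section \<open>Depth in terms of ideals\<close>

fun adjoin_list :: "'a::comm_ring_1 set \<Rightarrow> 'a set \<Rightarrow> 'a list \<Rightarrow> 'a set" where
  "adjoin_list S W [] = W"
| "adjoin_list S W (f # fs) = adjoin_list S (adjoin S W f) fs"

lemma (in carrier_subring) is_ideal_adjoin_list:
  "is_ideal S W \<Longrightarrow> set fs \<subseteq> S \<Longrightarrow> is_ideal S (adjoin_list S W fs)"
  by (induction fs arbitrary: W) (simp_all add: is_ideal_adjoin)

lemma (in carrier_subring) adjoin_list_superset: "W \<subseteq> adjoin_list S W fs"
proof (induction fs arbitrary: W)
  case (Cons f fs)
  show ?case using Cons[of "adjoin S W f"] adjoin_superset[of W f] by auto
qed simp

lemma (in carrier_subring) adjoin_list_subset: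
  "is_ideal S I \<Longrightarrow> W \<subseteq> I \<Longrightarrow> set fs \<subseteq> I \<Longrightarrow> adjoin_list S W fs \<subseteq> I"
proof (induction fs arbitrary: W)
  case (Cons f fs)
  have "adjoin S W f \<subseteq> I" using Cons.prems by (intro adjoin_least) auto
  then show ?case using Cons by simp
qed simp

lemma adjoin_list_eq:
  "adjoin_list S W fs = {w + (\<Sum>j<length fs. fs ! j * g j) | w g. w \<in> W \<and> (\<forall>j<length fs. g j \<in> S)}"
proof (induction fs arbitrary: W)
  case (Cons f fs)
  have sh: "(\<Sum>j<length (f # fs). (f # fs) ! j * g j) = f * g 0 + (\<Sum>j<length fs. fs ! j * g (Suc j))" for g
    by (simp add: sum.lessThan_Suc_shift del: sum.lessThan_Suc)
  show ?case (is "_ = ?R")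
  proof (intro Set.set_eqI iffI)
    fix x assume "x \<in> adjoin_list S W (f # fs)"
    then obtain w s g where x: "x = w + s * f + (\<Sum>j<length fs. fs ! j * g j)" "w \<in> W" "s \<in> S"
      "\<forall>j<length fs. g j \<in> S" by (auto simp: Cons adjoin_def)
    define g' where "g' j = (case j of 0 \<Rightarrow> s | Suc i \<Rightarrow> g i)" for j
    have "x = w + (\<Sum>j<length (f # fs). (f # fs) ! j * g' j)" unfolding sh x(1) by (simp add: g'_def mult.commute)
    moreover have "\<forall>j<length (f # fs). g' j \<in> S" using x by (auto simp: g'_def split: nat.split)
    ultimately show "x \<in> ?R" using x(2) by blast
  next
    fix x assume "x \<in> ?R"
    then obtain w g where x: "x = w + (\<Sum>j<length (f # fs). (f # fs) ! j * g j)" "w \<in> W"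
      "\<forall>j<length (f # fs). g j \<in> S" by blast
    then have "x = (w + g 0 * f) + (\<Sum>j<length fs. fs ! j * g (Suc j))"
      unfolding sh by (simp add: mult.commute add.assoc)
    moreover have "w + g 0 * f \<in> adjoin S W f" using x by (auto simp: adjoin_def)
    moreover have "\<forall>j<length fs. g (Suc j) \<in> S" using x(3) by simp
    ultimately show "x \<in> adjoin_list S W (f # fs)"
      unfolding adjoin_list.simps Cons by (intro CollectI exI[of _ "w + g 0 * f"] exI[of _ "\<lambda>j. g (Suc j)"]) simp
  qed
qed auto

lemma depth_ge_iff_list:
  "depth_ge S \<mm> W d \<longleftrightarrow> (\<exists>fs. length fs = d \<and> set fs \<subseteq> \<mm> \<and>
     (\<forall>i<length fs. regular_on S (adjoin_list S W (take i fs)) (fs ! i)))"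
proof (induction d arbitrary: W)
  case (Suc d)
  have *: "(\<forall>i<length (f # fs). regular_on S (adjoin_list S W (take i (f # fs))) ((f # fs) ! i)) \<longleftrightarrow>
     regular_on S W f \<and> (\<forall>i<length fs. regular_on S (adjoin_list S (adjoin S W f) (take i fs)) (fs ! i))" for f fs
    by (simp add: All_less_Suc2)
  show ?case
  proof
    assume "depth_ge S \<mm> W (Suc d)"
    then obtain f fs where "f \<in> \<mm>" "regular_on S W f" "length fs = d" "set fs \<subseteq> \<mm>"
      "\<forall>i<length fs. regular_on S (adjoin_list S (adjoin S W f) (take i fs)) (fs ! i)"
      using Suc by auto
    then show "\<exists>fs. length fs = Suc d \<and> set fs \<subseteq> \<mm> \<and>
        (\<forall>i<length fs. regular_on S (adjoin_list S W (take i fs)) (fs ! i))"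
      using *[of f fs] by (intro exI[of _ "f # fs"]) auto
  next
    assume "\<exists>fs. length fs = Suc d \<and> set fs \<subseteq> \<mm> \<and>
        (\<forall>i<length fs. regular_on S (adjoin_list S W (take i fs)) (fs ! i))"
    then obtain gs where gs: "length gs = Suc d" "set gs \<subseteq> \<mm>"
      "\<forall>i<length gs. regular_on S (adjoin_list S W (take i gs)) (gs ! i)" by blast
    then obtain f fs where fs: "gs = f # fs" by (cases gs) auto
    have "regular_on S W f" "\<forall>i<length fs. regular_on S (adjoin_list S (adjoin S W f) (take i fs)) (fs ! i)"
      using gs(3) unfolding fs * by blast+
    moreover have "length fs = d" "f \<in> \<mm>" "set fs \<subseteq> \<mm>" using gs(1,2) by (auto simp: fs)
    ultimately show "depth_ge S \<mm> W (Suc d)" unfolding depth_ge.simps Suc by blast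
  qed
qed auto

lemma one_notin_irrelevant: "1 \<notin> (irrelevant_ideal V :: 'k::field mpoly set)"
  using supported_monomial[of 0 "exps V - {0}", where ?'a = 'k] by (simp add: irrelevant_ideal_eq)

lemma finsum_ideal_module:
  assumes "finite A" "\<And>i. i \<in> A \<Longrightarrow> g i \<in> (polys V :: 'k::field mpoly set)"
  shows "(\<Oplus>\<^bsub>ideal_module (polys V)\<^esub>i\<in>A. g i) = (\<Sum>i\<in>A. g i)"
proof -
  interpret S: carrier_subring "polys V :: 'k mpoly set" by (rule carrier_subring_polys)
  interpret M: abelian_monoid "ideal_module (polys V :: 'k mpoly set)"
    by (rule abelian_monoidI) (auto simp: ideal_module_def S.add_closed S.zero_closed algebra_simps)
  show ?thesis
    using assms
  proof (induction A)
    case (insert i A)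
    then have "finsum (ideal_module (polys V)) g (insert i A) = g i \<oplus>\<^bsub>ideal_module (polys V)\<^esub> finsum (ideal_module (polys V)) g A"
      by (intro M.finsum_insert) (auto simp: ideal_module_def)
    then show ?case using insert by (simp add: ideal_module_def)
  qed (simp only: M.finsum_empty, simp add: ideal_module_def)
qed

lemma seq_submodule_ideal_module:
  assumes "set fs \<subseteq> (polys V :: 'k::field mpoly set)"
  shows "seq_submodule (ideal_module (polys V)) fs = adjoin_list (polys V) {0} fs"
proof -
  interpret S: carrier_subring "polys V :: 'k mpoly set" by (rule carrier_subring_polys)
  have fin: "(\<Oplus>\<^bsub>ideal_module (polys V)\<^esub>j\<in>{..<length fs}. fs ! j * m j) = (\<Sum>j<length fs. fs ! j * m j)"
    if "\<And>j. j < length fs \<Longrightarrow> m j \<in> polys V" for m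
    by (rule finsum_ideal_module) (use that assms nth_mem in \<open>auto intro!: S.mult_closed\<close>)
  show ?thesis
  proof (intro Set.set_eqI iffI)
    fix x assume "x \<in> seq_submodule (ideal_module (polys V)) fs"
    then obtain m where m: "x = (\<Oplus>\<^bsub>ideal_module (polys V)\<^esub>j\<in>{..<length fs}. fs ! j * m j)"
      "\<And>j. j < length fs \<Longrightarrow> m j \<in> polys V"
      unfolding seq_submodule_def by (auto simp: ideal_module_def)
    then show "x \<in> adjoin_list (polys V) {0} fs"
      unfolding adjoin_list_eq using fin[of m] by (intro CollectI exI[of _ 0] exI[of _ m]) simp
  next
    fix x assume "x \<in> adjoin_list (polys V) {0} fs"
    then obtain g where g: "x = (\<Sum>j<length fs. fs ! j * g j)" "\<forall>j<length fs. g j \<in> polys V"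
      unfolding adjoin_list_eq by auto
    then show "x \<in> seq_submodule (ideal_module (polys V)) fs"
      unfolding seq_submodule_def using fin[of g]
      by (intro CollectI exI[of _ g]) (auto simp: ideal_module_def)
  qed
qed

text \<open>Cosets translate regularity on the residue module into \<open>regular_on\<close> for the
  ideals generated by \<open>W\<close> and an initial part of the sequence. The supremum in
  \<open>depth\<close> can be compared with \<open>d\<close> because \<open>depth_ge\<close> is
  downward closed.\<close>

lemma depth_residue_module:
  assumes W: "is_ideal (polys V) (W :: 'k::field mpoly set)" "W \<subseteq> irrelevant_ideal V" and V: "finite V"
  shows "enat d \<le> depth V (residue_module V W) \<longleftrightarrow> depth_ge (polys V) (irrelevant_ideal V) W d"
proof -
  interpret S: noetherian_local "polys V :: 'k mpoly set" "irrelevant_ideal V"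
    by (rule noetherian_local_polys[OF V])
  let ?S = "polys V :: 'k mpoly set"
  interpret Q: ideal_quotient V ?S W by unfold_locales (rule S.is_ideal_carrier, rule W(1))
  let ?M = "quotient_module (ideal_module ?S) W"
  note car = Q.carrier_M and zero = Q.zero_M and add = Q.add_M and smult = Q.smult_M
  interpret M: abelian_monoid ?M
  proof (rule abelian_monoidI)
    show "\<zero>\<^bsub>?M\<^esub> \<in> carrier ?M" unfolding zero car using S.zero_closed by (rule imageI)
    fix x y assume "x \<in> carrier ?M" "y \<in> carrier ?M"
    then obtain a b where ab: "x = Q.cs a" "y = Q.cs b" "a \<in> ?S" "b \<in> ?S" unfolding car by blast
    show "x \<oplus>\<^bsub>?M\<^esub> y \<in> carrier ?M" unfolding car ab(1,2) add using S.add_closed[OF ab(3,4)] by (rule imageI)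
    show "x \<oplus>\<^bsub>?M\<^esub> y = y \<oplus>\<^bsub>?M\<^esub> x" unfolding ab(1,2) add by (simp add: add.commute)
    show "\<zero>\<^bsub>?M\<^esub> \<oplus>\<^bsub>?M\<^esub> x = x" unfolding zero ab(1) add by simp
    fix z assume "z \<in> carrier ?M"
    then obtain c where c: "z = Q.cs c" unfolding car by blast
    show "x \<oplus>\<^bsub>?M\<^esub> y \<oplus>\<^bsub>?M\<^esub> z = x \<oplus>\<^bsub>?M\<^esub> (y \<oplus>\<^bsub>?M\<^esub> z)" unfolding ab(1,2) c add by (simp add: add.assoc)
  qed
  have finsum: "(\<Oplus>\<^bsub>?M\<^esub>j\<in>A. Q.cs (g j)) = Q.cs (\<Sum>j\<in>A. g j)" if "finite A" "\<And>j. j \<in> A \<Longrightarrow> g j \<in> ?S" for A :: "nat set" and g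
    using that
  proof (induction A)
    case (insert i A)
    have "(\<lambda>j. Q.cs (g j)) \<in> A \<rightarrow> carrier ?M" "Q.cs (g i) \<in> carrier ?M" unfolding car using insert.prems by auto
    then have "(\<Oplus>\<^bsub>?M\<^esub>j\<in>insert i A. Q.cs (g j)) = Q.cs (g i) \<oplus>\<^bsub>?M\<^esub> (\<Oplus>\<^bsub>?M\<^esub>j\<in>A. Q.cs (g j))"
      using insert.hyps by (intro M.finsum_insert)
    then show ?case using insert add by simp
  qed (simp only: M.finsum_empty sum.empty zero)
  have seq: "seq_submodule ?M fs = Q.cs ` adjoin_list ?S W fs" if fs: "set fs \<subseteq> ?S" for fs
  proof (intro Set.set_eqI iffI)
    have fsj: "fs ! j \<in> ?S" if "j < length fs" for j using fs that nth_mem by blast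
    have sm: "(\<Oplus>\<^bsub>?M\<^esub>j\<in>{..<length fs}. fs ! j \<odot>\<^bsub>?M\<^esub> m j) = Q.cs (\<Sum>j<length fs. fs ! j * g j)"
      if m: "\<And>j. j < length fs \<Longrightarrow> m j = Q.cs (g j) \<and> g j \<in> ?S" for m g
    proof -
      have "(\<Oplus>\<^bsub>?M\<^esub>j\<in>{..<length fs}. fs ! j \<odot>\<^bsub>?M\<^esub> m j) = (\<Oplus>\<^bsub>?M\<^esub>j\<in>{..<length fs}. Q.cs (fs ! j * g j))"
      proof (rule M.finsum_cong')
        show "(\<lambda>j. Q.cs (fs ! j * g j)) \<in> {..<length fs} \<rightarrow> carrier ?M"
          unfolding car using m fsj S.mult_closed by auto
      qed (use m fsj smult in auto)
      also have "\<dots> = Q.cs (\<Sum>j<length fs. fs ! j * g j)"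
        using m fsj S.mult_closed by (intro finsum) auto
      finally show ?thesis .
    qed
    fix X
    {
      assume "X \<in> seq_submodule ?M fs"
      then obtain m where m: "X = (\<Oplus>\<^bsub>?M\<^esub>j\<in>{..<length fs}. fs ! j \<odot>\<^bsub>?M\<^esub> m j)" "m \<in> {..<length fs} \<rightarrow> carrier ?M"
        unfolding seq_submodule_def by blast
      have "\<forall>j\<in>{..<length fs}. \<exists>g. m j = Q.cs g \<and> g \<in> ?S" using m(2) unfolding car by auto
      from bchoice[OF this] obtain g where g: "\<And>j. j < length fs \<Longrightarrow> m j = Q.cs (g j) \<and> g j \<in> ?S" by auto
      have "0 + (\<Sum>j<length fs. fs ! j * g j) \<in> adjoin_list ?S W fs"
        unfolding adjoin_list_eq using g is_idealD(2)[OF W(1)] by blast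
      moreover have "X = Q.cs (0 + (\<Sum>j<length fs. fs ! j * g j))" unfolding m(1) add_0 by (rule sm[OF g])
      ultimately show "X \<in> Q.cs ` adjoin_list ?S W fs" by (rule image_eqI[rotated])
    next
      assume "X \<in> Q.cs ` adjoin_list ?S W fs"
      then obtain w g where wg: "X = Q.cs (w + (\<Sum>j<length fs. fs ! j * g j))" "w \<in> W" "\<forall>j<length fs. g j \<in> ?S"
        unfolding adjoin_list_eq by blast
      have "X = Q.cs (\<Sum>j<length fs. fs ! j * g j)" unfolding wg(1) Q.cs_eq_iff using wg(2) by simp
      also have "\<dots> = (\<Oplus>\<^bsub>?M\<^esub>j\<in>{..<length fs}. fs ! j \<odot>\<^bsub>?M\<^esub> Q.cs (g j))" using wg(3) by (intro sm[symmetric]) simp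
      finally show "X \<in> seq_submodule ?M fs"
        unfolding seq_submodule_def using wg(3) by (intro CollectI exI[of _ "\<lambda>j. Q.cs (g j)"]) (auto simp: car)
    }
  qed
  have cs_mem: "Q.cs x \<in> Q.cs ` W' \<longleftrightarrow> x \<in> W'" if "is_ideal ?S W'" "W \<subseteq> W'" for x W'
  proof
    assume "Q.cs x \<in> Q.cs ` W'"
    then obtain y where "y \<in> W'" "x - y \<in> W" using Q.cs_eq_iff by blast
    then have "(x - y) + y \<in> W'" using that is_idealD(3)[OF that(1)] by blast
    then show "x \<in> W'" by simp
  qed (rule imageI)
  have m: "set fs \<subseteq> irrelevant_ideal V \<Longrightarrow> set fs \<subseteq> ?S" for fs using S.mmS by auto
  have rs: "regular_sequence (poly_ring V) ?M fs \<longleftrightarrow>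
      (\<forall>i<length fs. regular_on ?S (adjoin_list ?S W (take i fs)) (fs ! i))"
    if fsm: "set fs \<subseteq> irrelevant_ideal V" for fs
  proof -
    note fs = m[OF fsm]
    have tk: "set (take i fs) \<subseteq> ?S" for i using fs set_take_subset by (rule order_trans[rotated])
    have Iid: "is_ideal ?S (adjoin_list ?S W (take i fs))" for i
      using S.is_ideal_adjoin_list[OF W(1) tk] .
    \<comment> \<open>Both \<open>W\<close> and the sequence lie in the irrelevant ideal, so 1 is
      not in the ideal they generate.\<close>
    have "seq_submodule ?M fs \<noteq> carrier ?M"
    proof
      assume "seq_submodule ?M fs = carrier ?M"
      then have "Q.cs 1 \<in> Q.cs ` adjoin_list ?S W fs" unfolding seq[OF fs] car using S.one_closed by simp
      then have "1 \<in> adjoin_list ?S W fs"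
        using cs_mem[OF S.is_ideal_adjoin_list[OF W(1) fs] S.adjoin_list_superset] by blast
      then show False using S.adjoin_list_subset[OF S.mm W(2) fsm] one_notin_irrelevant by blast
    qed
    moreover have "(\<forall>x\<in>carrier ?M. fs ! i \<odot>\<^bsub>?M\<^esub> x \<in> seq_submodule ?M (take i fs) \<longrightarrow> x \<in> seq_submodule ?M (take i fs)) \<longleftrightarrow>
        regular_on ?S (adjoin_list ?S W (take i fs)) (fs ! i)" if "i < length fs" for i
    proof -
      have "fs ! i \<in> ?S" using fs nth_mem[OF that] by blast
      then show ?thesis
        unfolding seq[OF tk] car regular_on_def
        by (simp add: smult cs_mem[OF Iid S.adjoin_list_superset])
    qed
    ultimately show ?thesis unfolding regular_sequence_def using fs by simp
  qed
  have depth: "depth V ?M = Sup {enat e | e. depth_ge ?S (irrelevant_ideal V) W e}"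
    unfolding depth_def depth_ge_iff_list using rs by (intro arg_cong[of _ _ Sup]) blast
  show ?thesis
    unfolding poly_ring_simps
  proof
    assume "depth_ge ?S (irrelevant_ideal V) W d"
    then show "enat d \<le> depth V ?M" unfolding depth by (intro Sup_upper) blast
  next
    assume le: "enat d \<le> depth V ?M"
    show "depth_ge ?S (irrelevant_ideal V) W d"
    proof (rule ccontr)
      assume neg: "\<not> depth_ge ?S (irrelevant_ideal V) W d"
      then obtain d' where d': "d = Suc d'" by (cases d) auto
      have "depth V ?M \<le> enat d'"
        unfolding depth
      proof (rule Sup_least)
        fix x assume "x \<in> {enat e | e. depth_ge ?S (irrelevant_ideal V) W e}"
        then obtain e where e: "x = enat e" "depth_ge ?S (irrelevant_ideal V) W e" by blast
        have "\<not> d \<le> e" using S.depth_ge_mono[OF e(2)] neg by blast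
        then show "x \<le> enat d'" using e(1) d' by simp
      qed
      then have "enat d \<le> enat d'" using le by (rule order_trans[rotated])
      then show False using d' by simp
    qed
  qed
qed

section \<open>Merging two variables\<close>

text \<open>Dividing out a difference of two variables is realised as a substitution onto a smaller
  polynomial ring. Depth modulo \<open>W\<close> agrees with depth modulo the preimage of
  \<open>W\<close>: regularity and the adjoining of elements correspond, and elements of
  \<open>\<mm>'\<close> lift to \<open>\<mm>\<close>.\<close>

locale ring_surjection =
  fixes S S' :: "'a::comm_ring_1 set" and \<mm> \<mm>' :: "'a set" and \<phi> :: "'a \<Rightarrow> 'a"
  assumes S: "carrier_subring S" and S': "carrier_subring S'"
    and \<phi>_add: "x \<in> S \<Longrightarrow> y \<in> S \<Longrightarrow> \<phi> (x + y) = \<phi> x + \<phi> y"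
    and \<phi>_mult: "x \<in> S \<Longrightarrow> y \<in> S \<Longrightarrow> \<phi> (x * y) = \<phi> x * \<phi> y"
    and \<phi>_surj: "\<phi> ` S = S'" and \<phi>_mm: "\<phi> ` \<mm> = \<mm>'" and mmS: "\<mm> \<subseteq> S"
begin

definition preimage :: "'a set \<Rightarrow> 'a set" where "preimage W = {x \<in> S. \<phi> x \<in> W}"

lemma \<phi>_in: "x \<in> S \<Longrightarrow> \<phi> x \<in> S'" using \<phi>_surj by blast

lemma preimage_adjoin:
  assumes f: "f \<in> S"
  shows "preimage (adjoin S' W (\<phi> f)) = adjoin S (preimage W) f"
proof (intro Set.set_eqI iffI)
  fix x
  {
    assume "x \<in> preimage (adjoin S' W (\<phi> f))"
    then obtain w s' where ws: "x \<in> S" "\<phi> x = w + s' * \<phi> f" "w \<in> W" "s' \<in> S'"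
      by (auto simp: preimage_def adjoin_def)
    then obtain s where s: "s \<in> S" "\<phi> s = s'" using \<phi>_surj by blast
    have sf: "s * f \<in> S" using s(1) f by (rule carrier_subring.mult_closed[OF S])
    then have d: "x - s * f \<in> S" using ws(1) carrier_subring.diff_closed[OF S] by blast
    have "\<phi> x = \<phi> (x - s * f) + \<phi> (s * f)" using \<phi>_add[OF d sf] by simp
    then have "\<phi> (x - s * f) = w" using ws(2) \<phi>_mult[OF s(1) f] s(2) by simp
    then have "x - s * f \<in> preimage W" using d ws(3) by (simp add: preimage_def)
    moreover have "x = (x - s * f) + s * f" by simp
    ultimately show "x \<in> adjoin S (preimage W) f" unfolding adjoin_def using s(1) by blast
  next
    assume "x \<in> adjoin S (preimage W) f"
    then obtain w s where ws: "x = w + s * f" "w \<in> S" "\<phi> w \<in> W" "s \<in> S"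
      by (auto simp: preimage_def adjoin_def)
    have sf: "s * f \<in> S" using ws(4) f by (rule carrier_subring.mult_closed[OF S])
    then have "x \<in> S" unfolding ws(1) using ws(2) carrier_subring.add_closed[OF S] by blast
    moreover have "\<phi> x = \<phi> w + \<phi> s * \<phi> f" unfolding ws(1) using \<phi>_add[OF ws(2) sf] \<phi>_mult[OF ws(4) f] by simp
    ultimately show "x \<in> preimage (adjoin S' W (\<phi> f))"
      unfolding preimage_def adjoin_def using ws(3) \<phi>_in[OF ws(4)] by blast
  }
qed

lemma regular_on_preimage:
  assumes f: "f \<in> S"
  shows "regular_on S (preimage W) f \<longleftrightarrow> regular_on S' W (\<phi> f)"
proof
  assume L: "regular_on S (preimage W) f"
  show "regular_on S' W (\<phi> f)"
    unfolding regular_on_def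
  proof (intro ballI impI)
    fix y assume y: "y \<in> S'" "\<phi> f * y \<in> W"
    then obtain x where x: "x \<in> S" "y = \<phi> x" using \<phi>_surj by blast
    have "f * x \<in> preimage W"
      using y(2) x f \<phi>_mult[OF f x(1)] carrier_subring.mult_closed[OF S f x(1)] by (simp add: preimage_def)
    then show "y \<in> W" using L x unfolding regular_on_def by (auto simp: preimage_def)
  qed
next
  assume R: "regular_on S' W (\<phi> f)"
  show "regular_on S (preimage W) f"
    unfolding regular_on_def
  proof (intro ballI impI)
    fix x assume x: "x \<in> S" "f * x \<in> preimage W"
    then have "\<phi> f * \<phi> x \<in> W" using \<phi>_mult[OF f x(1)] by (simp add: preimage_def)
    then show "x \<in> preimage W" using R \<phi>_in[OF x(1)] x(1) unfolding regular_on_def by (simp add: preimage_def)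
  qed
qed

lemma depth_ge_preimage: "depth_ge S \<mm> (preimage W) d \<longleftrightarrow> depth_ge S' \<mm>' W d"
proof (induction d arbitrary: W)
  case (Suc d)
  have "depth_ge S \<mm> (preimage W) (Suc d) \<longleftrightarrow>
      (\<exists>f\<in>\<mm>. regular_on S' W (\<phi> f) \<and> depth_ge S' \<mm>' (adjoin S' W (\<phi> f)) d)"
    unfolding depth_ge.simps using mmS
    by (intro bex_cong refl) (simp add: subset_iff regular_on_preimage flip: preimage_adjoin Suc)
  also have "\<dots> \<longleftrightarrow> depth_ge S' \<mm>' W (Suc d)" unfolding depth_ge.simps \<phi>_mm[symmetric] by blast
  finally show ?case .
qed simp

end

section \<open>Substitution of the variable \<open>x_a\<close> for \<open>x_b\<close>\<close>

definition merge :: "nat \<Rightarrow> nat \<Rightarrow> expo \<Rightarrow> expo" where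
  "merge a b t = (t - single b (lookup t b)) + single a (lookup t b)"

definition merge_poly :: "nat \<Rightarrow> nat \<Rightarrow> 'k::field mpoly \<Rightarrow> 'k mpoly" where
  "merge_poly a b p = (\<Sum>t\<in>keys p. single (merge a b t) (lookup p t))"

lemma lookup_merge:
  "a \<noteq> b \<Longrightarrow> lookup (merge a b t) v = (if v = b then 0 else if v = a then lookup t a + lookup t b else lookup t v)"
  by (auto simp: merge_def lookup_add lookup_minus lookup_single when_def)

lemma merge_add: "a \<noteq> b \<Longrightarrow> merge a b (t + u) = merge a b t + merge a b u"
  by (rule poly_mapping_eqI) (simp add: lookup_merge lookup_add)

lemma merge_exps: "a \<noteq> b \<Longrightarrow> a \<in> V \<Longrightarrow> t \<in> exps V \<Longrightarrow> merge a b t \<in> exps (V - {b})"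
  by (auto simp: exps_iff lookup_merge)

lemma merge_id: "a \<noteq> b \<Longrightarrow> t \<in> exps (V - {b}) \<Longrightarrow> merge a b t = t"
  by (rule poly_mapping_eqI) (auto simp: lookup_merge exps_iff)

lemma merge_eq_0: "a \<noteq> b \<Longrightarrow> merge a b t = 0 \<longleftrightarrow> t = 0"
proof
  assume ab: "a \<noteq> b" and m: "merge a b t = 0"
  show "t = 0"
  proof (rule poly_mapping_eqI)
    fix v
    have "lookup (merge a b t) v = 0" "lookup (merge a b t) a = 0" using m by simp_all
    then show "lookup t v = lookup 0 v" using ab by (auto simp: lookup_merge split: if_splits)
  qed
qed (auto intro!: poly_mapping_eqI simp: lookup_merge)

lemma merge_poly_superset:
  assumes "finite A" "keys p \<subseteq> A"
  shows "merge_poly a b p = (\<Sum>t\<in>A. single (merge a b t) (lookup p t))"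
  unfolding merge_poly_def using assms by (intro sum.mono_neutral_left) (auto simp: in_keys_iff)

lemma merge_poly_add: "merge_poly a b (p + q) = merge_poly a b p + merge_poly a b q"
proof -
  let ?A = "keys p \<union> keys q"
  have "keys (p + q) \<subseteq> ?A" by (rule keys_add)
  then show ?thesis
    using merge_poly_superset[of ?A "p + q" a b] merge_poly_superset[of ?A p a b] merge_poly_superset[of ?A q a b]
    by (simp add: lookup_add single_add sum.distrib)
qed

lemma merge_poly_0 [simp]: "merge_poly a b 0 = 0"
  by (simp add: merge_poly_def)

lemma merge_poly_single [simp]: "merge_poly a b (single t c) = single (merge a b t) c"
  by (cases "c = 0") (simp_all add: merge_poly_def)

lemma merge_poly_sum: "merge_poly a b (\<Sum>i\<in>A. g i) = (\<Sum>i\<in>A. merge_poly a b (g i))"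
  by (induction A rule: infinite_finite_induct) (simp_all add: merge_poly_add)

lemma merge_poly_mult:
  assumes "a \<noteq> b"
  shows "merge_poly a b (p * q) = merge_poly a b p * merge_poly a b q"
proof -
  have "p * q = (\<Sum>t\<in>keys p. \<Sum>u\<in>keys q. single t (lookup p t) * single u (lookup q u))"
    using mpoly_expand[of p] mpoly_expand[of q] by (metis (mono_tags, lifting) sum.cong sum_product)
  then have "merge_poly a b (p * q) =
      (\<Sum>t\<in>keys p. \<Sum>u\<in>keys q. single (merge a b t) (lookup p t) * single (merge a b u) (lookup q u))"
    by (simp add: merge_poly_sum mult_single merge_add[OF assms])
  then show ?thesis by (simp add: merge_poly_def sum_product)
qed

lemma merge_poly_id: "a \<noteq> b \<Longrightarrow> p \<in> polys (V - {b}) \<Longrightarrow> merge_poly a b p = p"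
proof -
  assume *: "a \<noteq> b" "p \<in> polys (V - {b})"
  have "merge_poly a b p = (\<Sum>t\<in>keys p. single t (lookup p t))"
    unfolding merge_poly_def
  proof (intro sum.cong refl)
    fix t assume "t \<in> keys p"
    then have "t \<in> exps (V - {b})" using *(2) unfolding polys_eq supported_def by blast
    then show "single (merge a b t) (lookup p t) = single t (lookup p t)" using merge_id[OF *(1)] by simp
  qed
  then show ?thesis using mpoly_expand[of p] by simp
qed

lemma merge_poly_supported:
  "p \<in> supported E \<Longrightarrow> merge_poly a b p \<in> supported (merge a b ` E)"
  unfolding merge_poly_def by (intro supported_sum) (auto simp: supported_def)

lemma merge_poly_polys:
  assumes "a \<noteq> b" "a \<in> V" "p \<in> polys V"
  shows "merge_poly a b p \<in> polys (V - {b})"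
proof -
  have "merge a b ` exps V \<subseteq> exps (V - {b})" using merge_exps[OF assms(1,2)] by blast
  then show ?thesis using merge_poly_supported[OF assms(3)[unfolded polys_eq]] supported_mono
    unfolding polys_eq by blast
qed

abbreviation var :: "nat \<Rightarrow> 'k::field mpoly" where "var v \<equiv> monomial (single v 1)"

lemma var_polys: "v \<in> V \<Longrightarrow> var v \<in> polys V" by (simp add: polys_eq)

lemma var_irrelevant: "v \<in> V \<Longrightarrow> var v \<in> irrelevant_ideal V"
proof -
  assume "v \<in> V"
  moreover have "single v 1 \<noteq> (0 :: expo)" by (metis lookup_single_eq lookup_zero zero_neq_one)
  ultimately show ?thesis unfolding irrelevant_ideal_eq by simp
qed

lemma ring_surjection_merge:
  assumes ab: "a \<noteq> b" "a \<in> V" "b \<in> V"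
  shows "ring_surjection (polys V) (polys (V - {b})) (irrelevant_ideal V) (irrelevant_ideal (V - {b}))
    (merge_poly a b :: 'k::field mpoly \<Rightarrow> _)"
proof (rule ring_surjection.intro)
  show "merge_poly a b ` polys V = (polys (V - {b}) :: 'k mpoly set)"
  proof
    show "merge_poly a b ` polys V \<subseteq> (polys (V - {b}) :: 'k mpoly set)"
      using merge_poly_polys[OF ab(1,2)] by blast
    show "(polys (V - {b}) :: 'k mpoly set) \<subseteq> merge_poly a b ` polys V"
    proof
      fix p :: "'k mpoly" assume p: "p \<in> polys (V - {b})"
      moreover have "polys (V - {b}) \<subseteq> (polys V :: 'k mpoly set)"
        unfolding polys_eq by (intro supported_mono exps_mono) blast
      ultimately show "p \<in> merge_poly a b ` polys V" using merge_poly_id[OF ab(1) p] by (metis image_eqI subsetD)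
    qed
  qed
  show "merge_poly a b ` irrelevant_ideal V = (irrelevant_ideal (V - {b}) :: 'k mpoly set)"
  proof
    have "merge a b ` (exps V - {0}) \<subseteq> exps (V - {b}) - {0}"
      by (intro image_subsetI DiffI) (simp_all add: merge_exps[OF ab(1,2)] merge_eq_0[OF ab(1)])
    from supported_mono[OF this]
    show "merge_poly a b ` irrelevant_ideal V \<subseteq> (irrelevant_ideal (V - {b}) :: 'k mpoly set)"
      unfolding irrelevant_ideal_eq by (intro image_subsetI) (rule subsetD, auto intro: merge_poly_supported)
    show "(irrelevant_ideal (V - {b}) :: 'k mpoly set) \<subseteq> merge_poly a b ` irrelevant_ideal V"
    proof
      fix p :: "'k mpoly" assume p: "p \<in> irrelevant_ideal (V - {b})"
      have "exps (V - {b}) - {0} \<subseteq> exps V - {0}" using exps_mono[of "V - {b}" V] by blast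
      then have pV: "p \<in> irrelevant_ideal V"
        using p supported_mono unfolding irrelevant_ideal_eq by blast
      have "p \<in> polys (V - {b})" using p supported_mono[of "exps (V - {b}) - {0}" "exps (V - {b})"]
        unfolding irrelevant_ideal_eq polys_eq by blast
      then show "p \<in> merge_poly a b ` irrelevant_ideal V" using merge_poly_id[OF ab(1)] pV by (metis image_eqI)
    qed
  qed
  show "irrelevant_ideal V \<subseteq> (polys V :: 'k mpoly set)"
    unfolding irrelevant_ideal_eq polys_eq by (rule supported_mono) blast
qed (simp_all add: carrier_subring_polys merge_poly_add merge_poly_mult[OF ab(1)])

text \<open>For a monomial this is divisibility of \<open>x_a^n - x_b^n\<close> by
  \<open>x_a - x_b\<close>, multiplied by the part of the monomial without \<open>x_b\<close>; the
  general case follows by linearity.\<close>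

lemma diff_merge_in_adjoin:
  assumes ab: "a \<noteq> b" "a \<in> V" "b \<in> V" and W: "is_ideal (polys V) W" and p: "p \<in> polys V"
  shows "p - merge_poly a b p \<in> adjoin (polys V) W (var a - var b :: 'k::field mpoly)"
proof -
  interpret S: carrier_subring "polys V :: 'k mpoly set" by (rule carrier_subring_polys)
  let ?f = "var a - var b :: 'k mpoly"
  have fS: "?f \<in> polys V" using var_polys ab by (intro S.diff_closed) auto
  have I: "is_ideal (polys V) (adjoin (polys V) W ?f)" by (rule S.is_ideal_adjoin[OF W fS])
  have pow: "monomial (single a n) - monomial (single b n) \<in> adjoin (polys V) W ?f" for n
  proof (induction n)
    case 0 show ?case using is_idealD(2)[OF I] by simp
  next
    case (Suc n)
    have "monomial (single a (Suc n)) - monomial (single b (Suc n)) =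
        var a * (monomial (single a n) - monomial (single b n)) + monomial (single b n) * ?f"
      using single_add[of a 1 n] single_add[of b 1 n] by (simp add: monomial_add algebra_simps)
    moreover have "monomial (single b n) \<in> (polys V :: 'k mpoly set)" using ab by (simp add: polys_eq)
    ultimately show ?case
      using is_idealD(3)[OF I is_idealD(4)[OF I var_polys[OF ab(2)] Suc] is_idealD(4)[OF I _ S.adjoin_gen[OF W]]]
      by simp
  qed
  have mono: "monomial t - monomial (merge a b t) \<in> adjoin (polys V) W ?f" if t: "t \<in> exps V" for t
  proof -
    define w where "w = t - single b (lookup t b)"
    have "t = w + single b (lookup t b)" unfolding w_def
      by (intro divs_minus(2)[symmetric]) (simp add: divs_def lookup_single when_def)
    then have eq: "monomial t - monomial (merge a b t) =
        - monomial w * (monomial (single a (lookup t b)) - monomial (single b (lookup t b)) :: 'k mpoly)"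
      by (metis (no_types, lifting) merge_def minus_diff_eq minus_mult_left monomial_add right_diff_distrib w_def)
    have "- monomial w \<in> (polys V :: 'k mpoly set)"
      using minus_exps[OF t] by (intro S.uminus_closed) (simp add: polys_eq w_def)
    then show ?thesis unfolding eq by (rule is_idealD(4)[OF I _ pow])
  qed
  have "p - merge_poly a b p = (\<Sum>t\<in>keys p. single t (lookup p t)) - (\<Sum>t\<in>keys p. single (merge a b t) (lookup p t))"
    using mpoly_expand[of p] by (simp add: merge_poly_def)
  also have "\<dots> = (\<Sum>t\<in>keys p. single 0 (lookup p t) * (monomial t - monomial (merge a b t)))"
    unfolding right_diff_distrib sum_subtractf by (simp flip: single_eq_monomial)
  also have "\<dots> \<in> adjoin (polys V) W ?f"
  proof (rule S.ideal_sum[OF I])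
    fix t assume "t \<in> keys p"
    then have "t \<in> exps V" using p unfolding polys_eq supported_def by blast
    then show "single 0 (lookup p t) * (monomial t - monomial (merge a b t)) \<in> adjoin (polys V) W ?f"
      using mono by (intro is_idealD(4)[OF I]) (auto simp: polys_eq)
  qed
  finally show ?thesis .
qed

text \<open>The substitution kills \<open>x_a - x_b\<close>. Conversely, \<open>p\<close> is
  congruent to its image modulo \<open>x_a - x_b\<close>, and each monomial of the image is
  congruent to the monomial in \<open>E\<close> from which it arises.\<close>

lemma adjoin_diff_eq_preimage:
  assumes ab: "a \<noteq> b" "a \<in> V" "b \<in> V" and E: "upset V E"
  shows "adjoin (polys V) (supported E) (var a - var b :: 'k::field mpoly) =
    {p \<in> polys V. merge_poly a b p \<in> supported (merge a b ` E)}"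
proof (intro Set.set_eqI iffI)
  interpret S: carrier_subring "polys V :: 'k mpoly set" by (rule carrier_subring_polys)
  let ?f = "var a - var b :: 'k mpoly"
  note W = is_ideal_supported[OF E, where ?'a = 'k]
  have fS: "?f \<in> polys V" using var_polys ab by (intro S.diff_closed) auto
  have I: "is_ideal (polys V) (adjoin (polys V) (supported E) ?f)" by (rule S.is_ideal_adjoin[OF W fS])
  have f0: "merge_poly a b ?f = 0"
  proof -
    have "merge_poly a b (var a) = (var a :: 'k mpoly)" "merge_poly a b (var b) = (var a :: 'k mpoly)"
      using ab(1) by (simp_all add: monomial_def merge_def lookup_single)
    then show ?thesis using merge_poly_add[of a b ?f "var b"] by simp
  qed
  fix p :: "'k mpoly"
  {
    assume "p \<in> adjoin (polys V) (supported E) ?f"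
    then obtain w s where ws: "p = w + s * ?f" "w \<in> supported E" "s \<in> polys V" unfolding adjoin_def by blast
    have "p \<in> polys V" unfolding ws(1) using ws(2,3) fS is_idealD(1)[OF W] by (intro S.add_closed S.mult_closed) auto
    moreover have "merge_poly a b p = merge_poly a b w"
      unfolding ws(1) merge_poly_add merge_poly_mult[OF ab(1)] f0 by simp
    ultimately show "p \<in> {p \<in> polys V. merge_poly a b p \<in> supported (merge a b ` E)}"
      using merge_poly_supported[OF ws(2)] by simp
  next
    assume "p \<in> {p \<in> polys V. merge_poly a b p \<in> supported (merge a b ` E)}"
    then have p: "p \<in> polys V" "merge_poly a b p \<in> supported (merge a b ` E)" by auto
    have "merge_poly a b p \<in> adjoin (polys V) (supported E) ?f"
    proof (rule mpoly_in_ideal[OF I])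
      show "merge_poly a b p \<in> polys V"
        using merge_poly_polys[OF ab(1,2) p(1)] supported_mono[OF exps_mono[of "V - {b}" V]] unfolding polys_eq by blast
      fix t assume "t \<in> keys (merge_poly a b p)"
      then obtain u where u: "t = merge a b u" "u \<in> E" using p(2) unfolding supported_def by blast
      have uV: "monomial u \<in> (polys V :: 'k mpoly set)" using upsetD[OF E u(2)] by (simp add: polys_eq)
      have "merge_poly a b (monomial u) = (monomial t :: 'k mpoly)" by (simp add: monomial_def u(1))
      then have d: "monomial u - monomial t \<in> adjoin (polys V) (supported E) ?f"
        using diff_merge_in_adjoin[OF ab W uV] by (simp only:)
      have "monomial u \<in> adjoin (polys V) (supported E) ?f"
        by (rule subsetD[OF S.adjoin_superset]) (simp add: u(2))
      from S.ideal_diff[OF I this d]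
      show "monomial t \<in> adjoin (polys V) (supported E) ?f" by simp
    qed
    then have "(p - merge_poly a b p) + merge_poly a b p \<in> adjoin (polys V) (supported E) ?f"
      using diff_merge_in_adjoin[OF ab W p(1)] by (intro is_idealD(3)[OF I])
    then show "p \<in> adjoin (polys V) (supported E) ?f" by simp
  }
qed

text \<open>
  Along \<open>t, t x\<^sub>a / x\<^sub>b, t x\<^sub>a\<^sup>2 / x\<^sub>b\<^sup>2, \<dots>\<close> the coefficient of \<open>h\<close> does not change as long as the exponents
  \<open>t x\<^sub>a, t x\<^sub>a\<^sup>2, \<dots>\<close> avoid \<open>E\<close>; this cannot continue once \<open>x\<^sub>b\<close> is used up.
\<close>

lemma regular_diff_aux:
  assumes "a \<noteq> b" and E: "upset V E" and ab: "a \<in> V" "b \<in> V"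
    and h: "\<And>s. s \<in> exps V - E \<Longrightarrow> lookup ((var a - var b) * h) s = 0"
    and "t \<in> exps V" "lookup h t \<noteq> 0"
  shows "\<exists>p. t + single a p \<in> E"
  using assms(6,7)
proof (induction "lookup t b" arbitrary: t rule: less_induct)
  case less
  show ?case
  proof (cases "t + single a 1 \<in> E")
    case True then show ?thesis by blast
  next
    case False
    then have z: "lookup ((var a - var b) * h) (t + single a 1) = 0"
      using h less.prems ab by simp
    have "lookup (var a * h) (t + single a 1) = lookup h t"
      by (simp add: add.commute[of t])
    then have eq: "lookup (var b * h) (t + single a 1) = lookup h t"
      using z by (simp add: left_diff_distrib lookup_minus)
    then have bd: "single b 1 divs t + single a 1" using less.prems(2) by (auto simp: lookup_monomial_mult split: if_splits)
    define u where "u = (t + single a 1) - single b 1"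
    have u: "u + single b 1 = t + single a 1" unfolding u_def by (rule divs_minus(2)[OF bd])
    have "lookup (u + single b 1) b = lookup (t + single a 1) b" unfolding u ..
    then have lt: "lookup u b < lookup t b" using assms(1) by (simp add: lookup_add lookup_single)
    have "lookup h u \<noteq> 0" using eq less.prems(2) bd by (simp add: lookup_monomial_mult u_def)
    moreover have "u \<in> exps V" unfolding u_def using less.prems(1) ab by (intro minus_exps) simp
    ultimately obtain p where p: "u + single a p \<in> E" using less.hyps[OF lt] by blast
    have "u + single a p + single b 1 \<in> E" using p E ab unfolding upset_def by simp
    moreover have "u + single a p + single b 1 = (u + single b 1) + single a p" by (simp add: ac_simps)
    moreover have "\<dots> = t + single a (Suc p)" unfolding u by (simp add: add.assoc flip: single_add)
    ultimately show ?thesis by metis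
  qed
qed

text \<open>The condition says that \<open>E\<close> is the intersection of its saturations in
  \<open>x_a\<close> and in \<open>x_b\<close>. By \<open>regular_diff_aux\<close>, used for both
  orders of the variables, every exponent of \<open>h\<close> lies in both saturations.\<close>

lemma regular_diff:
  assumes ab: "a \<noteq> b" "a \<in> V" "b \<in> V" and E: "upset V E"
    and cond: "\<And>w p q. w \<in> exps V \<Longrightarrow> w + single a p \<in> E \<Longrightarrow> w + single b q \<in> E \<Longrightarrow> w \<in> E"
  shows "regular_on (polys V) (supported E) (var a - var b :: 'k::field mpoly)"
  unfolding regular_on_def
proof (intro ballI impI)
  fix h :: "'k mpoly" assume h: "h \<in> polys V" "(var a - var b) * h \<in> supported E"
  show "h \<in> supported E"
    unfolding supported_def
  proof (intro CollectI subsetI)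
    fix t assume t: "t \<in> keys h"
    then have tV: "t \<in> exps V" and ht: "lookup h t \<noteq> 0"
      using h(1) by (auto simp: polys_eq supported_def in_keys_iff)
    have z: "lookup ((var a - var b) * h) s = 0" if "s \<in> exps V - E" for s
      using h(2) that by (auto simp: supported_def in_keys_iff)
    have "(var b - var a) * h = - ((var a - var b) * h)" by (simp add: algebra_simps)
    then have z': "lookup ((var b - var a) * h) s = 0" if "s \<in> exps V - E" for s
      using z[OF that] by simp
    obtain p where "t + single a p \<in> E" using regular_diff_aux[OF ab(1) E ab(2,3) z tV ht] by blast
    moreover obtain q where "t + single b q \<in> E"
      using regular_diff_aux[OF ab(1)[symmetric] E ab(3,2) z' tV ht] by blast
    ultimately show "t \<in> E" using cond[OF tV] by blast
  qed
qed

lemma depth_ge_merge: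
  assumes ab: "a \<noteq> b" "a \<in> V" "b \<in> V" and V: "finite V" and E: "upset V E"
    and cond: "\<And>w p q. w \<in> exps V \<Longrightarrow> w + single a p \<in> E \<Longrightarrow> w + single b q \<in> E \<Longrightarrow> w \<in> E"
  shows "depth_ge (polys V) (irrelevant_ideal V) (supported E :: 'k::field mpoly set) (Suc d) \<longleftrightarrow>
    depth_ge (polys (V - {b})) (irrelevant_ideal (V - {b})) (supported (merge a b ` E) :: 'k mpoly set) d"
proof -
  interpret S: noetherian_local "polys V :: 'k mpoly set" "irrelevant_ideal V"
    by (rule noetherian_local_polys[OF V])
  interpret \<phi>: ring_surjection "polys V :: 'k mpoly set" "polys (V - {b})" "irrelevant_ideal V"
    "irrelevant_ideal (V - {b})" "merge_poly a b" by (rule ring_surjection_merge[OF ab])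
  have f: "var a - var b \<in> (irrelevant_ideal V :: 'k mpoly set)"
    using var_irrelevant ab by (intro S.ideal_diff[OF S.mm]) auto
  have "depth_ge (polys V) (irrelevant_ideal V) (supported E :: 'k mpoly set) (Suc d) \<longleftrightarrow>
      depth_ge (polys V) (irrelevant_ideal V) (adjoin (polys V) (supported E) (var a - var b :: 'k mpoly)) d"
    by (rule S.depth_ge_adjoin[OF is_ideal_supported[OF E] f regular_diff[OF ab E cond]])
  also have "adjoin (polys V) (supported E) (var a - var b :: 'k mpoly) = \<phi>.preimage (supported (merge a b ` E))"
    unfolding adjoin_diff_eq_preimage[OF ab E] \<phi>.preimage_def ..
  finally show ?thesis unfolding \<phi>.depth_ge_preimage .
qed

section \<open>Depth of families of ideals\<close>

text \<open>The coefficient in \<open>K[X]\<close> of the monomial of \<open>v\<close>, when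
  \<open>h\<close> is read as a polynomial in the variables \<open>Y\<close> over
  \<open>K[X]\<close>.\<close>

definition coef :: "nat set \<Rightarrow> expo \<Rightarrow> 'k::field mpoly \<Rightarrow> 'k mpoly" where
  "coef X v h = restr (exps X) (Poly_Mapping.map_key (\<lambda>t. t + v) h)"

lemma lookup_coef: "lookup (coef X v h) t = (if t \<in> exps X then lookup h (t + v) else 0)"
  by (simp add: coef_def lookup_restr map_key.rep_eq inj_on_def)

lemma coef_polys: "coef X v h \<in> polys X"
  by (simp add: coef_def polys_eq restr_supported)

lemma coef_add: "coef X v (h + h') = coef X v h + coef X v h'"
  by (rule poly_mapping_eqI) (simp add: lookup_coef lookup_add)

lemma coef_0 [simp]: "coef X v 0 = 0"
  by (rule poly_mapping_eqI) (simp add: lookup_coef)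

lemma coef_sum: "coef X v (\<Sum>i\<in>A. g i) = (\<Sum>i\<in>A. coef X v (g i))"
  by (induction A rule: infinite_finite_induct) (simp_all add: coef_add)

text \<open>A factor in \<open>K[X]\<close> does not change the part of an exponent in
  \<open>Y\<close>, hence acts on each coefficient separately.\<close>

lemma coef_mult:
  assumes disj: "X \<inter> Y = {}" and v: "v \<in> exps Y" and u: "u \<in> polys X"
  shows "coef X v (u * h) = u * coef X v h"
proof -
  have mono: "coef X v (monomial s * h) = monomial s * coef X v h" if s: "s \<in> exps X" for s h
  proof (rule poly_mapping_eqI)
    fix t
    show "lookup (coef X v (monomial s * h)) t = lookup (monomial s * coef X v h) t"
    proof (cases "t \<in> exps X")
      case True
      have "lookup s w \<le> lookup t w + lookup v w \<longleftrightarrow> lookup s w \<le> lookup t w" for w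
        using s v disj by (cases "w \<in> X") (auto simp: exps_iff)
      then have d: "s divs t + v \<longleftrightarrow> s divs t" by (simp add: divs_def lookup_add)
      show ?thesis
      proof (cases "s divs t")
        case sd: True
        then have "t + v - s = (t - s) + v"
          by (intro poly_mapping_eqI) (auto simp: lookup_add lookup_minus divs_def)
        then show ?thesis using True sd d minus_exps[OF True] by (simp add: lookup_coef lookup_monomial_mult)
      next
        case False
        then show ?thesis using d by (simp add: lookup_coef lookup_monomial_mult)
      qed
    next
      case False
      have "s divs t \<Longrightarrow> t - s \<notin> exps X"
        using False s divs_minus(1)[of s t] add_exps[of s "t - s" X] by metis
      then show ?thesis using False by (simp add: lookup_coef lookup_monomial_mult)
    qed
  qed
  have const: "coef X v (single 0 c * h) = single 0 c * coef X v h" for c h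
    by (rule poly_mapping_eqI)
      (simp add: lookup_coef flip: mult_map_scale_conv_mult, simp add: Poly_Mapping.map.rep_eq lookup_coef when_def)
  have "coef X v ((\<Sum>s\<in>keys u. single s (lookup u s)) * h) = (\<Sum>s\<in>keys u. single s (lookup u s)) * coef X v h"
    unfolding sum_distrib_right coef_sum
  proof (intro sum.cong refl)
    fix s assume "s \<in> keys u"
    then have "s \<in> exps X" using u by (auto simp: polys_eq supported_def subset_iff)
    then show "coef X v (single s (lookup u s) * h) = single s (lookup u s) * coef X v h"
      unfolding single_eq_monomial[of s] mult.assoc const by (simp add: mono)
  qed
  then show ?thesis using mpoly_expand[of u] by simp
qed

lemma coef_monomial:
  assumes disj: "X \<inter> Y = {}" and vw: "v \<in> exps Y" "w \<in> exps Y"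
  shows "coef X v (monomial w) = (if v = w then 1 else 0)"
proof (rule poly_mapping_eqI)
  fix t
  have "t + v = w \<longleftrightarrow> t = 0 \<and> v = w" if "t \<in> exps X"
    using add_exps_eq_iff[OF disj that zero_exps vw] by simp
  then show "lookup (coef X v (monomial w)) t = lookup (if v = w then 1 else 0 :: 'a mpoly) t"
    by (auto simp: lookup_coef monomial_def lookup_single lookup_one when_def)
qed

lemma coef_mult_monomial:
  assumes "X \<inter> Y = {}" "v \<in> exps Y" "w \<in> exps Y" "u \<in> polys X"
  shows "coef X v (u * monomial w) = (if v = w then u else 0)"
  unfolding coef_mult[OF assms(1,2,4)] coef_monomial[OF assms(1-3)] by simp

lemma coef_expand:
  assumes disj: "X \<inter> Y = {}" and h: "h \<in> polys (X \<union> Y)"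
  shows "h = (\<Sum>v\<in>part Y ` keys h. coef X v h * monomial v)"
proof (rule poly_mapping_eqI)
  fix t
  have lk: "lookup (coef X v h * monomial v) t = (if v divs t \<and> t - v \<in> exps X then lookup h t else 0)" for v
    by (simp add: mult.commute[of _ "monomial v"] lookup_monomial_mult lookup_coef divs_minus)
  have uniq: "v = part Y t" if "v \<in> exps Y" "v divs t" "t - v \<in> exps X" for v
  proof -
    have "part Y t = part Y (t - v) + part Y v" unfolding part_add[symmetric] using divs_minus(2)[OF that(2)] by simp
    also have "\<dots> = v" using part_disjoint[OF that(3), of Y] part_id[OF that(1)] disj by (simp add: Int_commute)
    finally show ?thesis by simp
  qed
  show "lookup h t = lookup (\<Sum>v\<in>part Y ` keys h. coef X v h * monomial v) t"
  proof (cases "t \<in> keys h")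
    case True
    then have t: "t \<in> exps (X \<union> Y)" using h by (auto simp: polys_eq supported_def)
    have "part X t + part Y t = t" using part_add_part[OF t disj] .
    then have "t - part Y t = part X t" by (metis add_diff_cancel_right')
    then have d: "part Y t divs t" "t - part Y t \<in> exps X" using part_divs part_exps by auto
    have "(\<Sum>v\<in>part Y ` keys h. lookup (coef X v h * monomial v) t) =
        (\<Sum>v\<in>part Y ` keys h. if v = part Y t then lookup h t else 0)"
      unfolding lk using uniq d part_exps by (intro sum.cong refl) auto
    also have "\<dots> = lookup h t" using True by simp
    finally show ?thesis by (simp add: lookup_sum)
  next
    case False
    then have "lookup h t = 0" by (simp add: in_keys_iff)
    then show ?thesis unfolding lookup_sum lk by (simp add: sum.neutral)
  qed
qed

locale ideal_family =
  fixes X Y :: "nat set"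
  assumes fin: "finite X" "finite Y" and disj: "X \<inter> Y = {}"
begin

text \<open>The direct sum of the \<open>U v\<close> times the monomials of \<open>v\<close>. As a
  module over \<open>K[X]\<close>, the quotient by it is the direct sum of the
  \<open>K[X]/U v\<close>.\<close>

definition total_ideal :: "(expo \<Rightarrow> 'k::field mpoly set) \<Rightarrow> 'k mpoly set" where
  "total_ideal U = {h \<in> polys (X \<union> Y). \<forall>v\<in>exps Y. coef X v h \<in> U v}"

text \<open>The finiteness condition makes the variables of \<open>Y\<close> nilpotent modulo the
  total ideal. The alternative for \<open>U v\<close> ensures that a proper \<open>U v\<close> stays
  proper when elements of the irrelevant ideal are adjoined.\<close>

definition family :: "(expo \<Rightarrow> 'k::field mpoly set) \<Rightarrow> bool" where
  "family U \<longleftrightarrow> (\<forall>v\<in>exps Y. is_ideal (polys X) (U v) \<and> (U v \<subseteq> irrelevant_ideal X \<or> U v = polys X)) \<and>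
     (\<forall>v\<in>exps Y. \<forall>w\<in>exps Y. U v \<subseteq> U (v + w)) \<and> finite {v \<in> exps Y. U v \<noteq> polys X} \<and>
     is_ideal (polys (X \<union> Y)) (total_ideal U)"

lemma polys_X_subset: "polys X \<subseteq> polys (X \<union> Y)"
  unfolding polys_eq by (intro supported_mono exps_mono) blast

lemma irrelevant_X_subset: "irrelevant_ideal X \<subseteq> irrelevant_ideal (X \<union> Y)"
  unfolding irrelevant_ideal_eq using exps_mono[of X "X \<union> Y"] by (intro supported_mono) auto

lemma monomial_Y: "v \<in> exps Y \<Longrightarrow> monomial v \<in> polys (X \<union> Y)"
  using exps_mono[of Y "X \<union> Y"] by (auto simp: polys_eq)

text \<open>As \<open>f\<close> involves only \<open>X\<close>, it is adjoined to each coefficient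
  separately. The pieces are reassembled over the parts in \<open>Y\<close> that occur in
  \<open>h\<close>, which are finite in number.\<close>

lemma total_adjoin:
  assumes U: "family U" and f: "f \<in> polys X"
  shows "total_ideal (\<lambda>v. adjoin (polys X) (U v) f) = adjoin (polys (X \<union> Y)) (total_ideal U) f"
proof (intro Set.set_eqI iffI)
  interpret S: carrier_subring "polys (X \<union> Y) :: 'a mpoly set" by (rule carrier_subring_polys)
  interpret SX: carrier_subring "polys X :: 'a mpoly set" by (rule carrier_subring_polys)
  have fS: "f \<in> polys (X \<union> Y)" using f polys_X_subset by blast
  fix h
  {
    assume h: "h \<in> total_ideal (\<lambda>v. adjoin (polys X) (U v) f)"
    then have hp: "h \<in> polys (X \<union> Y)" by (simp add: total_ideal_def)
    have "\<forall>v\<in>exps Y. \<exists>w. \<exists>s. coef X v h = w + s * f \<and> w \<in> U v \<and> s \<in> polys X"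
      using h by (auto simp: total_ideal_def adjoin_def)
    from bchoice[OF this] obtain w where "\<forall>v\<in>exps Y. \<exists>s. coef X v h = w v + s * f \<and> w v \<in> U v \<and> s \<in> polys X" ..
    from bchoice[OF this] obtain s where ws: "\<And>v. v \<in> exps Y \<Longrightarrow> coef X v h = w v + s v * f \<and> w v \<in> U v \<and> s v \<in> polys X"
      by blast
    define A where "A = part Y ` keys h"
    have A: "finite A" "A \<subseteq> exps Y" using part_exps by (auto simp: A_def)
    have wX: "w v \<in> polys X" if "v \<in> A" for v
      using ws[of v] that A(2) U is_idealD(1) unfolding family_def by blast
    have ps: "u * monomial v \<in> polys (X \<union> Y)" if "u \<in> polys X" "v \<in> A" for u :: "'a mpoly" and v
      using that A(2) polys_X_subset monomial_Y by (intro S.mult_closed) auto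
    define h1 where "h1 = (\<Sum>v\<in>A. w v * monomial v)"
    define h2 where "h2 = (\<Sum>v\<in>A. s v * monomial v)"
    have "h = (\<Sum>v\<in>A. coef X v h * monomial v)" unfolding A_def by (rule coef_expand[OF disj hp])
    also have "\<dots> = (\<Sum>v\<in>A. (w v + s v * f) * monomial v)"
    proof (rule sum.cong[OF refl])
      fix v assume "v \<in> A"
      then have "coef X v h = w v + s v * f" using ws[of v] A(2) by blast
      then show "coef X v h * monomial v = (w v + s v * f) * monomial v" by simp
    qed
    also have "\<dots> = h1 + h2 * f"
      unfolding h1_def h2_def by (simp add: sum_distrib_left sum.distrib algebra_simps)
    finally have eq: "h = h1 + h2 * f" .
    have "h2 \<in> polys (X \<union> Y)"
      unfolding h2_def using ws A by (intro S.ideal_sum[OF S.is_ideal_carrier] ps) auto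
    moreover have "h1 \<in> total_ideal U"
      unfolding total_ideal_def
    proof (intro CollectI conjI ballI)
      show "h1 \<in> polys (X \<union> Y)" unfolding h1_def using wX by (intro S.ideal_sum[OF S.is_ideal_carrier] ps)
      fix v assume v: "v \<in> exps Y"
      have "coef X v h1 = (\<Sum>x\<in>A. if v = x then w x else 0)"
        unfolding h1_def coef_sum
      proof (rule sum.cong[OF refl])
        fix x assume x: "x \<in> A"
        then have "x \<in> exps Y" using A(2) by blast
        then show "coef X v (w x * monomial x) = (if v = x then w x else 0)"
          by (rule coef_mult_monomial[OF disj v _ wX[OF x]])
      qed
      also have "\<dots> = (if v \<in> A then w v else 0)" using A(1) by simp
      also have "\<dots> \<in> U v" using ws[OF v] U v is_idealD(2)[of "polys X" "U v"] unfolding family_def by auto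
      finally show "coef X v h1 \<in> U v" .
    qed
    ultimately show "h \<in> adjoin (polys (X \<union> Y)) (total_ideal U) f" unfolding adjoin_def eq by blast
  next
    assume "h \<in> adjoin (polys (X \<union> Y)) (total_ideal U) f"
    then obtain w s where ws: "h = w + f * s" "w \<in> total_ideal U" "s \<in> polys (X \<union> Y)"
      unfolding adjoin_def by (auto simp: mult.commute)
    have "coef X v h = coef X v w + coef X v s * f" if "v \<in> exps Y" for v
      unfolding ws(1) coef_add coef_mult[OF disj that f] by (simp add: mult.commute)
    moreover have "h \<in> polys (X \<union> Y)"
      unfolding ws(1) using ws(2,3) fS by (intro S.add_closed S.mult_closed) (auto simp: total_ideal_def)
    ultimately show "h \<in> total_ideal (\<lambda>v. adjoin (polys X) (U v) f)"
      unfolding total_ideal_def adjoin_def using ws(2)[unfolded total_ideal_def] coef_polys by blast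
  }
qed

lemma family_adjoin:
  assumes U: "family U" and f: "f \<in> irrelevant_ideal X"
  shows "family (\<lambda>v. adjoin (polys X) (U v) f)"
proof -
  interpret S: noetherian_local "polys (X \<union> Y) :: 'a mpoly set" "irrelevant_ideal (X \<union> Y)"
    using fin by (intro noetherian_local_polys) simp
  interpret SX: noetherian_local "polys X :: 'a mpoly set" "irrelevant_ideal X"
    using fin by (intro noetherian_local_polys) simp
  have fX: "f \<in> polys X" using f by (rule SX.mmS)
  have imp: "adjoin (polys X) (U v) f = polys X" if "U v = polys X" for v
    using that fX by (simp add: SX.adjoin_absorb SX.is_ideal_carrier)
  show ?thesis
    unfolding family_def
  proof (intro conjI ballI)
    fix v assume v: "v \<in> exps Y"
    then have Uv: "is_ideal (polys X) (U v)" "U v \<subseteq> irrelevant_ideal X \<or> U v = polys X"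
      using U by (auto simp: family_def)
    show "is_ideal (polys X) (adjoin (polys X) (U v) f)" by (rule SX.is_ideal_adjoin[OF Uv(1) fX])
    show "adjoin (polys X) (U v) f \<subseteq> irrelevant_ideal X \<or> adjoin (polys X) (U v) f = polys X"
      using Uv(2) imp SX.adjoin_least[OF SX.mm _ f] by blast
    fix w assume w: "w \<in> exps Y"
    have "U v \<subseteq> U (v + w)" using U v w by (simp add: family_def)
    then show "adjoin (polys X) (U v) f \<subseteq> adjoin (polys X) (U (v + w)) f" unfolding adjoin_def by blast
  next
    have "{v \<in> exps Y. adjoin (polys X) (U v) f \<noteq> polys X} \<subseteq> {v \<in> exps Y. U v \<noteq> polys X}" using imp by blast
    then show "finite {v \<in> exps Y. adjoin (polys X) (U v) f \<noteq> polys X}"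
      using U finite_subset unfolding family_def by blast
    show "is_ideal (polys (X \<union> Y)) (total_ideal (\<lambda>v. adjoin (polys X) (U v) f))"
      unfolding total_adjoin[OF U fX] using U fX polys_X_subset by (intro S.is_ideal_adjoin) (auto simp: family_def)
  qed
qed

lemma family_regular:
  assumes "f \<in> polys X" and "\<And>v. v \<in> exps Y \<Longrightarrow> regular_on (polys X) (U v) f"
  shows "regular_on (polys (X \<union> Y)) (total_ideal U) f"
  unfolding regular_on_def
proof (intro ballI impI)
  fix h assume h: "h \<in> polys (X \<union> Y)" "f * h \<in> total_ideal U"
  have "coef X v h \<in> U v" if v: "v \<in> exps Y" for v
    using h(2) v assms(2)[OF v] coef_polys[of X v h] coef_mult[OF disj v assms(1), of h]
    unfolding regular_on_def total_ideal_def by auto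
  then show "h \<in> total_ideal U" using h(1) by (simp add: total_ideal_def)
qed

text \<open>Suppose \<open>u\<close> outside \<open>U v\<close> is multiplied into
  \<open>U v\<close> by the irrelevant ideal. Choose \<open>w\<close> of maximal degree such that
  \<open>u\<close> is outside \<open>U (v + w)\<close>; only finitely many \<open>w\<close> qualify.
  Modulo the total ideal, \<open>u\<close> times the monomial of \<open>v + w\<close> is killed by
  the variables of \<open>X\<close>, since the family increases, and by those of \<open>Y\<close>,
  by maximality, yet it is not in the total ideal.\<close>

lemma family_socle_free:
  assumes U: "family U" and sf: "socle_free (polys (X \<union> Y)) (irrelevant_ideal (X \<union> Y)) (total_ideal U)"
    and v: "v \<in> exps Y"
  shows "socle_free (polys X) (irrelevant_ideal X) (U v)"
  unfolding socle_free_def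
proof (intro ballI impI, rule ccontr)
  fix u assume u: "u \<in> polys X" "\<forall>x\<in>irrelevant_ideal X. x * u \<in> U v" and nu: "u \<notin> U v"
  have up: "U a \<subseteq> U (a + b)" if "a \<in> exps Y" "b \<in> exps Y" for a b using U that by (simp add: family_def)
  define N where "N = {w \<in> exps Y. u \<notin> U (v + w)}"
  have "(\<lambda>w. v + w) ` N \<subseteq> {v \<in> exps Y. U v \<noteq> polys X}" using v u(1) by (auto simp: N_def)
  then have "finite ((\<lambda>w. v + w) ` N)" using U finite_subset unfolding family_def by blast
  then have "finite N" by (rule finite_imageD) (simp add: inj_on_def)
  moreover have "0 \<in> N" using nu by (simp add: N_def)
  ultimately have "Max ((\<lambda>w. \<Sum>y\<in>Y. lookup w y) ` N) \<in> (\<lambda>w. \<Sum>y\<in>Y. lookup w y) ` N"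
    by (intro Max_in) auto
  then obtain w where w0: "w \<in> N" "(\<Sum>y\<in>Y. lookup w y) = Max ((\<lambda>w. \<Sum>y\<in>Y. lookup w y) ` N)" by auto
  have w: "w \<in> N" "\<And>w'. w' \<in> N \<Longrightarrow> (\<Sum>y\<in>Y. lookup w' y) \<le> (\<Sum>y\<in>Y. lookup w y)"
    unfolding w0(2) using w0(1) \<open>finite N\<close> by (auto intro: Max_ge)
  have wY: "w \<in> exps Y" and vw: "v + w \<in> exps Y" using w(1) v by (auto simp: N_def)
  have top: "u \<in> U (v + w + single y 1)" if y: "y \<in> Y" for y
  proof (rule ccontr)
    assume "u \<notin> U (v + w + single y 1)"
    then have "w + single y 1 \<in> N" using wY y by (simp add: N_def add.assoc)
    then have "(\<Sum>z\<in>Y. lookup (w + single y 1) z) \<le> (\<Sum>z\<in>Y. lookup w z)" by (rule w(2))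
    moreover have "(\<Sum>z\<in>Y. lookup (w + single y 1) z) = (\<Sum>z\<in>Y. lookup w z) + 1"
      using y fin(2) by (simp add: lookup_add sum.distrib lookup_single when_def)
    ultimately show False by simp
  qed
  have uS: "u \<in> polys (X \<union> Y)" using u(1) polys_X_subset by blast
  interpret S: carrier_subring "polys (X \<union> Y) :: 'a mpoly set" by (rule carrier_subring_polys)
  have TI: "is_ideal (polys (X \<union> Y)) (total_ideal U)" using U by (simp add: family_def)
  have inT: "p * monomial a \<in> total_ideal U" if "p \<in> polys X" "a \<in> exps Y" "p \<in> U a" for p a
    unfolding total_ideal_def
  proof (intro CollectI conjI ballI)
    show "p * monomial a \<in> polys (X \<union> Y)" using that polys_X_subset monomial_Y by (intro S.mult_closed) auto
    fix b assume b: "b \<in> exps Y"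
    then have "0 \<in> U b" using U is_idealD(2) by (auto simp: family_def)
    then show "coef X b (p * monomial a) \<in> U b" using coef_mult_monomial[OF disj b that(2,1)] that(3) by simp
  qed
  have "u * monomial (v + w) \<in> total_ideal U"
  proof (rule sf[unfolded socle_free_def, rule_format])
    show "u * monomial (v + w) \<in> polys (X \<union> Y)" using uS monomial_Y[OF vw] by (rule S.mult_closed)
    have "\<forall>x\<in>irrelevant_ideal (X \<union> Y). x * (u * monomial (v + w)) \<in> total_ideal U"
    proof
      fix x :: "'a mpoly" assume x: "x \<in> irrelevant_ideal (X \<union> Y)"
      have mono: "monomial t * (u * monomial (v + w)) \<in> total_ideal U" if t: "t \<in> exps (X \<union> Y)" "t \<noteq> 0" for t
      proof -
        obtain y where y: "y \<in> keys t" using t(2) by (metis ex_in_conv keys_eq_empty)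
        then have yV: "y \<in> X \<union> Y" using t(1) by (auto simp: exps_def)
        have tt: "t = (t - single y 1) + single y 1"
          using y by (intro divs_minus(2)[symmetric]) (auto simp: divs_def lookup_single when_def in_keys_iff)
        have "monomial (single y 1) * (u * monomial (v + w)) \<in> total_ideal U"
        proof (cases "y \<in> X")
          case True
          then have yX: "monomial (single y 1) \<in> (irrelevant_ideal X :: 'a mpoly set)"
            by (auto simp: irrelevant_ideal_eq) (metis lookup_single_eq lookup_zero zero_neq_one One_nat_def)
          then have "monomial (single y 1) * u \<in> U (v + w)" using u(2) up[OF v wY] by blast
          moreover have "monomial (single y 1) * u \<in> polys X"
            using True u(1) by (intro carrier_subring.mult_closed[OF carrier_subring_polys]) (auto simp: polys_eq)
          ultimately have "(monomial (single y 1) * u) * monomial (v + w) \<in> total_ideal U" using inT vw by blast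
          then show ?thesis by (simp add: mult.assoc)
        next
          case False
          then have yY: "y \<in> Y" using yV by blast
          then have "u * monomial (v + w + single y 1) \<in> total_ideal U" using inT u(1) vw top by simp
          then show ?thesis by (simp add: monomial_add ac_simps)
        qed
        moreover have "monomial (t - single y 1) \<in> (polys (X \<union> Y) :: 'a mpoly set)"
          using minus_exps[OF t(1)] by (simp add: polys_eq)
        ultimately have "monomial (t - single y 1) * (monomial (single y 1) * (u * monomial (v + w))) \<in> total_ideal U"
          using is_idealD(4)[OF TI] by blast
        then show ?thesis by (subst tt) (simp add: monomial_add mult.assoc)
      qed
      have "(\<Sum>t\<in>keys x. single t (lookup x t)) * (u * monomial (v + w)) \<in> total_ideal U"
        unfolding sum_distrib_right
      proof (rule S.ideal_sum[OF TI])
        fix t assume "t \<in> keys x"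
        then have "t \<in> exps (X \<union> Y)" "t \<noteq> 0" using x by (auto simp: irrelevant_ideal_eq supported_def)
        then have "single 0 (lookup x t) * (monomial t * (u * monomial (v + w))) \<in> total_ideal U"
          by (intro is_idealD(4)[OF TI const_polys mono])
        then show "single t (lookup x t) * (u * monomial (v + w)) \<in> total_ideal U"
          by (subst single_eq_monomial) (simp add: mult.assoc)
      qed
      then show "x * (u * monomial (v + w)) \<in> total_ideal U" using mpoly_expand[of x] by simp
    qed
    then show "x * (u * monomial (v + w)) \<in> total_ideal U" if "x \<in> irrelevant_ideal (X \<union> Y)" for x
      using that by (rule bspec)
  qed
  then have "coef X (v + w) (u * monomial (v + w)) \<in> U (v + w)" using vw unfolding total_ideal_def by blast
  then have "u \<in> U (v + w)" using coef_mult_monomial[OF disj vw vw u(1)] by simp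
  then show False using w(1) by (simp add: N_def)
qed

text \<open>Induction on \<open>d\<close>. Either side for \<open>Suc d\<close> makes all proper
  \<open>U v\<close> socle-free. Hence one \<open>f\<close> in the irrelevant ideal of
  \<open>K[X]\<close> is regular modulo all of them, and then also modulo the total ideal. By Rees'
  theorem this \<open>f\<close> may be taken as the first element on both sides.\<close>

theorem depth_ge_total:
  assumes "family U"
  shows "depth_ge (polys (X \<union> Y)) (irrelevant_ideal (X \<union> Y)) (total_ideal U) d \<longleftrightarrow>
    (\<forall>v\<in>exps Y. U v \<noteq> polys X \<longrightarrow> depth_ge (polys X) (irrelevant_ideal X) (U v) d)"
  using assms
proof (induction d arbitrary: U)
  case (Suc d)
  interpret S: noetherian_local "polys (X \<union> Y) :: 'a mpoly set" "irrelevant_ideal (X \<union> Y)"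
    using fin by (intro noetherian_local_polys) simp
  interpret SX: noetherian_local "polys X :: 'a mpoly set" "irrelevant_ideal X"
    using fin by (intro noetherian_local_polys) simp
  note U = Suc.prems
  have UI: "is_ideal (polys X) (U v)" if "v \<in> exps Y" for v using U that by (simp add: family_def)
  have TI: "is_ideal (polys (X \<union> Y)) (total_ideal U)" using U by (simp add: family_def)
  define \<W> where "\<W> = U ` {v \<in> exps Y. U v \<noteq> polys X}"
  have key: "?case" if sf: "\<And>W. W \<in> \<W> \<Longrightarrow> socle_free (polys X) (irrelevant_ideal X) W"
  proof -
    have "\<exists>f\<in>irrelevant_ideal X. \<forall>W\<in>\<W>. regular_on (polys X) W f"
    proof (rule SX.ex_common_regular[OF _ _ sf SX.mm])
      show "finite \<W>" using U by (simp add: \<W>_def family_def)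
      show "is_ideal (polys X) W" if "W \<in> \<W>" for W using that UI by (auto simp: \<W>_def)
    qed
    then obtain f where f: "f \<in> irrelevant_ideal X" "\<And>W. W \<in> \<W> \<Longrightarrow> regular_on (polys X) W f" by blast
    have fX: "f \<in> polys X" by (rule SX.mmS[OF f(1)])
    have reg: "regular_on (polys X) (U v) f" if "v \<in> exps Y" for v
    proof (cases "U v = polys X")
      case True then show ?thesis by (simp add: regular_on_def)
    next
      case False then show ?thesis using f(2) that by (auto simp: \<W>_def)
    qed
    have fS: "f \<in> irrelevant_ideal (X \<union> Y)" using f(1) irrelevant_X_subset by blast
    \<comment> \<open>A proper \<open>U v\<close> lies in the irrelevant ideal together with
      \<open>f\<close>, so it remains proper.\<close>
    have iff: "adjoin (polys X) (U v) f \<noteq> polys X \<longleftrightarrow> U v \<noteq> polys X" if v: "v \<in> exps Y" for v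
    proof (cases "U v = polys X")
      case True then show ?thesis using fX by (simp add: SX.adjoin_absorb SX.is_ideal_carrier)
    next
      case False
      then have "U v \<subseteq> irrelevant_ideal X" using U v by (auto simp: family_def)
      then have "adjoin (polys X) (U v) f \<subseteq> irrelevant_ideal X" using SX.adjoin_least[OF SX.mm _ f(1)] by blast
      then show ?thesis using False one_notin_irrelevant SX.one_closed by blast
    qed
    have "depth_ge (polys (X \<union> Y)) (irrelevant_ideal (X \<union> Y)) (total_ideal U) (Suc d) \<longleftrightarrow>
        depth_ge (polys (X \<union> Y)) (irrelevant_ideal (X \<union> Y)) (total_ideal (\<lambda>v. adjoin (polys X) (U v) f)) d"
      unfolding total_adjoin[OF U fX] by (rule S.depth_ge_adjoin[OF TI fS family_regular[OF fX reg]])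
    also have "\<dots> \<longleftrightarrow> (\<forall>v\<in>exps Y. U v \<noteq> polys X \<longrightarrow>
        depth_ge (polys X) (irrelevant_ideal X) (adjoin (polys X) (U v) f) d)"
      unfolding Suc.IH[OF family_adjoin[OF U f(1)]] using iff by (intro ball_cong refl) simp
    also have "\<dots> \<longleftrightarrow> (\<forall>v\<in>exps Y. U v \<noteq> polys X \<longrightarrow> depth_ge (polys X) (irrelevant_ideal X) (U v) (Suc d))"
      using SX.depth_ge_adjoin[OF UI f(1) reg] by (intro ball_cong refl) blast
    finally show ?thesis .
  qed
  show ?case
  proof
    assume L: "depth_ge (polys (X \<union> Y)) (irrelevant_ideal (X \<union> Y)) (total_ideal U) (Suc d)"
    then obtain g where "g \<in> irrelevant_ideal (X \<union> Y)" "regular_on (polys (X \<union> Y)) (total_ideal U) g" by auto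
    then have "socle_free (polys (X \<union> Y)) (irrelevant_ideal (X \<union> Y)) (total_ideal U)" by (rule S.regular_socle_free)
    then have "socle_free (polys X) (irrelevant_ideal X) W" if "W \<in> \<W>" for W
      using that family_socle_free[OF U] by (auto simp: \<W>_def)
    then show "\<forall>v\<in>exps Y. U v \<noteq> polys X \<longrightarrow> depth_ge (polys X) (irrelevant_ideal X) (U v) (Suc d)"
      using key L by blast
  next
    assume R: "\<forall>v\<in>exps Y. U v \<noteq> polys X \<longrightarrow> depth_ge (polys X) (irrelevant_ideal X) (U v) (Suc d)"
    have "socle_free (polys X) (irrelevant_ideal X) W" if W: "W \<in> \<W>" for W
    proof -
      obtain v where v: "v \<in> exps Y" "U v \<noteq> polys X" "W = U v" using W by (auto simp: \<W>_def)
      then obtain g where "g \<in> irrelevant_ideal X" "regular_on (polys X) W g" using R by auto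
      then show ?thesis by (rule SX.regular_socle_free)
    qed
    then show "depth_ge (polys (X \<union> Y)) (irrelevant_ideal (X \<union> Y)) (total_ideal U) (Suc d)" using key R by blast
  qed
qed simp

end

section \<open>Depth of the powers of the sum\<close>

lemma merge_scale: "a \<noteq> b \<Longrightarrow> merge a b (scale c g) = scale c (merge a b g)"
  by (rule poly_mapping_eqI) (simp add: lookup_merge lookup_scale algebra_simps)

lemma merge_mono: "a \<noteq> b \<Longrightarrow> t divs u \<Longrightarrow> merge a b t divs merge a b u"
  by (auto simp: divs_def lookup_merge intro: add_mono)

lemma keys_merge: "a \<noteq> b \<Longrightarrow> keys (merge a b t) = (if b \<in> keys t then insert a (keys t - {b}) else keys t)"
  by (auto simp: in_keys_iff lookup_merge split: if_splits)

lemma scale_gmult_divs: "keys g \<noteq> {} \<Longrightarrow> c \<le> gmult g t \<longleftrightarrow> scale c g divs t"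
  by (simp add: le_gmult_iff divs_def lookup_scale)

context mixed_powers
begin

lemma mem_E_mono:
  assumes "t \<in> E n" "u \<in> exps V" "part X u = part X t" "ord t \<le> ord u"
  shows "u \<in> E n"
proof -
  have "P (n - ord t) \<subseteq> P (n - ord u)" using assms(4) by (intro P_antimono) simp
  then show ?thesis using assms(1-3) unfolding E_def by auto
qed

text \<open>Two situations are treated together: \<open>b\<close> belongs to the support of
  \<open>f j0\<close> as well, or it belongs to no support at all.\<close>

context
  fixes a b j0
  assumes ab: "a \<noteq> b" "a \<in> Y" "b \<in> Y" and j0: "j0 < k" "a \<in> keys (f j0)"
    and b: "\<forall>j<k. j \<noteq> j0 \<longrightarrow> b \<notin> keys (f j)"
begin

lemma a_notin: "j < k \<Longrightarrow> j \<noteq> j0 \<Longrightarrow> a \<notin> keys (f j)"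
  using fdisj[of j j0] j0 by blast

lemma ab_notin_X: "a \<notin> X" "b \<notin> X" using ab disj by auto

lemma merge_f_other: "j < k \<Longrightarrow> j \<noteq> j0 \<Longrightarrow> merge a b (f j) = f j"
  using a_notin[of j] b[rule_format, of j] ab(1) by (intro poly_mapping_eqI) (auto simp: lookup_merge in_keys_iff)

lemma keys_merge_f:
  assumes j: "j < k"
  shows "keys (merge a b (f j)) \<subseteq> keys (f j)" "keys (merge a b (f j)) \<subseteq> Y - {b}" "keys (merge a b (f j)) \<noteq> {}"
proof -
  show sub: "keys (merge a b (f j)) \<subseteq> keys (f j)"
    using merge_f_other[OF j] j0(2) keys_merge[OF ab(1), of "f j"] by (cases "j = j0") auto
  have "b \<notin> keys (merge a b (f j))" using ab(1) by (simp add: in_keys_iff lookup_merge)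
  then show "keys (merge a b (f j)) \<subseteq> Y - {b}" using sub f(2)[OF j] by blast
  show "keys (merge a b (f j)) \<noteq> {}"
    unfolding keys_merge[OF ab(1)] using f(1)[OF j] by auto
qed

lemma mixed_powers_merge: "mixed_powers X (Y - {b}) P k (\<lambda>j. merge a b (f j))"
proof (rule mixed_powers.intro)
  show "keys (merge a b (f i)) \<inter> keys (merge a b (f j)) = {}" if "i < k" "j < k" "i \<noteq> j" for i j
    using keys_merge_f(1)[OF that(1)] keys_merge_f(1)[OF that(2)] fdisj[OF that] by blast
  show "keys (merge a b (f j)) \<noteq> {}" "keys (merge a b (f j)) \<subseteq> Y - {b}" if "j < k" for j
    using keys_merge_f[OF that] by blast+
  show "finite (Y - {b})" "X \<inter> (Y - {b}) = {}" using fin disj by auto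
qed (rule fin P0 P1 PSuc k)+

interpretation M: mixed_powers X "Y - {b}" P k "\<lambda>j. merge a b (f j)" by (rule mixed_powers_merge)

lemma part_X_merge: "part X (merge a b t) = part X t"
  using ab ab_notin_X by (intro poly_mapping_eqI) (auto simp: lookup_part lookup_merge)

lemma ord_le_ord_merge: "ord t \<le> M.ord (merge a b t)"
  unfolding ord_def M.ord_def
proof (rule sum_mono)
  fix j assume "j \<in> {..<k}"
  then have j: "j < k" by simp
  have "scale (gmult (f j) t) (f j) divs t" using scale_gmult_divs[OF f(1)[OF j]] by blast
  from merge_mono[OF ab(1) this] show "gmult (f j) t \<le> gmult (merge a b (f j)) (merge a b t)"
    unfolding scale_gmult_divs[OF keys_merge_f(3)[OF j]] merge_scale[OF ab(1)] .
qed

lemma V_minus: "X \<union> (Y - {b}) = V - {b}" using ab_notin_X by blast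

text \<open>Merging preserves divisibility, so it cannot lower multiplicities; this gives one
  inclusion. For the other one, an exponent \<open>s\<close> is lifted without loss of multiplicity
  by replacing the largest power of the merged \<open>f j0\<close> that divides it by the same power
  of \<open>f j0\<close>.\<close>

lemma merge_E: "merge a b ` E n = M.E n"
proof (intro Set.set_eqI iffI)
  fix s assume "s \<in> merge a b ` E n"
  then obtain t where t: "s = merge a b t" "t \<in> E n" by blast
  have "s \<in> exps (V - {b})" unfolding t(1) using t(2) ab by (intro merge_exps) (auto simp: E_def)
  moreover have "P (n - ord t) \<subseteq> P (n - M.ord s)" unfolding t(1) using ord_le_ord_merge[of t] by (intro P_antimono) simp
  ultimately show "s \<in> M.E n" using t(2) unfolding M.E_def E_def V_minus by (auto simp: t(1) part_X_merge)
next
  fix s assume s: "s \<in> M.E n"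
  then have sV: "s \<in> exps (V - {b})" and sP: "part X s \<in> P (n - M.ord s)" unfolding M.E_def V_minus by auto
  define c where "c = gmult (merge a b (f j0)) s"
  have cd: "scale c (merge a b (f j0)) divs s" using scale_gmult_divs[OF keys_merge_f(3)[OF j0(1)]] c_def by blast
  define t where "t = (s - scale c (merge a b (f j0))) + scale c (f j0)"
  have "s - scale c (merge a b (f j0)) \<in> exps (V - {b})" using sV by (rule minus_exps)
  then have mt: "merge a b t = s"
    unfolding t_def merge_add[OF ab(1)] merge_scale[OF ab(1)] using merge_id[OF ab(1)] divs_minus(2)[OF cd] by simp
  have "f j0 \<in> exps V" using f(2)[OF j0(1)] unfolding exps_def by blast
  then have tV: "t \<in> exps V"
    unfolding t_def add_exps using minus_exps[OF sV] exps_mono[of "V - {b}" V] scale_exps by blast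
  have "M.ord s \<le> ord t"
    unfolding ord_def M.ord_def
  proof (rule sum_mono)
    fix j assume "j \<in> {..<k}"
    then have j: "j < k" by simp
    show "gmult (merge a b (f j)) s \<le> gmult (f j) t"
    proof (cases "j = j0")
      case True
      then show ?thesis unfolding True c_def[symmetric] scale_gmult_divs[OF f(1)[OF j0(1)]] t_def by simp
    next
      case False
      have "lookup s v = lookup t v" if v: "v \<in> keys (f j)" for v
      proof -
        have "v \<notin> keys (f j0)" using fdisj[OF j j0(1) False] v by blast
        moreover from this have "v \<notin> keys (merge a b (f j0))" using keys_merge_f(1)[OF j0(1)] by blast
        ultimately show ?thesis by (simp add: t_def lookup_add lookup_minus lookup_scale in_keys_iff)
      qed
      then have "gmult (f j) s = gmult (f j) t" by (rule gmult_cong)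
      then show ?thesis using merge_f_other[OF j False] by simp
    qed
  qed
  then have "P (n - M.ord s) \<subseteq> P (n - ord t)" by (intro P_antimono) simp
  then have "t \<in> E n" using sP tV part_X_merge[of t] unfolding E_def mt by auto
  then show "s \<in> merge a b ` E n" using mt by blast
qed

text \<open>In every coordinate at least one of the multiplications by \<open>x_a^p\<close> and
  \<open>x_b^q\<close> changes nothing, so the smaller of the two resulting multiplicities of
  \<open>f j0\<close> is already attained by \<open>w\<close>. The corresponding product has order
  at most \<open>ord w\<close> and the same part in \<open>X\<close> as \<open>w\<close>.\<close>

lemma E_merge_cond:
  assumes w: "w \<in> exps V" and wa: "w + single a p \<in> E n" and wb: "w + single b q \<in> E n"
  shows "w \<in> E n"
proof -
  have px: "part X (w + single v r) = part X w" if "v \<in> Y" for v r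
    using that disj by (intro poly_mapping_eqI) (auto simp: lookup_part lookup_add lookup_single when_def)
  have other: "gmult (f j) (w + single v r) = gmult (f j) w" if "j < k" "j \<noteq> j0" "v = a \<or> v = b" for j v r
    using a_notin[OF that(1,2)] b[rule_format, OF that(1,2)] that(3)
    by (intro gmult_cong) (auto simp: lookup_add lookup_single when_def)
  have ord_le: "ord (w + single v r) \<le> ord w"
    if v: "v = a \<or> v = b" and g: "gmult (f j0) (w + single v r) \<le> gmult (f j0) w" for v r
    unfolding ord_def
  proof (rule sum_mono)
    fix j assume "j \<in> {..<k}"
    then show "gmult (f j) (w + single v r) \<le> gmult (f j) w"
      using other[of j v r] v g by (cases "j = j0") auto
  qed
  define d where "d = min (gmult (f j0) (w + single a p)) (gmult (f j0) (w + single b q))"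
  have dw: "d \<le> gmult (f j0) w"
    unfolding le_gmult_iff[OF f(1)[OF j0(1)]]
  proof
    fix v
    have "d * lookup (f j0) v \<le> lookup (w + single a p) v" "d * lookup (f j0) v \<le> lookup (w + single b q) v"
      using le_gmult_iff[OF f(1)[OF j0(1)], THEN iffD1] min.cobounded1 min.cobounded2 unfolding d_def by blast+
    then show "d * lookup (f j0) v \<le> lookup w v"
      using ab(1) by (cases "v = a") (auto simp: lookup_add lookup_single when_def split: if_splits)
  qed
  show ?thesis
  proof (cases "gmult (f j0) (w + single a p) \<le> gmult (f j0) (w + single b q)")
    case True
    then have "ord (w + single a p) \<le> ord w" using dw by (intro ord_le) (auto simp: d_def)
    then show ?thesis using mem_E_mono[OF wa w] px[OF ab(2)] by simp
  next
    case False
    then have "ord (w + single b q) \<le> ord w" using dw by (intro ord_le) (auto simp: d_def)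
    then show ?thesis using mem_E_mono[OF wb w] px[OF ab(3)] by simp
  qed
qed

lemma depth_ge_E_merge:
  "depth_ge (polys V) (irrelevant_ideal V) (supported (E n) :: 'k::field mpoly set) (Suc d) \<longleftrightarrow>
   depth_ge (polys (X \<union> (Y - {b}))) (irrelevant_ideal (X \<union> (Y - {b}))) (supported (M.E n) :: 'k mpoly set) d"
  unfolding V_minus merge_E[symmetric]
  by (rule depth_ge_merge[OF ab(1) _ _ _ upset_E E_merge_cond]) (use ab fin in auto)

end

text \<open>If some variable occurs in no \<open>f j\<close>, it is paired with a variable of
  \<open>f 0\<close>. Otherwise the supports cover \<open>Y\<close>, and as there are fewer supports
  than variables, one of them contains two.\<close>

lemma ex_mergeable:
  assumes "k < card Y"
  shows "\<exists>a b j0. a \<noteq> b \<and> a \<in> Y \<and> b \<in> Y \<and> j0 < k \<and> a \<in> keys (f j0) \<and>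
    (\<forall>j<k. j \<noteq> j0 \<longrightarrow> b \<notin> keys (f j))"
proof (cases "Y \<subseteq> (\<Union>j<k. keys (f j))")
  case False
  then obtain b where b: "b \<in> Y" "\<And>j. j < k \<Longrightarrow> b \<notin> keys (f j)" by auto
  have "keys (f 0) \<noteq> {}" using k by (intro f(1)) simp
  then obtain a where "a \<in> keys (f 0)" by blast
  then have "a \<noteq> b" "a \<in> Y" "0 < k" "a \<in> keys (f 0)" using b(2)[of 0] f(2)[of 0] k by auto
  then show ?thesis using b by blast
next
  case True
  have "\<exists>j<k. \<not> (\<forall>a\<in>keys (f j). \<forall>b\<in>keys (f j). a = b)"
  proof (rule ccontr)
    assume neg: "\<not> (\<exists>j<k. \<not> (\<forall>a\<in>keys (f j). \<forall>b\<in>keys (f j). a = b))"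
    have "card (keys (f j)) \<le> 1" if "j < k" for j
      unfolding One_nat_def card_le_Suc0_iff_eq[OF finite_keys] using neg that by blast
    then have "(\<Sum>j<k. card (keys (f j))) \<le> (\<Sum>j<k. 1)" by (intro sum_mono) auto
    moreover have "card Y \<le> card (\<Union>j<k. keys (f j))" using True by (intro card_mono) auto
    moreover have "card (\<Union>j<k. keys (f j)) \<le> (\<Sum>j<k. card (keys (f j)))" by (rule card_UN_le) simp
    ultimately show False using assms by simp
  qed
  then obtain j a b where j: "j < k" "a \<in> keys (f j)" "b \<in> keys (f j)" "a \<noteq> b" by blast
  moreover have "b \<notin> keys (f i)" if "i < k" "i \<noteq> j" for i using fdisj[OF that(1) j(1) that(2)] j(3) by blast
  ultimately show ?thesis using f(2)[OF j(1)] by blast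
qed

text \<open>As \<open>card Y = k\<close>, every support is a single variable. The exponent set
  \<open>E n\<close> belongs to the total ideal of the family given by \<open>P (n - ord v)\<close>,
  whose member at \<open>v\<close> is proper exactly if \<open>ord v < n\<close>.\<close>

lemma depth_ge_E_base:
  assumes "card Y = k" "n \<ge> 1"
  shows "depth_ge (polys V) (irrelevant_ideal V) (supported (E n) :: 'k::field mpoly set) d \<longleftrightarrow>
    (\<forall>i\<in>{1..n}. depth_ge (polys X) (irrelevant_ideal X) (supported (P i) :: 'k mpoly set) d)"
proof -
  interpret F: ideal_family X Y using fin disj by unfold_locales
  define U where "U v = (supported (P (n - ord v)) :: 'k mpoly set)" for v
  have proper: "U v \<noteq> polys X \<longleftrightarrow> ord v < n" for v
  proof
    show "ord v < n" if "U v \<noteq> polys X" using that P0 by (cases "ord v < n") (auto simp: U_def polys_eq)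
    assume "ord v < n"
    then have "0 \<notin> P (n - ord v)" by (intro zero_notin_P) simp
    then show "U v \<noteq> polys X" unfolding U_def polys_eq supported_eq_iff using zero_exps by blast
  qed
  have sing: "\<exists>j<k. keys (f j) = {y}" if y: "y \<in> Y" for y
  proof (rule ccontr)
    assume neg: "\<not> (\<exists>j<k. keys (f j) = {y})"
    have "card (Y \<inter> {y}) + k \<le> card Y"
    proof (rule card_ge_disjoint_supports[of Y k f])
      show "\<not> keys (f j) \<subseteq> {y}" if "j < k" for j using neg f(1)[OF that] that by blast
    qed (use fin f fdisj in auto)
    then show False using y assms(1) by simp
  qed
  have total: "F.total_ideal U = supported (E n)"
  proof (intro Set.set_eqI iffI)
    fix h :: "'k mpoly"
    assume h: "h \<in> F.total_ideal U"
    show "h \<in> supported (E n)"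
      unfolding supported_def
    proof (intro CollectI subsetI)
      fix t assume t: "t \<in> keys h"
      then have tV: "t \<in> exps V" using h by (auto simp: F.total_ideal_def polys_eq supported_def)
      have eq: "part X t + part Y t = t" by (rule part_add_part[OF tV disj])
      have "part X t \<in> keys (coef X (part Y t) h)"
        using t by (simp add: in_keys_iff lookup_coef part_exps eq)
      moreover have "coef X (part Y t) h \<in> U (part Y t)" using h part_exps by (simp add: F.total_ideal_def)
      ultimately have "part X t \<in> P (n - ord (part Y t))" by (auto simp: U_def supported_def)
      moreover have "ord (part Y t) = ord t" by (rule ord_cong) (simp add: lookup_part)
      ultimately show "t \<in> E n" using tV by (simp add: E_def)
    qed
  next
    fix h :: "'k mpoly"
    assume h: "h \<in> supported (E n)"
    have "coef X v h \<in> U v" if v: "v \<in> exps Y" for v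
      unfolding U_def supported_def
    proof (intro CollectI subsetI)
      fix t assume "t \<in> keys (coef X v h)"
      then have t: "t \<in> exps X" "t + v \<in> keys h" by (auto simp: in_keys_iff lookup_coef split: if_splits)
      then have "t + v \<in> E n" using h by (auto simp: supported_def)
      moreover have "part X (t + v) = t" "ord (t + v) = ord v"
        using t(1) v part_disjoint[OF v disj] part_id[OF t(1)] ord_add_X[OF t(1)] by (simp_all add: part_add)
      ultimately show "t \<in> P (n - ord v)" by (simp add: E_def)
    qed
    moreover have "h \<in> polys V" using h upset_E[of n] supported_mono[of "E n" "exps V"]
      by (auto simp: polys_eq upset_def)
    ultimately show "h \<in> F.total_ideal U" by (simp add: F.total_ideal_def)
  qed
  have fam: "F.family U"
    unfolding F.family_def
  proof (intro conjI ballI)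
    fix v assume v: "v \<in> exps Y"
    show "is_ideal (polys X) (U v)" unfolding U_def by (rule is_ideal_supported[OF upset_P])
    show "U v \<subseteq> irrelevant_ideal X \<or> U v = polys X"
    proof (cases "ord v < n")
      case True
      then have "0 \<notin> P (n - ord v)" by (intro zero_notin_P) simp
      then have "P (n - ord v) \<subseteq> exps X - {0}" using upset_P[of "n - ord v"] by (auto simp: upset_def)
      then show ?thesis unfolding U_def irrelevant_ideal_eq using supported_mono by blast
    next
      case False then show ?thesis using proper by blast
    qed
    fix w assume "w \<in> exps Y"
    have "ord v \<le> ord (v + w)" using ord_superadd[of v w] by simp
    then show "U v \<subseteq> U (v + w)" unfolding U_def by (intro supported_mono P_antimono) simp
  next
    show "is_ideal (polys (X \<union> Y)) (F.total_ideal U)" unfolding total by (rule is_ideal_supported[OF upset_E])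
    \<comment> \<open>If \<open>ord v < n\<close> and \<open>f j\<close> is a power of
      \<open>y\<close>, the exponent of \<open>y\<close> in \<open>v\<close> is less than
      \<open>n\<close> times that in \<open>f j\<close>; \<open>N\<close> bounds all exponents of
      the \<open>f j\<close>.\<close>
    define N where "N = Max (insert 0 (\<Union>j<k. lookup (f j) ` keys (f j)))"
    have "lookup v y \<le> n * N" if v: "v \<in> exps Y" "U v \<noteq> polys X" for v y
    proof (cases "y \<in> Y")
      case True
      then obtain j where j: "j < k" "keys (f j) = {y}" using sing by blast
      have "gmult (f j) v \<le> ord v" unfolding ord_def using j(1) by (intro member_le_sum) auto
      then have "lookup v y div lookup (f j) y < n" using v(2) proper j(2) by (simp add: gmult_def)
      moreover have pos: "lookup (f j) y > 0" using j(2) by (metis gr0I in_keys_iff singletonI)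
      ultimately have "lookup v y < n * lookup (f j) y" by (simp add: div_less_iff_less_mult)
      also have "lookup (f j) y \<le> N" unfolding N_def using j by (intro Max_ge) auto
      finally show ?thesis by simp
    next
      case False then show ?thesis using v(1) by (simp add: exps_lookup)
    qed
    then have "{v \<in> exps Y. U v \<noteq> polys X} \<subseteq> {v \<in> exps Y. \<forall>y. lookup v y \<le> n * N}" by blast
    then show "finite {v \<in> exps Y. U v \<noteq> polys X}"
      using card_bounded_exps(1)[OF fin(2)] finite_subset by blast
  qed
  \<comment> \<open>Powers of \<open>f 0\<close> realise all orders, so every \<open>i\<close> in
    \<open>{1..n}\<close> occurs as \<open>n - ord v\<close>.\<close>
  have val: "\<exists>v\<in>exps Y. ord v = i" for i
  proof -
    have "ord (scale i (f 0)) = i"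
    proof (induction i)
      case 0
      have "scale 0 (f 0) = 0" by (rule poly_mapping_eqI) (simp add: lookup_scale)
      then show ?case using ord_0 by simp
    next
      case (Suc i)
      have "scale (Suc i) (f 0) = scale i (f 0) + f 0" by (rule poly_mapping_eqI) (simp add: lookup_scale lookup_add)
      then show ?case using Suc ord_add_f[of 0] k by simp
    qed
    moreover have "scale i (f 0) \<in> exps Y" using f(2)[of 0] k by (intro scale_exps) (simp add: exps_def)
    ultimately show ?thesis by blast
  qed
  have "depth_ge (polys V) (irrelevant_ideal V) (supported (E n) :: 'k mpoly set) d \<longleftrightarrow>
      (\<forall>v\<in>exps Y. ord v < n \<longrightarrow> depth_ge (polys X) (irrelevant_ideal X) (U v) d)"
    using F.depth_ge_total[OF fam, of d] unfolding total proper .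
  also have "\<dots> \<longleftrightarrow> (\<forall>i\<in>{1..n}. depth_ge (polys X) (irrelevant_ideal X) (supported (P i) :: 'k mpoly set) d)"
  proof
    assume L: "\<forall>v\<in>exps Y. ord v < n \<longrightarrow> depth_ge (polys X) (irrelevant_ideal X) (U v) d"
    show "\<forall>i\<in>{1..n}. depth_ge (polys X) (irrelevant_ideal X) (supported (P i) :: 'k mpoly set) d"
    proof
      fix i assume i: "i \<in> {1..n}"
      obtain v where v: "v \<in> exps Y" "ord v = n - i" using val by blast
      then have "ord v < n" "n - ord v = i" using i by auto
      then show "depth_ge (polys X) (irrelevant_ideal X) (supported (P i) :: 'k mpoly set) d"
        using L v(1) unfolding U_def by metis
    qed
  next
    assume R: "\<forall>i\<in>{1..n}. depth_ge (polys X) (irrelevant_ideal X) (supported (P i) :: 'k mpoly set) d"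
    show "\<forall>v\<in>exps Y. ord v < n \<longrightarrow> depth_ge (polys X) (irrelevant_ideal X) (U v) d"
    proof (intro ballI impI)
      fix v assume "ord v < n"
      then have "n - ord v \<in> {1..n}" by auto
      then show "depth_ge (polys X) (irrelevant_ideal X) (U v) d" unfolding U_def by (rule R[rule_format])
    qed
  qed
  finally show ?thesis .
qed

end

text \<open>Stated outside the locale, because the induction on \<open>r\<close> changes
  \<open>Y\<close> and \<open>f\<close>. Each identification of two variables divides out one
  regular element, which accounts for the shift by \<open>r\<close>.\<close>

lemma depth_ge_E:
  assumes "mixed_powers X Y P k f" "card Y = k + r" "n \<ge> 1"
  shows "depth_ge (polys (X \<union> Y)) (irrelevant_ideal (X \<union> Y)) (supported (mixed_powers.E X Y P k f n) :: 'k::field mpoly set) (d + r) \<longleftrightarrow>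
    (\<forall>i\<in>{1..n}. depth_ge (polys X) (irrelevant_ideal X) (supported (P i) :: 'k mpoly set) d)"
  using assms(1,2)
proof (induction r arbitrary: Y f)
  case 0
  interpret mixed_powers X Y P k f by (rule 0)
  show ?case using depth_ge_E_base[OF _ assms(3)] 0(2) by simp
next
  case (Suc r)
  interpret mixed_powers X Y P k f by (rule Suc.prems)
  have "k < card Y" using Suc.prems(2) by simp
  then obtain a b j0 where ab: "a \<noteq> b" "a \<in> Y" "b \<in> Y" "j0 < k" "a \<in> keys (f j0)"
    "\<forall>j<k. j \<noteq> j0 \<longrightarrow> b \<notin> keys (f j)" using ex_mergeable by blast
  have card: "card (Y - {b}) = k + r" using Suc.prems(2) ab(3) fin(2) by simp
  have "depth_ge (polys V) (irrelevant_ideal V) (supported (E n) :: 'k mpoly set) (Suc (d + r)) \<longleftrightarrow>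
      depth_ge (polys (X \<union> (Y - {b}))) (irrelevant_ideal (X \<union> (Y - {b})))
        (supported (mixed_powers.E X (Y - {b}) P k (\<lambda>j. merge a b (f j)) n) :: 'k mpoly set) (d + r)"
    using ab by (rule depth_ge_E_merge)
  also note Suc.IH[OF mixed_powers_merge[OF ab] card]
  finally show ?case by (simp only: add_Suc_right)
qed

section \<open>Monomial complete intersections\<close>

lemma monomial_divides_iff:
  assumes "u \<in> exps V"
  shows "(monomial t :: 'k::field mpoly) divides\<^bsub>poly_ring V\<^esub> monomial u \<longleftrightarrow> t divs u"
proof
  assume "(monomial t :: 'k mpoly) divides\<^bsub>poly_ring V\<^esub> monomial u"
  then obtain c :: "'k mpoly" where "monomial u = monomial t * c" by (auto simp: factor_def)
  then have "u \<in> keys (monomial t * c)" by (metis keys_monomial insertI1)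
  then show "t divs u" unfolding keys_monomial_mult by auto
next
  assume "t divs u"
  then have "(monomial u :: 'k mpoly) = monomial t * monomial (u - t)"
    by (simp add: divs_minus flip: monomial_add)
  moreover have "(monomial (u - t) :: 'k mpoly) \<in> carrier (poly_ring V)"
    using minus_exps[OF assms] by (simp add: polys_eq)
  ultimately show "(monomial t :: 'k mpoly) divides\<^bsub>poly_ring V\<^esub> monomial u" unfolding factor_def by auto
qed

definition minimal_exps :: "expo set \<Rightarrow> expo set" where
  "minimal_exps E = {t \<in> E. \<forall>u\<in>E. u divs t \<longrightarrow> u = t}"

lemma minimal_monomial_generators_eq:
  assumes "upset V E"
  shows "minimal_monomial_generators V (supported E :: 'k::field mpoly set) = monomial ` minimal_exps E"
proof -
  have "monomials V \<inter> supported E = (monomial ` E :: 'k mpoly set)"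
    using upsetD[OF assms] by (auto simp: monomials_eq)
  then have "minimal_monomial_generators V (supported E :: 'k mpoly set) =
      {m \<in> monomial ` E. \<forall>g\<in>monomial ` E. g divides\<^bsub>poly_ring V\<^esub> m \<longrightarrow> g = m}"
    unfolding minimal_monomial_generators_def by simp
  also have "\<dots> = monomial ` {t \<in> E. \<forall>u\<in>E. (monomial u :: 'k mpoly) divides\<^bsub>poly_ring V\<^esub> monomial t \<longrightarrow> u = t}"
    by auto
  also have "{t \<in> E. \<forall>u\<in>E. (monomial u :: 'k mpoly) divides\<^bsub>poly_ring V\<^esub> monomial t \<longrightarrow> u = t} = minimal_exps E"
    unfolding minimal_exps_def
    by (intro Collect_cong conj_cong refl ball_cong) (simp add: monomial_divides_iff[OF upsetD[OF assms]])
  finally show ?thesis .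
qed

text \<open>Descent on the total degree, which drops on passing to a proper divisor.\<close>

lemma ex_minimal_divisor: "t \<in> E \<Longrightarrow> \<exists>u\<in>minimal_exps E. u divs t"
proof (induction "\<Sum>v\<in>keys t. lookup t v" arbitrary: t rule: less_induct)
  case less
  show ?case
  proof (cases "t \<in> minimal_exps E")
    case False
    then obtain u where u: "u \<in> E" "u divs t" "u \<noteq> t" using less.prems by (auto simp: minimal_exps_def)
    then obtain v where v: "lookup u v \<noteq> lookup t v" using poly_mapping_eqI by metis
    then have lt: "lookup u v < lookup t v" using u(2) unfolding divs_def by (metis le_neq_implies_less)
    have "keys u \<subseteq> keys t" using u(2) by (auto simp: divs_iff)
    then have "(\<Sum>v\<in>keys u. lookup u v) \<le> (\<Sum>v\<in>keys t. lookup u v)" by (intro sum_mono2) auto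
    also have "\<dots> < (\<Sum>v\<in>keys t. lookup t v)"
      using u(2) lt by (intro sum_strict_mono_ex1) (auto simp: divs_def in_keys_iff intro!: bexI[of _ v])
    finally obtain w where "w \<in> minimal_exps E" "w divs u" using less.hyps u(1) by blast
    then show ?thesis using u(2) divs_trans by blast
  qed (auto intro: bexI[of _ t])
qed

lemma upset_gen_minimal:
  assumes E: "upset V E"
  shows "upset_gen V (minimal_exps E) = E"
proof (intro Set.set_eqI iffI)
  fix t assume "t \<in> upset_gen V (minimal_exps E)"
  then obtain g where "t \<in> exps V" "g \<in> E" "g divs t" by (auto simp: upset_gen_def minimal_exps_def)
  then show "t \<in> E" using upset_divs[OF E] by blast
next
  fix t assume "t \<in> E"
  then show "t \<in> upset_gen V (minimal_exps E)"
    using ex_minimal_divisor upsetD[OF E] by (auto simp: upset_gen_def)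
qed

lemma (in carrier_subring) in_adjoin_list:
  "is_ideal S W \<Longrightarrow> set fs \<subseteq> S \<Longrightarrow> f \<in> set fs \<Longrightarrow> f \<in> adjoin_list S W fs"
proof (induction fs arbitrary: W)
  case (Cons g fs)
  show ?case
  proof (cases "f = g")
    case True
    have "g \<in> adjoin S W g" using Cons.prems(1) by (rule adjoin_gen)
    then show ?thesis using True adjoin_list_superset by auto
  next
    case False
    then show ?thesis using Cons by (simp add: is_ideal_adjoin)
  qed
qed simp

text \<open>If \<open>x_v\<close> divides \<open>f i\<close> and \<open>f j\<close>, then
  \<open>f j\<close> times \<open>f i / x_v\<close> is a multiple of \<open>f i\<close>. By
  regularity \<open>f i / x_v\<close> lies in the ideal of the monomials before \<open>f j\<close>,
  so one of these divides it. That monomial also divides \<open>f i\<close>, hence equals it by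
  minimality, which is absurd.\<close>

lemma minimal_regular_disjoint:
  fixes f :: "nat \<Rightarrow> expo"
  assumes E: "upset V E" and min: "\<And>j. j < k \<Longrightarrow> f j \<in> minimal_exps E"
    and reg: "regular_sequence (poly_ring V) (ideal_module (polys V)) (map (\<lambda>j. monomial (f j) :: 'k::field mpoly) [0..<k])"
    and ij: "i < j" "j < k"
  shows "keys (f i) \<inter> keys (f j) = {}"
proof (rule ccontr)
  assume "keys (f i) \<inter> keys (f j) \<noteq> {}"
  then obtain v where v: "v \<in> keys (f i)" "v \<in> keys (f j)" by blast
  interpret S: carrier_subring "polys V :: 'k mpoly set" by (rule carrier_subring_polys)
  define fs where "fs = map (\<lambda>j. monomial (f j) :: 'k mpoly) [0..<k]"
  have fV: "f j \<in> exps V" if "j < k" for j using min[OF that] upsetD[OF E] by (simp add: minimal_exps_def)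
  have fs: "set fs \<subseteq> polys V" using fV by (auto simp: fs_def polys_eq)
  then have tk: "set (take j fs) \<subseteq> polys V" using set_take_subset by (rule order_trans[rotated])
  define I where "I = adjoin_list (polys V) {0} (take j fs)"
  have zero: "is_ideal (polys V) {0 :: 'k mpoly}" by (simp add: is_ideal_def S.zero_closed)
  have II: "is_ideal (polys V) I" unfolding I_def by (rule S.is_ideal_adjoin_list[OF zero tk])
  have dv: "single v 1 divs f i" "single v 1 divs f j"
    using v by (auto simp: divs_def lookup_single when_def in_keys_iff)
  have "f j + (f i - single v 1) = (f j - single v 1) + f i"
    using divs_minus(2)[OF dv(1)] divs_minus(2)[OF dv(2)] by (metis add.assoc add.commute)
  then have eq: "monomial (f j) * monomial (f i - single v 1) = (monomial (f j - single v 1) * monomial (f i) :: 'k mpoly)"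
    by (simp flip: monomial_add)
  have "monomial (f i) \<in> set (take j fs)" using ij by (auto simp: fs_def take_map)
  then have "monomial (f i) \<in> I" unfolding I_def by (rule S.in_adjoin_list[OF zero tk])
  moreover have "monomial (f j - single v 1) \<in> (polys V :: 'k mpoly set)"
    using minus_exps[OF fV[OF ij(2)]] by (simp add: polys_eq)
  ultimately have "monomial (f j) * monomial (f i - single v 1) \<in> I" unfolding eq using is_idealD(4)[OF II] by blast
  moreover have "monomial (f i - single v 1) \<in> (polys V :: 'k mpoly set)"
    using minus_exps[OF fV[of i]] ij by (simp add: polys_eq)
  moreover have "\<forall>x\<in>polys V. fs ! j * x \<in> I \<longrightarrow> x \<in> I"
  proof -
    have "\<forall>x\<in>carrier (ideal_module (polys V)). fs ! j \<odot>\<^bsub>ideal_module (polys V)\<^esub> x \<in> seq_submodule (ideal_module (polys V)) (take j fs)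
        \<longrightarrow> x \<in> seq_submodule (ideal_module (polys V)) (take j fs)"
      using reg ij unfolding regular_sequence_def fs_def by simp
    then show ?thesis unfolding I_def seq_submodule_ideal_module[OF tk] by (simp add: ideal_module_def)
  qed
  ultimately have "monomial (f i - single v 1) \<in> I" using ij by (simp add: fs_def)
  moreover have "I \<subseteq> supported (upset_gen V (f ` {..<j}))"
    unfolding I_def
  proof (rule S.adjoin_list_subset[OF is_ideal_supported[OF upset_upset_gen]])
    have "f ` {..<j} \<subseteq> upset_gen V (f ` {..<j})" using fV ij by (intro upset_gen_superset) auto
    moreover have "set (take j fs) = monomial ` f ` {..<j}" using ij by (auto simp: fs_def take_map)
    ultimately show "set (take j fs) \<subseteq> supported (upset_gen V (f ` {..<j}))"
      by (simp only: monomial_image_supported)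
  qed simp
  ultimately have "f i - single v 1 \<in> upset_gen V (f ` {..<j})" by auto
  then obtain l where l: "l < j" "f l divs f i - single v 1" by (auto simp: upset_gen_def)
  have "f i - single v 1 divs f i" by (simp add: divs_def lookup_minus)
  then have "f l divs f i" using l(2) by (rule divs_trans[rotated])
  then have "f l = f i" using min[of i] min[of l] l(1) ij by (auto simp: minimal_exps_def)
  then have "lookup (f i) v \<le> lookup (f i - single v 1) v" using l(2) by (simp add: divs_def)
  then show False using v(1) by (simp add: lookup_minus in_keys_iff)
qed

text \<open>Disjointness comes from the regular sequence of minimal generators; the hypotheses
  \<open>0 \<notin> E\<close> and \<open>E \<noteq> {}\<close> yield nonempty supports and
  \<open>k \<ge> 1\<close>.\<close>

lemma complete_intersection_supports:
  assumes E: "upset V E" "0 \<notin> E" "E \<noteq> {}" and ci: "complete_intersection V (supported E :: 'k::field mpoly set)"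
  shows "\<exists>(k :: nat) f. k \<ge> 1 \<and> (\<forall>j<k. keys (f j) \<noteq> {} \<and> keys (f j) \<subseteq> V) \<and>
    (\<forall>i<k. \<forall>j<k. i \<noteq> j \<longrightarrow> keys (f i) \<inter> keys (f j) = {}) \<and> E = upset_gen V (f ` {..<k})"
proof -
  obtain fs :: "'k mpoly list" where fs: "set fs = monomial ` minimal_exps E"
    "regular_sequence (poly_ring V) (ideal_module (polys V)) fs"
    using ci unfolding complete_intersection_def minimal_monomial_generators_eq[OF E(1)] by auto
  define k where "k = length fs"
  have "\<forall>j\<in>{..<k}. \<exists>t. fs ! j = monomial t \<and> t \<in> minimal_exps E"
    using fs(1) nth_mem[of _ fs] by (force simp: k_def)
  from bchoice[OF this] obtain f where f: "\<And>j. j < k \<Longrightarrow> fs ! j = monomial (f j)"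
    "\<And>j. j < k \<Longrightarrow> f j \<in> minimal_exps E" by auto
  have fs_eq: "fs = map (\<lambda>j. monomial (f j)) [0..<k]" using f(1) by (intro nth_equalityI) (auto simp: k_def)
  have "monomial ` f ` {..<k} = (monomial ` minimal_exps E :: 'k mpoly set)"
    unfolding fs(1)[symmetric] fs_eq by auto
  then have img: "f ` {..<k} = minimal_exps E" by (simp add: inj_image_eq_iff inj_def)
  have ltd: "keys (f i) \<inter> keys (f j) = {}" if "i < j" "j < k" for i j
    using minimal_regular_disjoint[OF E(1) f(2) fs(2)[unfolded fs_eq] that] .
  show ?thesis
  proof (intro exI conjI allI impI)
    have "minimal_exps E \<noteq> {}" using E(3) ex_minimal_divisor by blast
    then show "k \<ge> 1" using img by (cases k) auto
    show "keys (f j) \<noteq> {}" "keys (f j) \<subseteq> V" if "j < k" for j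
    proof -
      have "f j \<in> E" using f(2)[OF that] by (simp add: minimal_exps_def)
      then show "keys (f j) \<noteq> {}" "keys (f j) \<subseteq> V" using E(2) upsetD[OF E(1)] by (auto simp: exps_def)
    qed
    show "keys (f i) \<inter> keys (f j) = {}" if "i < k" "j < k" "i \<noteq> j" for i j
      using ltd[of i j] ltd[of j i] that by (metis Int_commute nat_neq_iff)
    show "E = upset_gen V (f ` {..<k})" unfolding img using upset_gen_minimal[OF E(1)] by simp
  qed
qed

section \<open>The main theorem\<close>

lemma upset_gen_upset_gen:
  assumes "G \<subseteq> exps W"
  shows "upset_gen V (upset_gen W G) = upset_gen V G"
proof (intro Set.set_eqI iffI)
  fix t assume "t \<in> upset_gen V (upset_gen W G)"
  then obtain g u where "t \<in> exps V" "g \<in> G" "g divs u" "u divs t" by (auto simp: upset_gen_def)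
  then show "t \<in> upset_gen V G" unfolding upset_gen_def using divs_trans by blast
next
  fix t assume "t \<in> upset_gen V G"
  then show "t \<in> upset_gen V (upset_gen W G)"
    using upset_gen_superset[OF assms] by (auto simp: upset_gen_def)
qed

lemma ideals_set_simps [simp]:
  "monoid.mult (ideals_set R) = ideal_prod R" "one (ideals_set R) = carrier R"
  by (simp_all add: ideals_set_def)

primrec upset_power :: "nat set \<Rightarrow> expo set \<Rightarrow> nat \<Rightarrow> expo set" where
  "upset_power V E 0 = exps V"
| "upset_power V E (Suc n) = sumset (upset_power V E n) E"

lemma ideal_power_supported:
  "(supported E :: 'k::field mpoly set) [^]\<^bsub>ideals_set (poly_ring V)\<^esub> (n :: nat) = supported (upset_power V E n)"
  by (induction n) (simp_all add: nat_pow_def polys_eq ideal_prod_supported)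

lemma sumset_exps: "upset V E \<Longrightarrow> sumset (exps V) E = E"
proof
  assume E: "upset V E"
  have "t + u \<in> E" if "t \<in> exps V" "u \<in> E" for t u
    using E that unfolding upset_def by (metis add.commute)
  then show "sumset (exps V) E \<subseteq> E" by (auto simp: sumset_def)
  show "E \<subseteq> sumset (exps V) E" unfolding sumset_def using zero_exps add_0 by (metis (mono_tags, lifting) mem_Collect_eq subsetI)
qed

text \<open>The values are well-ordered: from the place where the least of them is attained, the
  sequence can neither rise nor fall.\<close>

lemma eventually_const_enat:
  fixes g :: "nat \<Rightarrow> enat"
  assumes "\<And>n. n \<ge> 1 \<Longrightarrow> g (n + 1) \<le> g n"
  shows "\<exists>c. \<forall>\<^sub>F n in sequentially. g n = c"
proof -
  define c where "c = (LEAST x. x \<in> g ` {1..})"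
  have "c \<in> g ` {1..}" unfolding c_def by (rule LeastI[of _ "g 1"]) simp
  then obtain N where N: "N \<ge> 1" "c = g N" by auto
  have "g n = c" if "n \<ge> N" for n
  proof (rule antisym)
    show "g n \<le> c"
      using that
    proof (induction rule: dec_induct)
      case (step n)
      have "g (Suc n) \<le> g n" using assms[of n] step.hyps(1) N(1) by simp
      then show ?case using step.IH by (rule order_trans)
    qed (simp add: N(2))
    have "g n \<in> g ` {1..}" using that N(1) by auto
    then show "c \<le> g n" unfolding c_def by (rule Least_le)
  qed
  then show ?thesis unfolding eventually_sequentially by blast
qed

context mixed_powers
begin

lemma depth_powers:
  assumes "n \<ge> 1"
  shows "depth V (residue_module V (supported (E n) :: 'k::field mpoly set)) =
    (MIN i \<in> {1..n}. depth X (residue_module X (supported (P i) :: 'k mpoly set)) + enat (card Y - k))"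
proof -
  let ?r = "card Y - k"
  have irr: "supported U \<subseteq> (irrelevant_ideal W :: 'k mpoly set)" if "upset W U" "0 \<notin> U" for U W
  proof -
    have "U \<subseteq> exps W - {0}" using that by (auto simp: upset_def)
    then show ?thesis unfolding irrelevant_ideal_eq by (rule supported_mono)
  qed
  have dE: "enat d \<le> depth V (residue_module V (supported (E n) :: 'k mpoly set)) \<longleftrightarrow>
      depth_ge (polys V) (irrelevant_ideal V) (supported (E n) :: 'k mpoly set) d" for d
    using fin by (intro depth_residue_module is_ideal_supported upset_E irr zero_notin_E assms) simp
  have dP: "enat d \<le> depth X (residue_module X (supported (P i) :: 'k mpoly set)) \<longleftrightarrow>
      depth_ge (polys X) (irrelevant_ideal X) (supported (P i) :: 'k mpoly set) d" if "i \<in> {1..n}" for d i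
    using fin that by (intro depth_residue_module is_ideal_supported upset_P irr zero_notin_P) auto
  have main: "depth_ge (polys V) (irrelevant_ideal V) (supported (E n) :: 'k mpoly set) (d + ?r) \<longleftrightarrow>
      (\<forall>i\<in>{1..n}. depth_ge (polys X) (irrelevant_ideal X) (supported (P i) :: 'k mpoly set) d)" for d
    using k_le_card_Y by (intro depth_ge_E[OF mixed_powers_axioms _ assms]) simp
  interpret S: noetherian_local "polys V :: 'k mpoly set" "irrelevant_ideal V"
    using fin by (intro noetherian_local_polys) simp
  have iff: "enat q \<le> depth V (residue_module V (supported (E n) :: 'k mpoly set)) \<longleftrightarrow>
      enat q \<le> (MIN i \<in> {1..n}. depth X (residue_module X (supported (P i) :: 'k mpoly set)) + enat ?r)" for q
  proof -
    have "enat q \<le> (MIN i \<in> {1..n}. depth X (residue_module X (supported (P i) :: 'k mpoly set)) + enat ?r) \<longleftrightarrow>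
        (\<forall>i\<in>{1..n}. enat q \<le> depth X (residue_module X (supported (P i) :: 'k mpoly set)) + enat ?r)"
      using assms by (simp add: Min_ge_iff)
    also have "\<dots> \<longleftrightarrow> (\<forall>i\<in>{1..n}. enat (q - ?r) \<le> depth X (residue_module X (supported (P i) :: 'k mpoly set)))"
    proof (intro ball_cong refl)
      fix i
      show "enat q \<le> depth X (residue_module X (supported (P i) :: 'k mpoly set)) + enat ?r \<longleftrightarrow>
          enat (q - ?r) \<le> depth X (residue_module X (supported (P i) :: 'k mpoly set))"
        by (cases "depth X (residue_module X (supported (P i) :: 'k mpoly set))") auto
    qed
    also have "\<dots> \<longleftrightarrow> depth_ge (polys V) (irrelevant_ideal V) (supported (E n) :: 'k mpoly set) (q - ?r + ?r)"
      unfolding main using dP by simp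
    also have "\<dots> \<longleftrightarrow> depth_ge (polys V) (irrelevant_ideal V) (supported (E n) :: 'k mpoly set) q"
    proof (cases "?r \<le> q")
      \<comment> \<open>Below the shift the truncated difference is 0, and both sides hold, since
        \<open>main\<close> with \<open>d = 0\<close> already gives depth at least
        \<open>?r\<close>.\<close>
      case False
      have "depth_ge (polys V) (irrelevant_ideal V) (supported (E n) :: 'k mpoly set) (0 + ?r)"
        unfolding main by simp
      then have "depth_ge (polys V) (irrelevant_ideal V) (supported (E n) :: 'k mpoly set) q"
        "depth_ge (polys V) (irrelevant_ideal V) (supported (E n) :: 'k mpoly set) (q - ?r + ?r)"
        using False by (auto elim: S.depth_ge_mono)
      then show ?thesis by blast
    qed simp
    finally show ?thesis using dE by simp
  qed
  show ?thesis by (rule antisym; subst enat_le_iff_all; use iff in blast)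
qed

end

theorem theorem2p11:
  fixes r s :: nat
    and I J :: "'k::field mpoly set"
  defines "X \<equiv> {1..r}" and "Y \<equiv> {r + 1..r + s}" and "XY \<equiv> {1..r + s}"
  defines "A \<equiv> (poly_ring X :: 'k mpoly ring)"
    and "B \<equiv> (poly_ring Y :: 'k mpoly ring)"
    and "R \<equiv> (poly_ring XY :: 'k mpoly ring)"
  defines "IJ \<equiv> (\<lambda>n::nat. ((Idl\<^bsub>R\<^esub> I) <+>\<^bsub>R\<^esub> (Idl\<^bsub>R\<^esub> J)) [^]\<^bsub>ideals_set R\<^esub> n)"
    and "Ipow \<equiv> (\<lambda>i::nat. I [^]\<^bsub>ideals_set A\<^esub> i)"
  assumes "r \<ge> 1" and "s \<ge> 1"
    and "monomial_ideal X I" and "I \<noteq> {0}" and "I \<noteq> carrier A"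
    and "monomial_ideal Y J" and "J \<noteq> {0}" and "J \<noteq> carrier B"
    and "complete_intersection Y J"
  shows
    "(\<forall>n \<ge> 1.
        depth XY (residue_module XY (IJ n)) =
          (MIN i \<in> {1..n}. depth X (residue_module X (Ipow i)) + krull_dim (B Quot J)) \<and>

        enat r + krull_dim (B Quot J) \<ge> sdepth XY (residue_module XY (IJ n)) \<and>
        sdepth XY (residue_module XY (IJ n)) \<ge>
          (MIN i \<in> {1..n}. sdepth X (residue_module X (Ipow i)) + krull_dim (B Quot J)) \<and>

        ((\<forall>i \<in> {1..n}. sdepth X (residue_module X (Ipow i)) \<ge> depth X (residue_module X (Ipow i)))
          \<longrightarrow> sdepth XY (residue_module XY (IJ n)) \<ge> depth XY (residue_module XY (IJ n))) \<and>
        ((\<forall>i \<in> {1..n}. sdepth X (residue_module X (Ipow i)) + 1 \<ge> depth X (residue_module X (Ipow i)))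
          \<longrightarrow> sdepth XY (residue_module XY (IJ n)) + 1 \<ge> depth XY (residue_module XY (IJ n))) \<and>

        sdepth XY (residue_module XY (IJ (n + 1))) \<le> sdepth XY (residue_module XY (IJ n)) \<and>
        sdepth XY (ideal_module (IJ (n + 1))) \<le> sdepth XY (ideal_module (IJ n)) \<and>
        sdepth XY (quotient_module (ideal_module (IJ (n + 1))) (IJ (n + 2)))
          \<le> sdepth XY (quotient_module (ideal_module (IJ n)) (IJ (n + 1)))) \<and>

     (\<exists>c. \<forall>\<^sub>F n in sequentially. sdepth XY (residue_module XY (IJ n)) = c) \<and>
     (\<exists>c. \<forall>\<^sub>F n in sequentially. sdepth XY (ideal_module (IJ n)) = c) \<and>
     (\<exists>c. \<forall>\<^sub>F n in sequentially.
        sdepth XY (quotient_module (ideal_module (IJ n)) (IJ (n + 1))) = c)"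
proof -
  obtain EI where EI: "upset X EI" "I = supported EI"
    using \<open>monomial_ideal X I\<close> unfolding monomial_ideal_iff by blast
  obtain EJ where EJ: "upset Y EJ" "J = supported EJ"
    using \<open>monomial_ideal Y J\<close> unfolding monomial_ideal_iff by blast
  have "EI \<noteq> exps X" using \<open>I \<noteq> carrier A\<close> by (auto simp: A_def EI polys_eq)
  then have EI0: "0 \<notin> EI" using proper_upset[OF EI(1)] by blast
  have "EJ \<noteq> exps Y" using \<open>J \<noteq> carrier B\<close> by (auto simp: B_def EJ polys_eq)
  then have EJ0: "0 \<notin> EJ" using proper_upset[OF EJ(1)] by blast
  have EJne: "EJ \<noteq> {}" using \<open>J \<noteq> {0}\<close> by (auto simp: EJ supported_def)
  obtain k :: nat and f :: "nat \<Rightarrow> expo" where k: "k \<ge> 1" and f: "\<forall>j<k. keys (f j) \<noteq> {} \<and> keys (f j) \<subseteq> Y"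
    and fdisj: "\<forall>i<k. \<forall>j<k. i \<noteq> j \<longrightarrow> keys (f i) \<inter> keys (f j) = {}" and EJgen: "EJ = upset_gen Y (f ` {..<k})"
    using complete_intersection_supports[OF EJ(1) EJ0 EJne \<open>complete_intersection Y J\<close>[unfolded EJ(2)]]
    by (elim exE conjE)
  define P where "P = upset_power X EI"
  have P_1: "P 1 = EI" by (simp add: P_def sumset_exps[OF EI(1)])
  interpret mixed_powers X Y P k f
  proof (rule mixed_powers.intro)
    show "finite X" "finite Y" "X \<inter> Y = {}" by (auto simp: X_def Y_def)
    show "P 0 = exps X" by (simp add: P_def)
    show "P (Suc i) = sumset (P i) (P 1)" for i unfolding P_1 by (simp add: P_def)
    show "upset X (P 1)" "0 \<notin> P 1" unfolding P_1 by (rule EI(1), rule EI0)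
  qed (use k f fdisj in auto)
  have XY: "XY = X \<union> Y" by (auto simp: X_def Y_def XY_def)
  have card: "card X = r" "card Y = s" by (simp_all add: X_def Y_def)
  have Ip: "Ipow i = supported (P i)" for i by (simp add: Ipow_def A_def EI(2) ideal_power_supported P_def)
  have kd: "krull_dim (B Quot J) = enat (card Y - k)"
    unfolding B_def EJ(2) EJgen by (rule krull_dim_quotient) (use fin f fdisj in auto)
  have gen: "(Idl\<^bsub>R\<^esub> I) <+>\<^bsub>R\<^esub> (Idl\<^bsub>R\<^esub> J) = supported (E 1)"
  proof -
    have "upset_gen V EJ = upset_gen V (f ` {..<k})"
    unfolding EJgen using f by (intro upset_gen_upset_gen) (simp add: exps_def image_subset_iff)
    moreover have "upset_gen V EI \<union> upset_gen V (f ` {..<k}) = E 1" unfolding E_1 P_1 by (auto simp: upset_gen_def)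
    ultimately show ?thesis
      unfolding R_def XY EI(2) EJ(2)
      using genideal_supported[OF EI(1), of V, where ?'k = 'k] genideal_supported[OF EJ(1), of V, where ?'k = 'k]
      by (simp add: set_add_supported)
  qed
  have "upset_power V (E 1) n = E n" for n
    by (induction n) (simp_all only: upset_power.simps E_0 E_Suc)
  then have IJ: "IJ n = supported (E n)" for n
    unfolding IJ_def gen unfolding R_def XY ideal_power_supported by simp
  have sR: "sdepth XY (residue_module XY (IJ n)) = cone_depth V (exps V - E n)" for n
    unfolding IJ XY poly_ring_simps polys_eq
    by (rule sdepth_quotient_module[OF upset_exps upset_E]) (simp add: upset_E[unfolded upset_def])
  have sI: "sdepth XY (ideal_module (IJ n)) = cone_depth V (E n)" for n
    unfolding IJ XY by (rule sdepth_ideal_module[OF upset_E])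
  have sQ: "sdepth XY (quotient_module (ideal_module (IJ n)) (IJ (Suc n))) = cone_depth V (E n - E (Suc n))" for n
    unfolding IJ XY by (rule sdepth_quotient_module[OF upset_E upset_E E_Suc_subset])
  have sA: "sdepth X (residue_module X (Ipow i)) = cone_depth X (exps X - P i)" for i
    unfolding Ip poly_ring_simps polys_eq
    by (rule sdepth_quotient_module[OF upset_exps upset_P]) (simp add: upset_P[unfolded upset_def])
  have main: "depth XY (residue_module XY (IJ n)) =
      (MIN i \<in> {1..n}. depth X (residue_module X (Ipow i)) + krull_dim (B Quot J))" if "n \<ge> 1" for n
    unfolding IJ XY kd Ip by (rule depth_powers[OF that])
  have lower: "(MIN i \<in> {1..n}. sdepth X (residue_module X (Ipow i)) + krull_dim (B Quot J))
      \<le> sdepth XY (residue_module XY (IJ n))" if "n \<ge> 1" for n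
    unfolding sA sR kd by (rule cone_depth_complement_bounds(2)[OF that])
  have upper: "sdepth XY (residue_module XY (IJ n)) \<le> enat r + krull_dim (B Quot J)" if "n \<ge> 1" for n
    using cone_depth_complement_bounds(1)[OF that] unfolding sR kd card by simp
  \<comment> \<open>Depth and Stanley depth are compared at an index where the minimum of the
    Stanley depths is attained; there the depth formula still gives an upper bound.\<close>
  have attained: "\<exists>i\<in>{1..n}. (MIN i \<in> {1..n}. g i) = g i" if "n \<ge> 1" for g :: "nat \<Rightarrow> enat" and n
  proof -
    have "(MIN i \<in> {1..n}. g i) \<in> g ` {1..n}" using that by (intro Min_in) auto
    then show ?thesis by auto
  qed
  have dle: "depth XY (residue_module XY (IJ n)) \<le> depth X (residue_module X (Ipow i)) + krull_dim (B Quot J)"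
    if "n \<ge> 1" "i \<in> {1..n}" for n i
    unfolding main[OF that(1)] using that(2) by (intro Min_le) auto
  have sd: "depth XY (residue_module XY (IJ n)) \<le> sdepth XY (residue_module XY (IJ n))"
    if n: "n \<ge> 1" and le: "\<forall>i \<in> {1..n}. depth X (residue_module X (Ipow i)) \<le> sdepth X (residue_module X (Ipow i))" for n
  proof -
    obtain i where i: "i \<in> {1..n}" "(MIN i \<in> {1..n}. sdepth X (residue_module X (Ipow i)) + krull_dim (B Quot J)) =
        sdepth X (residue_module X (Ipow i)) + krull_dim (B Quot J)" using attained[OF n] by blast
    have "depth XY (residue_module XY (IJ n)) \<le> depth X (residue_module X (Ipow i)) + krull_dim (B Quot J)"
      by (rule dle[OF n i(1)])
    also have "\<dots> \<le> sdepth X (residue_module X (Ipow i)) + krull_dim (B Quot J)"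
      using le i(1) by (intro add_right_mono) blast
    also have "\<dots> \<le> sdepth XY (residue_module XY (IJ n))" using lower[OF n] unfolding i(2) .
    finally show ?thesis .
  qed
  have sd1: "depth XY (residue_module XY (IJ n)) \<le> sdepth XY (residue_module XY (IJ n)) + 1"
    if n: "n \<ge> 1" and le: "\<forall>i \<in> {1..n}. depth X (residue_module X (Ipow i)) \<le> sdepth X (residue_module X (Ipow i)) + 1" for n
  proof -
    obtain i where i: "i \<in> {1..n}" "(MIN i \<in> {1..n}. sdepth X (residue_module X (Ipow i)) + krull_dim (B Quot J)) =
        sdepth X (residue_module X (Ipow i)) + krull_dim (B Quot J)" using attained[OF n] by blast
    have "depth XY (residue_module XY (IJ n)) \<le> depth X (residue_module X (Ipow i)) + krull_dim (B Quot J)"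
      by (rule dle[OF n i(1)])
    also have "\<dots> \<le> (sdepth X (residue_module X (Ipow i)) + 1) + krull_dim (B Quot J)"
      using le i(1) by (intro add_right_mono) blast
    also have "\<dots> = (sdepth X (residue_module X (Ipow i)) + krull_dim (B Quot J)) + 1" by (simp add: ac_simps)
    also have "\<dots> \<le> sdepth XY (residue_module XY (IJ n)) + 1"
      using lower[OF n] unfolding i(2) by (rule add_right_mono)
    finally show ?thesis .
  qed
  have antimono: "sdepth XY (residue_module XY (IJ (n + 1))) \<le> sdepth XY (residue_module XY (IJ n))"
    "sdepth XY (ideal_module (IJ (n + 1))) \<le> sdepth XY (ideal_module (IJ n))"
    "sdepth XY (quotient_module (ideal_module (IJ (n + 1))) (IJ (n + 2)))
      \<le> sdepth XY (quotient_module (ideal_module (IJ n)) (IJ (n + 1)))" for n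
    using cone_depth_complement_antimono[of n] cone_depth_E_antimono[of n] cone_depth_quotient_antimono[of n]
      sQ[of n] sQ[of "Suc n"] unfolding sR sI by simp_all
  have "\<exists>c. \<forall>\<^sub>F n in sequentially. sdepth XY (residue_module XY (IJ n)) = c"
    "\<exists>c. \<forall>\<^sub>F n in sequentially. sdepth XY (ideal_module (IJ n)) = c"
    "\<exists>c. \<forall>\<^sub>F n in sequentially. sdepth XY (quotient_module (ideal_module (IJ n)) (IJ (n + 1))) = c"
    using antimono by (auto intro!: eventually_const_enat simp: numeral_2_eq_2)
  then show ?thesis using main lower upper sd sd1 antimono by blast
qed

end
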